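(* Let $G$ be a Matsubara graph with $V$ vertices and $I$ lines (with a chosen orientation of each line). Let $\{q_i\}$, $i=1,\dots,I$, be the set of positive real values associated to the lines of $G$ and let $\{N_v\}$, $v=1,\dots,V$, be the set of integer values associated to the vertices of $G$, with $\sum_{v=1}^{V}N_v=0$. Then the Matsubara sum of $G$ can be explicitly evaluated as $$S_G(\{N_v\},\{q_i\})=\hat{\mathcal O}_G(\{q_i\})\,I_G(\{N_v\},\{q_i\}),$$ where $$\hat{\mathcal O}_G(\{q_i\})=\prod_{i=1}^{I}\bigl[1+n_b(q_i)\,(1-\hat R_i)\bigr]$$ and $I_G(\{N_v\},\{q_i\})$ is the Matsubara integral of $G$.
   Context: **Matsubara graph.** A connected finite multigraph $G$ with $V$ vertices and $I$ lines (edges), such that every line joins two different vertices (no line joins a vertex to itself) and every vertex is an endpoint of at least two different lines; a pair of vertices may be joined by more than one line. **Data.** Choose an orientation of each line $i$. To line $i$ attach a real $q_i>0$ and an integer summation variable $n_i$; to each vertex $v$ attach an integer $N_v$ and $T_v:=\sum_i s^v_i n_i$, where $s^v_i=+1$ if line $i$ is oriented into $v$, $-1$ if it is oriented away from $v$, and $0$ if it is not incident on $v$. **Matsubara sum.** $$S_G(\{N_v\},\{q_i\}):=\sum_{n_1=-\infty}^{\infty}\cdots\sum_{n_I=-\infty}^{\infty}\frac{\delta_G(n;N)}{\prod_{i=1}^I(n_i^2+q_i^2)},\qquad \delta_G(n;N)=\prod_{v=1}^V\delta_{T_v,N_v}\quad\text{(Kronecker deltas)}.$$ **Matsubara integral.**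 $I_G(\{N_v\},\{q_i\})$ is obtained from $S_G$ by replacing the integer variables $n_i$ by real variables $x_i$ and the sums by integrals over $(-\infty,\infty)$, the constraints being imposed by Dirac deltas for the $V-1$ independent vertex equations. Explicitly: for any spanning tree $\mathcal T$ of $G$, the equations $\sum_i s^v_ix_i=N_v$ $(v=1,\dots,V)$ determine the $x_j$, $j\in\mathcal T$, as affine functions of the $x_l$, $l\notin\mathcal T$, and $$I_G=\int_{\mathbb R^{L}}\ \prod_{i=1}^I\frac1{x_i^2+q_i^2}\ \prod_{l\notin\mathcal T}dx_l,\qquad L=I-V+1.$$ The operators below act on the evaluation of this integral, i.e. on the explicit closed-form expression (rational in the $q_i$) that it equals for positive $q_i$, and not on the integrand. **Kernel and operators.** $n_b(z)=\dfrac1{e^{2\pi z}-1}$. The reflection operator $\hat R_i$ acts on functions of $(q_1,\dots,q_I)$ by $(\hat R_if)(q_1,\dots,q_i,\dots,q_I)=f(q_1,\dots,-q_i,\dots,q_I)$. In $n_b(q_i)(1-\hat R_i)$ the factor $n_b(q_i)$ is a multiplication operator applied after $1-\hat R_i$.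
   Formalization: For some positive q_i a reflected closed form has a pole (two lines, N=0, q_1=q_2), so the right-hand side is undefined; equality is stated where all reflected values of the closed form are defined, and for every positive q the sum is the limit of the right-hand side through such points. *)

theory Defs
  imports "HOL-Analysis.Analysis" "Graph_Theory.Digraph_Component"
begin

text \<open>
  A multigraph together with a choice of orientation of its lines is a digraph in which parallel
  arcs are allowed; the arcs are the lines. The predicate \<open>Digraph_Component.connected\<close> refers to
  the underlying undirected graph.

  The type of lines is finite so that the parameters \<open>q\<close> form a vector in a Euclidean space, on which
  polynomial functions are available. Coordinates outside \<open>arcs G\<close> play no role.
\<close>

locale matsubara_graph = fin_digraph G + loopfree_digraph G
  for G :: "('v, 'e) pre_digraph" (structure) +
  assumes connected_graph: "Digraph_Component.connected G"
    and two_lines: "v \<in> verts G \<Longrightarrow> 2 \<le> card {e \<in> arcs G. tail G e = v \<or> head G e = v}"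

text \<open>
  The library notions of forest and tree exclude directed cycles only, so a spanning tree of the
  underlying undirected multigraph has to be defined here. Two parallel lines form a cycle of
  length 2.
\<close>

definition undirected_cycle :: "('v, 'e) pre_digraph \<Rightarrow> 'v list \<Rightarrow> 'e list \<Rightarrow> bool" where
  "undirected_cycle G vs es \<longleftrightarrow>
     es \<noteq> [] \<and> length vs = length es \<and> distinct vs \<and> distinct es \<and> set es \<subseteq> arcs G \<and>
     (\<forall>k < length es. {tail G (es ! k), head G (es ! k)} = {vs ! k, vs ! (Suc k mod length es)})"

definition spanning_tree_lines :: "('v, 'e) pre_digraph \<Rightarrow> 'e set \<Rightarrow> bool" where
  "spanning_tree_lines G T \<longleftrightarrow>
     T \<subseteq> arcs G \<and> Digraph_Component.connected (G\<lparr>arcs := T\<rparr>) \<and>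
     \<not> (\<exists>vs es. undirected_cycle (G\<lparr>arcs := T\<rparr>) vs es)"

definition incidence :: "('v, 'e) pre_digraph \<Rightarrow> 'v \<Rightarrow> 'e \<Rightarrow> int" where
  "incidence G v i = (if head G i = v then 1 else if tail G i = v then - 1 else 0)"


definition matsubara_summand ::
    "('v, 'e::finite) pre_digraph \<Rightarrow> ('v \<Rightarrow> int) \<Rightarrow> real ^ 'e \<Rightarrow> ('e \<Rightarrow> int) \<Rightarrow> real" where
  "matsubara_summand G N q n =
     (\<Prod>v\<in>verts G. of_bool ((\<Sum>i\<in>arcs G. incidence G v i * n i) = N v)) /
     (\<Prod>i\<in>arcs G. (real_of_int (n i))\<^sup>2 + (q $ i)\<^sup>2)"

text \<open>The summands are nonnegative, so the unordered sum is the iterated one.\<close>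

definition matsubara_sum ::
    "('v, 'e::finite) pre_digraph \<Rightarrow> ('v \<Rightarrow> int) \<Rightarrow> real ^ 'e \<Rightarrow> real" where
  "matsubara_sum G N q = (\<Sum>\<^sub>\<infinity>n \<in> arcs G \<rightarrow>\<^sub>E UNIV. matsubara_summand G N q n)"


text \<open>
  The solution of the vertex equations with prescribed values \<open>y\<close> on the lines outside the spanning
  tree; it is unique when the sum of \<open>N\<close> is zero.
\<close>

definition tree_solution ::
    "('v, 'e) pre_digraph \<Rightarrow> ('v \<Rightarrow> int) \<Rightarrow> 'e set \<Rightarrow> ('e \<Rightarrow> real) \<Rightarrow> 'e \<Rightarrow> real" where
  "tree_solution G N T y = (THE x. x \<in> extensional (arcs G) \<and>
     (\<forall>l \<in> arcs G - T. x l = y l) \<and>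
     (\<forall>v \<in> verts G. (\<Sum>i\<in>arcs G. real_of_int (incidence G v i) * x i) = real_of_int (N v)))"

definition matsubara_integrand ::
    "('v, 'e::finite) pre_digraph \<Rightarrow> ('v \<Rightarrow> int) \<Rightarrow> 'e set \<Rightarrow> real ^ 'e \<Rightarrow> ('e \<Rightarrow> real) \<Rightarrow> real" where
  "matsubara_integrand G N T q y =
     (\<Prod>i\<in>arcs G. 1 / ((tree_solution G N T y i)\<^sup>2 + (q $ i)\<^sup>2))"

definition matsubara_integral ::
    "('v, 'e::finite) pre_digraph \<Rightarrow> ('v \<Rightarrow> int) \<Rightarrow> 'e set \<Rightarrow> real ^ 'e \<Rightarrow> real" where
  "matsubara_integral G N T q =
     (\<integral>y. matsubara_integrand G N T q y \<partial>(Pi\<^sub>M (arcs G - T) (\<lambda>_. lborel)))"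

text \<open>
  \<open>P / Q\<close> is a closed form of the integral: a rational function equal to it for positive \<open>q\<close>. The
  reflection operators act on this function, which is also defined for negative arguments; the
  integral itself is even in each \<open>q $ i\<close>.
\<close>

definition closed_form ::
    "('v, 'e::finite) pre_digraph \<Rightarrow> ('v \<Rightarrow> int) \<Rightarrow> 'e set \<Rightarrow>
     (real ^ 'e \<Rightarrow> real) \<Rightarrow> (real ^ 'e \<Rightarrow> real) \<Rightarrow> bool" where
  "closed_form G N T P Q \<longleftrightarrow>
     real_polynomial_function P \<and> real_polynomial_function Q \<and>
     (\<forall>q. (\<forall>i\<in>arcs G. 0 < q $ i) \<longrightarrow> Q q \<noteq> 0 \<and> matsubara_integral G N T q = P q / Q q)"


definition bose :: "real \<Rightarrow> real" where
  "bose z = 1 / (exp (2 * pi * z) - 1)"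

definition flip_signs :: "'e set \<Rightarrow> real ^ 'e \<Rightarrow> real ^ 'e" where
  "flip_signs A q = (\<chi> j. if j \<in> A then - (q $ j) else q $ j)"

definition reflection :: "'e \<Rightarrow> (real ^ 'e \<Rightarrow> real) \<Rightarrow> real ^ 'e \<Rightarrow> real" where
  "reflection i f = (\<lambda>q. f (flip_signs {i} q))"

definition line_operator :: "'e \<Rightarrow> (real ^ 'e \<Rightarrow> real) \<Rightarrow> real ^ 'e \<Rightarrow> real" where
  "line_operator i f = (\<lambda>q. f q + bose (q $ i) * (f q - reflection i f q))"

text \<open>
  The product (composition) of the line operators over all lines. They commute, so the order in
  which \<open>Finite_Set.fold\<close> applies them does not matter.
\<close>

definition matsubara_operator ::
    "('v, 'e) pre_digraph \<Rightarrow> (real ^ 'e \<Rightarrow> real) \<Rightarrow> real ^ 'e \<Rightarrow> real" where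
  "matsubara_operator G f = Finite_Set.fold line_operator f (arcs G)"

lemma flip_signs_commute: "flip_signs A (flip_signs B q) = flip_signs B (flip_signs A q)"
  by (simp add: flip_signs_def vec_eq_iff)

lemma line_operator_commute:
  "line_operator i (line_operator j f) = line_operator j (line_operator i f)"
proof (cases "i = j")
  case False
  then have "flip_signs {i} q $ j = q $ j" "flip_signs {j} q $ i = q $ i" for q :: "real ^ 'a"
    by (auto simp: flip_signs_def)
  then show ?thesis
    by (simp add: line_operator_def reflection_def flip_signs_commute[of "{j}" "{i}"]
        algebra_simps fun_eq_iff)
qed simp

lemma comp_fun_commute_line_operator: "comp_fun_commute line_operator"
  by unfold_locales (simp add: fun_eq_iff line_operator_commute)

text \<open>
  The points at which every reflected value of a function with denominator \<open>Q\<close> is defined. For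
  example, for two vertices joined by two lines and \<open>N = 0\<close> the integral is
  \<open>pi / (q1 * q2 * (q1 + q2))\<close>, and its reflections have a pole at \<open>q1 = q2\<close>, although the
  singularities cancel after applying the full operator.
\<close>

definition regular_points ::
    "('v, 'e) pre_digraph \<Rightarrow> (real ^ 'e \<Rightarrow> real) \<Rightarrow> (real ^ 'e) set" where
  "regular_points G Q = {q. \<forall>A \<subseteq> arcs G. Q (flip_signs A q) \<noteq> 0}"

end

theory Submission
  imports Defs "HOL-Combinatorics.Multiset_Permutations"
begin

text \<open>
  For \<open>\<bar>x\<bar> \<le> 2 * pi\<close> the Fourier series of \<open>1 / (n\<^sup>2 + q\<^sup>2)\<close> is
  \<open>pi / q * ((1 + bose q) * exp (- q * \<bar>x\<bar>) + bose q * exp (q * \<bar>x\<bar>))\<close>, so the Matsubara sum is an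
  integral over a torus of one angle per vertex, with one root vertex held at \<open>0\<close>, and expanding the
  product over the lines gives one exponential integrand for each set \<open>A\<close> of reflected lines. The
  torus splits into the simplices of linearly ordered angles, on which the integrand is the
  exponential of a linear form, and the integral over a simplex is a divided difference of \<open>exp\<close>.
  Its terms belong to the vertices of the simplex, that is, to the positions at which the root is
  inserted in a cyclic order of the graph vertices; the term at a given position carries a factor
  \<open>exp (- 2 * pi * q i)\<close> for each line \<open>i\<close> of a cut, which by
  \<open>exp (2 * pi * q) * bose q = 1 + bose q\<close> is absorbed by reflecting the lines of the cut. Hence the
  sum equals the operator applied to the time-ordered expression
  \<open>pi ^ I / (2 * pi) ^ (V - 1) * (\<Prod>i. 1 / q i) * (\<Sum>\<sigma>. \<Prod>k. 1 / E k)\<close>, where \<open>\<sigma>\<close> runs over the linear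
  orders of the vertices and \<open>E k\<close> is the energy of the cut behind the first \<open>k\<close> vertices. That this
  expression is the Matsubara integral follows from the same identity: the integral is the limit of
  the rescaled Riemann sums, which are Matsubara sums with data \<open>M * N\<close> and \<open>M * q\<close>, and
  \<open>bose (M * q)\<close> tends to \<open>0\<close>. Both sides of the theorem are continuous in \<open>q\<close>, so points at which some
  cut energy vanishes after a reflection can be avoided.
\<close>


section \<open>Infinite sums and integrals\<close>

text \<open>The operators act on a rational expression: the integral itself is even in each
  \<open>q $ i\<close>, so \<open>1 - R\<close> would annihilate it. Agreement of values at positive
  \<open>q\<close> is therefore not enough; the time-ordered expression must be valid as a rational
  function at all reflected arguments. The bridge is that a polynomial vanishing on the open
  positive orthant vanishes identically. This also makes the right-hand side independent of the
  closed form chosen, and it shows that the time-ordered expression is real although its terms are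
  complex. The integral is not evaluated by residues. The identity for the sum is already available,
  and scaling \<open>N\<close> and \<open>q\<close> by \<open>M\<close> removes all reflected terms
  in the limit. The powers of \<open>M\<close> match because the time-ordered expression is
  homogeneous of degree \<open>- (I + V - 1)\<close> in \<open>N\<close> and \<open>q\<close>
  together and a spanning tree has \<open>V - 1\<close> lines. Integrality of \<open>N\<close> makes
  the phase collected by a turn around the torus equal to 1, so that the factor to be absorbed is
  real. Divided differences need distinct nodes, which is the origin of the condition
  \<open>generic\<close>.\<close>

lemma has_sum_integral:
  fixes f :: "'i \<Rightarrow> 'a \<Rightarrow> 'b :: {banach, second_countable_topology}"
  assumes "countable A"
    and int: "\<And>i. i \<in> A \<Longrightarrow> integrable M (f i)"
    and pt: "\<And>x. x \<in> space M \<Longrightarrow> (\<lambda>i. norm (f i x)) summable_on A"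
    and le: "\<And>i. i \<in> A \<Longrightarrow> (\<integral>x. norm (f i x) \<partial>M) \<le> c i" and c: "c summable_on A"
  shows "((\<lambda>i. \<integral>x. f i x \<partial>M) has_sum (\<integral>x. (\<Sum>\<^sub>\<infinity>i\<in>A. f i x) \<partial>M)) A"
proof (cases "finite A")
  case True
  then show ?thesis
    using int by (auto intro!: has_sum_finiteI)
next
  case False
  \<comment> \<open>The infinite case is the theorem on integrals of series, read along an
    enumeration of \<open>A\<close>; absolute convergence makes the result independent of the
    enumeration.\<close>
  define h where "h = from_nat_into A"
  have h: "bij_betw h UNIV A"
    unfolding h_def using \<open>countable A\<close> False by (rule bij_betw_from_nat_into)
  then have hA: "h k \<in> A" for k
    by (auto simp: bij_betw_def)
  have s1: "summable (\<lambda>k. norm (f (h k) x))" if "x \<in> space M" for x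
    using pt[OF that] summable_on_reindex_bij_betw[OF h, of "\<lambda>i. norm (f i x)"]
    by (simp add: summable_on_UNIV_nonneg_real_iff)
  have c0: "c i \<ge> 0" if "i \<in> A" for i
    using le[OF that] by (meson Bochner_Integration.integral_nonneg norm_ge_zero order_trans)
  have "summable (\<lambda>k. c (h k))"
    using c c0 hA summable_on_reindex_bij_betw[OF h, of c]
    by (simp add: summable_on_UNIV_nonneg_real_iff)
  then have s2: "summable (\<lambda>k. \<integral>x. norm (f (h k) x) \<partial>M)"
    by (rule summable_comparison_test_ev[rotated])
       (auto intro!: always_eventually le hA simp: Bochner_Integration.integral_nonneg)
  have 1: "(\<lambda>k. \<integral>x. f (h k) x \<partial>M) sums (\<integral>x. (\<Sum>k. f (h k) x) \<partial>M)"
    using s1 s2 int hA by (intro sums_integral) auto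
  have 2: "(\<Sum>k. f (h k) x) = (\<Sum>\<^sub>\<infinity>i\<in>A. f i x)" if "x \<in> space M" for x
  proof -
    have "(\<lambda>k. f (h k) x) summable_on UNIV"
      by (rule norm_summable_imp_summable_on[OF s1[OF that]])
    then have "(\<lambda>k. f (h k) x) sums (\<Sum>\<^sub>\<infinity>k. f (h k) x)"
      by (intro has_sum_imp_sums has_sum_infsum)
    then show ?thesis
      using infsum_reindex_bij_betw[OF h, of "\<lambda>i. f i x"] by (simp add: sums_iff)
  qed
  have 3: "summable (\<lambda>k. norm (\<integral>x. f (h k) x \<partial>M))"
    by (rule summable_comparison_test'[OF s2]) (auto simp: integral_norm_bound)
  have "((\<lambda>k. \<integral>x. f (h k) x \<partial>M) has_sum (\<integral>x. (\<Sum>k. f (h k) x) \<partial>M)) UNIV"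
    using norm_summable_imp_has_sum[OF 3 1] .
  also have "(\<integral>x. (\<Sum>k. f (h k) x) \<partial>M) = (\<integral>x. (\<Sum>\<^sub>\<infinity>i\<in>A. f i x) \<partial>M)"
    using 2 by (intro Bochner_Integration.integral_cong) auto
  finally show ?thesis
    using has_sum_reindex_bij_betw[OF h, of "\<lambda>i. \<integral>x. f i x \<partial>M"] by simp
qed

lemma summable_on_prod_PiE:
  fixes f :: "'a \<Rightarrow> 'b :: countable \<Rightarrow> real"
  assumes "finite A" and f: "\<And>x. x \<in> A \<Longrightarrow> f x summable_on B x"
    and nonneg: "\<And>x y. x \<in> A \<Longrightarrow> y \<in> B x \<Longrightarrow> 0 \<le> f x y"
  shows "(\<lambda>g. \<Prod>x\<in>A. f x (g x)) summable_on PiE A B"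
proof -
  have "Infinite_Set_Sum.abs_summable_on (f x) (B x)" if "x \<in> A" for x
    unfolding abs_summable_equivalent[symmetric] using f[OF that] summable_on_iff_abs_summable_on_real by auto
  then have "Infinite_Set_Sum.abs_summable_on (\<lambda>g. \<Prod>x\<in>A. f x (g x)) (PiE A B)"
    using \<open>finite A\<close> by (intro abs_summable_on_prod_PiE) auto
  then show ?thesis
    unfolding abs_summable_equivalent[symmetric] by (rule abs_summable_summable)
qed

lemma summable_on_int_inverse_square:
  fixes q :: real
  assumes "q \<noteq> 0"
  shows "(\<lambda>n::int. 1 / ((real_of_int n)\<^sup>2 + q\<^sup>2)) summable_on UNIV"
proof -
  have "summable (\<lambda>n::nat. 1 / ((real n)\<^sup>2 + q\<^sup>2))"
  proof (rule summable_comparison_test_ev[OF _ inverse_power_summable[of 2]])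
    show "\<forall>\<^sub>F n in sequentially. norm (1 / ((real n)\<^sup>2 + q\<^sup>2)) \<le> inverse (real n ^ 2)"
      using eventually_gt_at_top[of 0]
      by eventually_elim (simp add: inverse_eq_divide frac_le)
  qed auto
  then have nat: "(\<lambda>n::nat. 1 / ((real n)\<^sup>2 + q\<^sup>2)) summable_on UNIV"
    by (subst summable_on_UNIV_nonneg_real_iff) auto
  have "(\<lambda>n::int. 1 / ((real_of_int n)\<^sup>2 + q\<^sup>2)) summable_on range int"
    using nat by (subst summable_on_reindex) (auto simp: o_def inj_on_def)
  moreover have "(\<lambda>n::int. 1 / ((real_of_int n)\<^sup>2 + q\<^sup>2)) summable_on range (\<lambda>n. - int n)"
    using nat by (subst summable_on_reindex) (auto simp: o_def inj_on_def)
  ultimately have "(\<lambda>n::int. 1 / ((real_of_int n)\<^sup>2 + q\<^sup>2)) summable_on range int \<union> range (\<lambda>n. - int n)"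
    by (rule summable_on_union)
  also have "range int \<union> range (\<lambda>n. - int n) = UNIV"
    by (auto simp: set_eq_iff image_iff) (metis int_cases2)
  finally show ?thesis .
qed

section \<open>The Fourier series of the propagator\<close>

lemma integral_cos_int:
  "((\<lambda>x. cos (real_of_int k * x)) has_integral (if k = 0 then pi else 0)) {0..pi}"
proof (cases "k = 0")
  case True
  then show ?thesis using has_integral_const_real[of "1::real" 0 pi] by simp
next
  case False
  have "((\<lambda>x. cos (real_of_int k * x)) has_integral
    sin (real_of_int k * pi) / real_of_int k - sin (real_of_int k * 0) / real_of_int k) {0..pi}"
    using False
    by (intro fundamental_theorem_of_calculus)
      (auto intro!: derivative_eq_intros simp: has_real_derivative_iff_has_vector_derivative[symmetric])
  then show ?thesis using False by (simp add: sin_times_pi_eq_0 mult.commute)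
qed

text \<open>Both indicators are 1 for \<open>m = n = 0\<close>, which accounts for the exceptional
  value \<open>pi\<close>.\<close>

lemma integral_cos_mult_cos:
  "((\<lambda>x. cos (real_of_int m * x) * cos (real_of_int n * x)) has_integral
    (pi / 2 * (of_bool (m = n) + of_bool (m = - n)))) {0..pi}"
proof -
  have "((\<lambda>x. (cos (real_of_int (m - n) * x) + cos (real_of_int (m + n) * x)) / 2) has_integral
    ((if m - n = 0 then pi else 0) + (if m + n = 0 then pi else 0)) / 2) {0..pi}"
    by (intro has_integral_divide has_integral_add integral_cos_int)
  then show ?thesis
    by (rule has_integral_eq_rhs[OF has_integral_eq[rotated]])
      (auto simp: cos_times_cos algebra_simps)
qed

text \<open>Up to the factor \<open>pi / q / sinh (q * pi)\<close>, these are the cosine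
  coefficients of the closed form proposed for the propagator series.\<close>

lemma integral_cosh_mult_cos:
  fixes q :: real
  assumes "q > 0"
  shows "((\<lambda>x. cosh (q * (pi - x)) * cos (real_of_int n * x)) has_integral
    (q * sinh (q * pi) / ((real_of_int n)\<^sup>2 + q\<^sup>2))) {0..pi}"
proof -
  define d where "d = (real_of_int n)\<^sup>2 + q\<^sup>2"
  have d: "d > 0" using assms by (auto simp: d_def intro: add_nonneg_pos)
  \<comment> \<open>Antiderivative obtained by integrating by parts twice. At \<open>pi\<close> both
    sines vanish, \<open>sin (n * pi)\<close> and \<open>sinh 0\<close>, so only the lower end
    contributes.\<close>
  define F where "F x = (real_of_int n * cosh (q * (pi - x)) * sin (real_of_int n * x)
    - q * sinh (q * (pi - x)) * cos (real_of_int n * x)) / d" for x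
  have "(F has_real_derivative (cosh (q * (pi - x)) * cos (real_of_int n * x))) (at x within {0..pi})" for x
  proof -
    have "(F has_real_derivative ((q\<^sup>2 + (real_of_int n)\<^sup>2) * (cosh (q * (pi - x)) * cos (real_of_int n * x)) / d)) (at x within {0..pi})"
      unfolding F_def
      by (rule derivative_eq_intros refl | use d in \<open>simp; fail\<close>)+
         (use d in \<open>simp add: field_simps power2_eq_square\<close>)
    then show ?thesis using d assms by (simp add: d_def add.commute)
  qed
  then have "((\<lambda>x. cosh (q * (pi - x)) * cos (real_of_int n * x)) has_integral (F pi - F 0)) {0..pi}"
    by (intro fundamental_theorem_of_calculus) (auto simp: has_real_derivative_iff_has_vector_derivative[symmetric])
  moreover have "F pi - F 0 = q * sinh (q * pi) / d"
    by (simp add: F_def sin_times_pi_eq_0 mult.commute[of "real_of_int n" pi])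
  ultimately show ?thesis by (simp add: d_def)
qed

text \<open>Multiplication by \<open>cos x\<close> averages the frequencies \<open>n - 1\<close> and
  \<open>n + 1\<close>, so the induction over \<open>k\<close> has to leave \<open>n\<close>
  arbitrary.\<close>

lemma cos_moments_zero:
  fixes u :: "real \<Rightarrow> real"
  assumes u: "continuous_on {0..pi} u"
    and 0: "\<And>n::int. integral {0..pi} (\<lambda>x. u x * cos (real_of_int n * x)) = 0"
  shows "integral {0..pi} (\<lambda>x. u x * cos x ^ k * cos (real_of_int n * x)) = 0"
proof (induction k arbitrary: n)
  case 0
  then show ?case using assms by simp
next
  case (Suc k)
  have "integral {0..pi} (\<lambda>x. u x * cos x ^ Suc k * cos (real_of_int n * x)) =
    integral {0..pi} (\<lambda>x. (u x * cos x ^ k * cos (real_of_int (n - 1) * x) + u x * cos x ^ k * cos (real_of_int (n + 1) * x)) / 2)"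
    by (intro integral_cong) (simp add: cos_add cos_diff algebra_simps)
  also have "\<dots> = 0"
    using Suc[of "n - 1"] Suc[of "n + 1"] u by (subst integral_divide, subst integral_add)
      (auto intro!: integrable_continuous_real continuous_intros)
  finally show ?case .
qed

text \<open>Substituting \<open>c = cos x\<close>, this is the Weierstrass approximation theorem on \<open>{-1..1}\<close>.\<close>

lemma cos_coefficients_unique:
  fixes u :: "real \<Rightarrow> real"
  assumes u: "continuous_on {0..pi} u"
    and 0: "\<And>n::int. integral {0..pi} (\<lambda>x. u x * cos (real_of_int n * x)) = 0"
    and x: "x \<in> {0..pi}"
  shows "u x = 0"
proof -
  have int: "(\<lambda>x. u x * f x) integrable_on {0..pi}" if "continuous_on {0..pi} f" for f
    using u that by (intro integrable_continuous_real continuous_intros)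
  have cu: "continuous_on {-1..1} (\<lambda>c. u (arccos c))"
    by (rule continuous_on_compose2[OF u]) (auto intro!: continuous_intros simp: arccos_lbound arccos_ubound)
  have "integral {0..pi} (\<lambda>x. u x * u x) \<le> 0 + e" if "e > 0" for e
  proof -
    define B where "B = integral {0..pi} (\<lambda>x. \<bar>u x\<bar>)"
    have B: "B \<ge> 0"
      unfolding B_def by (intro integral_nonneg integrable_continuous_real continuous_intros u) auto
    \<comment> \<open>\<open>u\<close> is orthogonal to every polynomial in \<open>cos x\<close>, so
      its square integral is at most \<open>B\<close> times the approximation error. The summand 1
      keeps the denominator positive when \<open>B = 0\<close>.\<close>
    define d where "d = e / (B + 1)"
    have d: "d > 0" "d * B \<le> e"
      using that B by (auto simp: d_def field_simps)
    obtain p where p: "real_polynomial_function p" "\<And>c. c \<in> {-1..1} \<Longrightarrow> \<bar>u (arccos c) - p c\<bar> < d"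
      using Stone_Weierstrass_real_polynomial_function[OF compact_Icc cu d(1)] by blast
    then obtain a n where a: "p = (\<lambda>x. \<Sum>i\<le>n. a i * x ^ i)"
      using real_polynomial_function_imp_sum by blast
    have cp: "continuous_on {0..pi} (\<lambda>x. p (cos x))"
      unfolding a by (intro continuous_intros)
    have "integral {0..pi} (\<lambda>x. u x * p (cos x)) = integral {0..pi} (\<lambda>x. \<Sum>i\<le>n. a i * (u x * cos x ^ i * cos (real_of_int 0 * x)))"
      unfolding a by (intro integral_cong) (simp add: sum_distrib_left mult_ac)
    also have "\<dots> = (\<Sum>i\<le>n. a i * integral {0..pi} (\<lambda>x. u x * cos x ^ i * cos (real_of_int 0 * x)))"
      using u by (subst integral_sum) (auto intro!: integrable_continuous_real continuous_intros)
    also have "\<dots> = 0" using cos_moments_zero[OF u 0, of _ 0] by simp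
    finally have 1: "integral {0..pi} (\<lambda>x. u x * p (cos x)) = 0" .
    have "integral {0..pi} (\<lambda>x. u x * u x) = integral {0..pi} (\<lambda>x. u x * (u x - p (cos x)))"
      using 1 by (simp add: right_diff_distrib integral_diff int u cp)
    also have "\<dots> \<le> integral {0..pi} (\<lambda>x. d * \<bar>u x\<bar>)"
    proof (intro integral_le)
      fix x assume x: "x \<in> {0..pi}"
      have "\<bar>u x - p (cos x)\<bar> \<le> d"
        using p(2)[of "cos x"] x by (simp add: arccos_cos)
      then have "\<bar>u x * (u x - p (cos x))\<bar> \<le> d * \<bar>u x\<bar>"
        using mult_right_mono[of "\<bar>u x - p (cos x)\<bar>" d "\<bar>u x\<bar>"] by (simp add: abs_mult mult_ac)
      then show "u x * (u x - p (cos x)) \<le> d * \<bar>u x\<bar>" by linarith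
    qed (use u cp in \<open>auto intro!: integrable_continuous_real continuous_intros\<close>)
    also have "\<dots> \<le> e" using d by (simp add: B_def)
    finally show ?thesis by simp
  qed
  then have "integral {0..pi} (\<lambda>x. u x * u x) \<le> 0"
    by (rule field_le_epsilon)
  moreover have "integral {0..pi} (\<lambda>x. u x * u x) \<ge> 0"
    by (intro integral_nonneg int u) auto
  ultimately have "integral {0..pi} (\<lambda>x. u x * u x) = 0" by simp
  then have "\<forall>x\<in>{0..pi}. u x * u x = 0"
    using u by (subst (asm) integral_eq_0_iff) (auto intro!: continuous_intros)
  then show ?thesis using x by auto
qed

lemma propagator_bound:
  fixes q :: real
  assumes "\<bar>c\<bar> \<le> 1"
  shows "\<bar>c / ((real_of_int m)\<^sup>2 + q\<^sup>2)\<bar> \<le> 1 / ((real_of_int m)\<^sup>2 + q\<^sup>2)"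
  using assms by (auto simp: abs_div intro!: divide_right_mono)

text \<open>Uniform convergence makes the series continuous and allows termwise integration against
  cosines. Both sides then have the same cosine coefficients and agree at every point, including the
  end points.\<close>

lemma infsum_cos_half_period:
  fixes q :: real
  assumes q: "q > 0" and x: "x \<in> {0..pi}"
  shows "(\<Sum>\<^sub>\<infinity>n::int. cos (real_of_int n * x) / ((real_of_int n)\<^sup>2 + q\<^sup>2)) = pi / q * cosh (q * (pi - x)) / sinh (q * pi)"
proof -
  define D where "D m = (real_of_int m)\<^sup>2 + q\<^sup>2" for m
  have D: "D m > 0" for m using q by (auto simp: D_def intro: add_nonneg_pos)
  have Dsum: "(\<lambda>m. 1 / D m) summable_on UNIV"
    using summable_on_int_inverse_square[of q] q by (simp add: D_def)
  define g where "g x = (\<Sum>\<^sub>\<infinity>m. cos (real_of_int m * x) / D m)" for x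
  define h where "h x = pi / q * cosh (q * (pi - x)) / sinh (q * pi)" for x
  \<comment> \<open>The bounded factor \<open>f\<close> lets one M-test serve twice: with
    \<open>f = 1\<close> for the continuity of \<open>g\<close>, and with a cosine for the
    coefficients.\<close>
  have unif: "uniform_limit {0..pi} (\<lambda>X x. \<Sum>m\<in>X. cos (real_of_int m * x) / D m * f x)
      (\<lambda>x. g x * f x) (finite_subsets_at_top UNIV)" if f: "\<And>x. \<bar>f x\<bar> \<le> 1" for f
  proof -
    have "uniform_limit {0..pi} (\<lambda>X x. \<Sum>m\<in>X. cos (real_of_int m * x) / D m * f x)
      (\<lambda>x. \<Sum>\<^sub>\<infinity>m. cos (real_of_int m * x) / D m * f x) (finite_subsets_at_top UNIV)"
    proof (rule Weierstrass_m_test_general[OF _ Dsum])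
      fix m x
      have "\<bar>cos (real_of_int m * x) * f x\<bar> \<le> 1"
        using f[of x] abs_cos_le_one[of "real_of_int m * x"] by (simp add: abs_mult mult_le_one)
      from propagator_bound[OF this, of m q]
      show "norm (cos (real_of_int m * x) / D m * f x) \<le> 1 / D m" by (simp add: D_def)
    qed
    moreover have "(\<Sum>\<^sub>\<infinity>m. cos (real_of_int m * x) / D m * f x) = g x * f x" for x
      unfolding g_def by (rule infsum_cmult_left')
    ultimately show ?thesis by (simp only:)
  qed
  have cg: "continuous_on {0..pi} g"
  proof (rule uniform_limit_theorem)
    show "uniform_limit {0..pi} (\<lambda>X x. \<Sum>m\<in>X. cos (real_of_int m * x) / D m) g (finite_subsets_at_top UNIV)"
      using unif[of "\<lambda>_. 1"] by simp
    show "\<forall>\<^sub>F X in finite_subsets_at_top UNIV. continuous_on {0..pi} (\<lambda>x. \<Sum>m\<in>X. cos (real_of_int m * x) / D m)"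
      using D by (intro always_eventually allI continuous_intros) (auto simp: less_imp_neq[THEN not_sym])
  qed auto
  have ig: "integral {0..pi} (\<lambda>x. g x * cos (real_of_int n * x)) = pi / D n" for n
  proof -
    let ?c = "\<lambda>m. pi / 2 * (of_bool (m = n) + of_bool (m = - n)) / D m"
    let ?f = "\<lambda>X x. \<Sum>m\<in>X. cos (real_of_int m * x) / D m * cos (real_of_int n * x)"
    have "continuous_on {0..pi} (?f X)" for X
      using D by (intro continuous_intros) (auto simp: less_imp_neq[THEN not_sym])
    then obtain I J where IJ: "\<And>X. (?f X has_integral I X) {0..pi}"
      "((\<lambda>x. g x * cos (real_of_int n * x)) has_integral J) {0..pi}" "(I \<longlongrightarrow> J) (finite_subsets_at_top UNIV)"
      using uniform_limit_integral[OF unif[of "\<lambda>x. cos (real_of_int n * x)"]] by (auto simp: abs_cos_le_one)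
    have "(?f X has_integral (\<Sum>m\<in>X. ?c m)) {0..pi}" if "finite X" for X
    proof (rule has_integral_sum[OF that])
      fix m
      show "((\<lambda>x. cos (real_of_int m * x) / D m * cos (real_of_int n * x)) has_integral ?c m) {0..pi}"
        using has_integral_divide[OF integral_cos_mult_cos[of m n], of "D m"] by simp
    qed
    then have "I X = (\<Sum>m\<in>X. ?c m)" if "finite X" for X
      using IJ(1)[of X] that has_integral_unique by blast
    then have "\<forall>\<^sub>F X in finite_subsets_at_top UNIV. I X = (\<Sum>m\<in>X. ?c m)"
      by (simp add: eventually_finite_subsets_at_top_weakI)
    with IJ(3) have "((\<lambda>X. \<Sum>m\<in>X. ?c m) \<longlongrightarrow> integral {0..pi} (\<lambda>x. g x * cos (real_of_int n * x))) (finite_subsets_at_top UNIV)"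
      unfolding integral_unique[OF IJ(2)] by (rule Lim_transform_eventually)
    then have hs1: "(?c has_sum integral {0..pi} (\<lambda>x. g x * cos (real_of_int n * x))) UNIV"
      by (simp add: has_sum_def)
    \<comment> \<open>By orthogonality only the indices \<open>n\<close> and \<open>- n\<close>
      contribute. For \<open>n = 0\<close> the set has one element, and its coefficient counts
      double.\<close>
    have hs2: "(?c has_sum (\<Sum>m\<in>{n, -n}. ?c m)) UNIV"
    proof -
      have "(?c has_sum (\<Sum>m\<in>{n, -n}. ?c m)) {n, -n}" by (rule has_sum_finite) simp
      then show ?thesis by (subst (asm) has_sum_cong_neutral[of UNIV "{n, -n}" ?c ?c]) auto
    qed
    moreover have "(\<Sum>m\<in>{n, -n}. ?c m) = pi / D n"
    proof -
      have "D (- n) = D n" by (simp add: D_def)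
      then show ?thesis using D[of n] by (cases "n = 0") (auto simp: field_simps)
    qed
    ultimately show ?thesis using has_sum_unique[OF hs1 hs2] by simp
  qed
  have ih: "((\<lambda>x. h x * cos (real_of_int n * x)) has_integral pi / D n) {0..pi}" for n
    using has_integral_mult_right[OF integral_cosh_mult_cos[OF q, of n], of "pi / q / sinh (q * pi)"] q
    by (simp add: h_def D_def mult_ac)
  have ch: "continuous_on {0..pi} h"
    using q unfolding h_def by (auto intro!: continuous_intros)
  have "g x - h x = 0"
  proof (rule cos_coefficients_unique[OF _ _ x])
    show "continuous_on {0..pi} (\<lambda>x. g x - h x)" by (intro continuous_intros cg ch)
    show "integral {0..pi} (\<lambda>x. (g x - h x) * cos (real_of_int n * x)) = 0" for n
      unfolding left_diff_distrib
      by (subst integral_diff) (auto intro!: integrable_continuous_real continuous_intros cg ch simp: ig integral_unique[OF ih])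
  qed
  then show ?thesis by (simp add: g_def h_def D_def)
qed

lemma bose_cosh_sinh:
  assumes "q > 0"
  shows "cosh (q * (pi - x)) / sinh (q * pi) = (1 + bose q) * exp (- q * x) + bose q * exp (q * x)"
proof -
  define E where "E = exp (q * pi)"
  define X where "X = exp (q * x)"
  have E: "E > 1" using assms by (simp add: E_def)
  have X: "X > 0" by (simp add: X_def)
  have "E * E > 1" using E by (metis less_1_mult)
  have e: "exp (q * (pi - x)) = E / X" "exp (- (q * (pi - x))) = X / E" "exp (- (q * pi)) = 1 / E"
    "exp (- q * x) = 1 / X" "exp (2 * pi * q) = E * E"
    by (simp_all add: E_def X_def right_diff_distrib exp_diff exp_minus inverse_eq_divide mult_exp_exp)
  have c: "cosh (q * (pi - x)) = (E / X + X / E) / 2" and s: "sinh (q * pi) = (E - 1 / E) / 2"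
    unfolding cosh_def sinh_def e E_def[symmetric] by simp_all
  have b: "bose q = 1 / (E * E - 1)"
    unfolding bose_def e ..
  show ?thesis
    unfolding c s b X_def[symmetric] e
    using E X \<open>E * E > 1\<close> by (simp add: divide_simps) (simp add: algebra_simps)
qed

text \<open>Pairing \<open>n\<close> with \<open>- n\<close> leaves a cosine series. It is invariant
  under exchanging \<open>x\<close> and \<open>2 * pi - x\<close>, as is
  \<open>cosh (q * (pi - x))\<close>, so the half period determines the whole range of differences
  of two angles between 0 and \<open>2 * pi\<close>.\<close>

lemma infsum_cis_propagator:
  fixes q :: real
  assumes q: "q > 0" and x: "\<bar>x\<bar> \<le> 2 * pi"
  shows "(\<Sum>\<^sub>\<infinity>n::int. cis (real_of_int n * x) / complex_of_real ((real_of_int n)\<^sup>2 + q\<^sup>2)) =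
    complex_of_real (pi / q * ((1 + bose q) * exp (- q * \<bar>x\<bar>) + bose q * exp (q * \<bar>x\<bar>)))"
proof -
  define D where "D m = (real_of_int m)\<^sup>2 + q\<^sup>2" for m
  have Dsum: "(\<lambda>m. 1 / D m) summable_on UNIV"
    using summable_on_int_inverse_square[of q] q by (simp add: D_def)
  define f where "f n = cis (real_of_int n * x) / complex_of_real (D n)" for n
  have "D n \<ge> 0" for n by (simp add: D_def)
  then have norm_f: "norm (f n) = 1 / D n" for n by (simp add: f_def norm_divide)
  have f: "f summable_on UNIV"
    by (rule abs_summable_summable) (simp add: norm_f Dsum)
  have f': "(\<lambda>n. f (- n)) summable_on UNIV" and f'': "infsum (\<lambda>n. f (- n)) UNIV = infsum f UNIV"
    using summable_on_reindex_bij_betw[of uminus UNIV UNIV f] infsum_reindex_bij_betw[of uminus UNIV UNIV f] f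
    by (auto simp: bij_uminus)
  have "2 * infsum f UNIV = infsum (\<lambda>n. f n + f (- n)) UNIV"
    using infsum_add[OF f f'] f'' by simp
  also have "\<dots> = infsum (\<lambda>n. complex_of_real (2 * (cos (real_of_int n * \<bar>x\<bar>) / D n))) UNIV"
  proof (intro infsum_cong)
    fix n
    have "cos (real_of_int n * \<bar>x\<bar>) = cos (real_of_int n * x)" by (cases "x \<ge> 0") auto
    then show "f n + f (- n) = complex_of_real (2 * (cos (real_of_int n * \<bar>x\<bar>) / D n))"
      by (simp add: f_def D_def complex_eq_iff Re_divide_of_real Im_divide_of_real)
  qed
  also have "\<dots> = 2 * complex_of_real (\<Sum>\<^sub>\<infinity>n. cos (real_of_int n * \<bar>x\<bar>) / D n)"
  proof -
    have "(\<lambda>n. cos (real_of_int n * \<bar>x\<bar>) / D n) summable_on UNIV"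
    proof (rule abs_summable_summable, rule summable_on_comparison_test[OF Dsum])
      show "norm (cos (real_of_int n * \<bar>x\<bar>) / D n) \<le> 1 / D n" for n
        using propagator_bound[of "cos (real_of_int n * \<bar>x\<bar>)" n q] by (simp add: D_def)
    qed auto
    then have "((\<lambda>n. complex_of_real (2 * (cos (real_of_int n * \<bar>x\<bar>) / D n))) has_sum
      complex_of_real (2 * (\<Sum>\<^sub>\<infinity>n. cos (real_of_int n * \<bar>x\<bar>) / D n))) UNIV"
      by (intro has_sum_of_real has_sum_cmult_right has_sum_infsum)
    then show ?thesis by (simp add: infsumI)
  qed
  finally have 1: "infsum f UNIV = complex_of_real (\<Sum>\<^sub>\<infinity>n. cos (real_of_int n * \<bar>x\<bar>) / D n)" by simp
  have "(\<Sum>\<^sub>\<infinity>n. cos (real_of_int n * \<bar>x\<bar>) / D n) = pi / q * (cosh (q * (pi - \<bar>x\<bar>)) / sinh (q * pi))"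
  proof (cases "\<bar>x\<bar> \<le> pi")
    case True
    then show ?thesis using infsum_cos_half_period[OF q, of "\<bar>x\<bar>"] by (simp add: D_def)
  next
    case False
    have "cos (real_of_int n * \<bar>x\<bar>) = cos (real_of_int n * (2 * pi - \<bar>x\<bar>))" for n
      using cos_int_2pin[of n] sin_int_2pin[of n] by (simp add: right_diff_distrib cos_diff mult_ac)
    moreover have "cosh (q * (pi - (2 * pi - \<bar>x\<bar>))) = cosh (q * (pi - \<bar>x\<bar>))"
      using cosh_minus[of "q * (pi - \<bar>x\<bar>)"] by (simp add: algebra_simps)
    ultimately show ?thesis using infsum_cos_half_period[OF q, of "2 * pi - \<bar>x\<bar>"] False x by (simp add: D_def)
  qed
  then show ?thesis
    using 1 bose_cosh_sinh[OF q, of "\<bar>x\<bar>"] unfolding f_def D_def by (simp only:)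
qed

section \<open>Zeros of polynomial functions\<close>

lemma real_polynomial_function_line:
  fixes p :: "'a::euclidean_space \<Rightarrow> real"
  assumes "real_polynomial_function p"
  shows "real_polynomial_function (\<lambda>t::real. p (a + t *\<^sub>R b))"
proof -
  have "polynomial_function (\<lambda>t::real. a + t *\<^sub>R b)"
    by (intro polynomial_function_add polynomial_function_const polynomial_function_mult
        polynomial_function_id[unfolded id_def])
  then show ?thesis
    using real_polynomial_function_compose[of "\<lambda>t::real. a + t *\<^sub>R b" p] assms by (simp add: o_def)
qed

text \<open>On the line from a point of \<open>S\<close> to \<open>x\<close> the function is a
  polynomial in one variable with infinitely many zeros close to its starting point.\<close>

lemma real_polynomial_function_eq_0:
  fixes p :: "'a::euclidean_space \<Rightarrow> real"
  assumes p: "real_polynomial_function p" and "open S" "S \<noteq> {}" and 0: "\<And>x. x \<in> S \<Longrightarrow> p x = 0"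
  shows "p x = 0"
proof -
  obtain a where a: "a \<in> S" using assms by blast
  obtain c n where c: "(\<lambda>t::real. p (a + t *\<^sub>R (x - a))) = (\<lambda>t. \<Sum>i\<le>n. c i * t ^ i)"
    using real_polynomial_function_imp_sum[OF real_polynomial_function_line[OF p]] by blast
  have "isCont (\<lambda>t::real. a + t *\<^sub>R (x - a)) 0" by (intro continuous_intros)
  then have "\<forall>\<^sub>F t in at 0. a + t *\<^sub>R (x - a) \<in> S"
    unfolding isCont_def using \<open>open S\<close> a by (auto dest!: topological_tendstoD)
  then obtain d where d: "d > 0" "\<And>t. t \<noteq> 0 \<Longrightarrow> \<bar>t\<bar> < d \<Longrightarrow> a + t *\<^sub>R (x - a) \<in> S"
    unfolding eventually_at by (auto simp: dist_real_def)
  have "{0<..<d} \<subseteq> {t. (\<Sum>i\<le>n. c i * t ^ i) = 0}"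
  proof
    fix t assume "t \<in> {0<..<d}"
    then have "p (a + t *\<^sub>R (x - a)) = 0" using d(2)[of t] 0 by simp
    then show "t \<in> {t. (\<Sum>i\<le>n. c i * t ^ i) = 0}" using fun_cong[OF c, of t] by simp
  qed
  then have "infinite {t. (\<Sum>i\<le>n. c i * t ^ i) = 0}"
    using d(1) infinite_Ioo finite_subset by blast
  then have "\<forall>i\<le>n. c i = 0"
    using polyfun_finite_roots[of c n] by blast
  then have "p (a + 1 *\<^sub>R (x - a)) = 0" using fun_cong[OF c, of 1] by simp
  then show ?thesis by simp
qed

lemma continuous_on_real_polynomial_function:
  fixes p :: "'a::euclidean_space \<Rightarrow> real"
  shows "real_polynomial_function p \<Longrightarrow> continuous_on S p"
  by (simp add: continuous_on_polymonial_function real_polynomial_function_eq)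

text \<open>A product of nonzero polynomial functions is nonzero: one factor is nonzero on some open
  set, and the product of the others cannot vanish throughout it. Hence finitely many exceptional
  zero sets can be avoided arbitrarily close to \<open>q\<close>.\<close>

lemma common_nonzero_islimpt:
  fixes q :: "'a::euclidean_space"
  assumes "finite F" and F: "\<And>p. p \<in> F \<Longrightarrow> real_polynomial_function p \<and> (\<exists>a. p a \<noteq> 0)"
    and "open S" "q \<in> S"
  shows "q islimpt (S \<inter> {x. \<forall>p\<in>F. p x \<noteq> 0})"
proof -
  have *: "real_polynomial_function (\<lambda>x. \<Prod>p\<in>F. p x) \<and> (\<exists>a. (\<Prod>p\<in>F. p a) \<noteq> 0)"
    using \<open>finite F\<close> F
  proof (induction F rule: finite_induct)
    case empty
    then show ?case by auto
  next
    case (insert p F)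
    then have poly: "real_polynomial_function p" "real_polynomial_function (\<lambda>x. \<Prod>p\<in>F. p x)" by auto
    obtain a where a: "p a \<noteq> 0" using insert.prems by blast
    obtain b where b: "(\<Prod>p\<in>F. p b) \<noteq> 0" using insert by blast
    note ab = a b
    have "open {x. p x \<noteq> 0}"
      by (rule open_Collect_neq) (auto intro: continuous_on_real_polynomial_function poly)
    moreover have "a \<in> {x. p x \<noteq> 0}" using ab by simp
    ultimately have "\<exists>x\<in>{x. p x \<noteq> 0}. (\<Prod>p\<in>F. p x) \<noteq> 0"
      using real_polynomial_function_eq_0[OF poly(2), of "{x. p x \<noteq> 0}" b] ab(2) by auto
    then obtain x where "p x \<noteq> 0" "(\<Prod>p\<in>F. p x) \<noteq> 0" by blast
    then have "(\<Prod>p\<in>insert p F. p x) \<noteq> 0" using insert by simp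
    moreover have "real_polynomial_function (\<lambda>x. \<Prod>p\<in>insert p F. p x)"
      using insert poly by (auto intro: real_polynomial_function.intros)
    ultimately show ?case by blast
  qed
  have "\<exists>x'\<in>S \<inter> {x. \<forall>p\<in>F. p x \<noteq> 0}. x' \<in> U \<and> x' \<noteq> q" if "open U" "q \<in> U" for U
  proof (rule ccontr)
    assume no: "\<not> ?thesis"
    have "open (U \<inter> S - {q})" using that assms by auto
    moreover have "U \<inter> S - {q} \<noteq> {}"
    proof
      assume "U \<inter> S - {q} = {}"
      then have "U \<inter> S = {q}" using that assms by auto
      then show False using that assms open_Int[of U S] not_open_singleton by auto
    qed
    ultimately have "(\<Prod>p\<in>F. p a) = 0" for a
      by (rule real_polynomial_function_eq_0[OF conjunct1[OF *], of "U \<inter> S - {q}"])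
        (use no \<open>finite F\<close> in auto)
    then show False using * by blast
  qed
  then show ?thesis unfolding islimpt_def by (intro allI impI) 
qed

section \<open>Flows and spanning trees\<close>

text \<open>The step is an equivalence because a connecting path may run against the orientation of
  its lines.\<close>

lemma connected_induct [consumes 3, case_names arc]:
  assumes "Digraph_Component.connected G" "u \<in> verts G" "v \<in> verts G"
    and step: "\<And>e. e \<in> arcs G \<Longrightarrow> P (tail G e) \<longleftrightarrow> P (head G e)"
    and "P u"
  shows "P v"
proof -
  have "u \<rightarrow>\<^sup>*\<^bsub>with_proj (mk_symmetric G)\<^esub> v"
    using assms(1-3) by (auto simp: Digraph_Component.connected_def strongly_connected_def)
  then show ?thesis
    unfolding reachable_def
    by (induction rule: rtrancl_on_induct) (use \<open>P u\<close> in \<open>auto simp: parcs_mk_symmetric dest: step\<close>)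
qed

lemma connected_crossing_arc:
  assumes "Digraph_Component.connected G" "u \<in> U" "u \<in> verts G" "v \<in> verts G" "v \<notin> U"
  obtains e where "e \<in> arcs G" "tail G e \<in> U \<longleftrightarrow> head G e \<notin> U"
proof (rule ccontr)
  note found = that
  assume "\<not> thesis"
  then have "tail G e \<in> U \<longleftrightarrow> head G e \<in> U" if "e \<in> arcs G" for e
    using found[OF that] by metis
  then have "v \<in> U"
    by (rule connected_induct[OF assms(1) assms(3,4), of "\<lambda>w. w \<in> U"]) (use assms in auto)
  then show False using assms by simp
qed

lemma (in loopfree_digraph) incidence_eq:
  "i \<in> arcs G \<Longrightarrow> incidence G v i = of_bool (head G i = v) - of_bool (tail G i = v)"
  using no_loops[of i] by (auto simp: incidence_def)

text \<open>Stated over a commutative ring so that it covers both the integer variables of the sum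
  and the real variables of the integral.\<close>

definition flow_divergence :: "('v, 'e) pre_digraph \<Rightarrow> ('e \<Rightarrow> 'a::comm_ring_1) \<Rightarrow> 'v \<Rightarrow> 'a" where
  "flow_divergence G x v = (\<Sum>i\<in>arcs G. of_int (incidence G v i) * x i)"

text \<open>If a unit flow from \<open>r\<close> ends at one end point of a line of
  \<open>T\<close>, adding plus or minus one on that line moves its end to the other end
  point.\<close>

lemma connected_unit_flow:
  fixes G :: "('v, 'e) pre_digraph"
  assumes "fin_digraph G" "loopfree_digraph G" "T \<subseteq> arcs G" and "Digraph_Component.connected (G\<lparr>arcs := T\<rparr>)"
    and "r \<in> verts G" "v \<in> verts G"
  shows "\<exists>x :: 'e \<Rightarrow> int. (\<forall>i. i \<notin> T \<longrightarrow> x i = 0) \<and>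
    (\<forall>u\<in>verts G. flow_divergence G x u = of_bool (u = v) - of_bool (u = r))"
proof -
  interpret fin_digraph G by fact
  interpret loopfree_digraph G by fact
  let ?P = "\<lambda>v. \<exists>x :: 'e \<Rightarrow> int. (\<forall>i. i \<notin> T \<longrightarrow> x i = 0) \<and>
    (\<forall>u\<in>verts G. flow_divergence G x u = of_bool (u = v) - of_bool (u = r))"
  have add: "flow_divergence G (\<lambda>i. x i + c * of_bool (i = e)) u = flow_divergence G x u + c * incidence G u e"
    if "e \<in> arcs G" for x :: "'e \<Rightarrow> int" and e c u
  proof -
    have "flow_divergence G (\<lambda>i. x i + c * of_bool (i = e)) u =
      flow_divergence G x u + (\<Sum>i\<in>arcs G. if i = e then c * incidence G u i else 0)"
      unfolding flow_divergence_def sum.distrib[symmetric] by (intro sum.cong) (auto simp: algebra_simps)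
    then show ?thesis using that by simp
  qed
  have P: "?P b" if e: "e \<in> T" and "?P a" 
    and c: "\<And>u. u \<in> verts G \<Longrightarrow> c * incidence G u e = of_bool (u = b) - of_bool (u = a)" for e a b c
  proof -
    from \<open>?P a\<close> obtain x :: "'e \<Rightarrow> int" where x: "\<forall>i. i \<notin> T \<longrightarrow> x i = 0"
      "\<forall>u\<in>verts G. flow_divergence G x u = of_bool (u = a) - of_bool (u = r)" by blast
    have "e \<in> arcs G" using e assms by auto
    show ?thesis
      by (rule exI[of _ "\<lambda>i. x i + c * of_bool (i = e)"])
         (use x e add[OF \<open>e \<in> arcs G\<close>] c in auto)
  qed
  show ?thesis
  proof (rule connected_induct[OF assms(4), of r v ?P])
    show "r \<in> verts (G\<lparr>arcs := T\<rparr>)" "v \<in> verts (G\<lparr>arcs := T\<rparr>)" using assms by auto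
    show "?P r" by (rule exI[of _ "\<lambda>_. 0"]) (auto simp: flow_divergence_def)
    fix e assume "e \<in> arcs (G\<lparr>arcs := T\<rparr>)"
    then have e: "e \<in> T" "e \<in> arcs G" using assms by auto
    have "?P (head G e)" if "?P (tail G e)"
      by (rule P[OF e(1) that, of 1]) (use incidence_eq[OF e(2)] in auto)
    moreover have "?P (tail G e)" if "?P (head G e)"
      by (rule P[OF e(1) that, of "-1"]) (use incidence_eq[OF e(2)] in auto)
    moreover have "tail (G\<lparr>arcs := T\<rparr>) e = tail G e" "head (G\<lparr>arcs := T\<rparr>) e = head G e" by simp_all
    ultimately show "?P (tail (G\<lparr>arcs := T\<rparr>) e) \<longleftrightarrow> ?P (head (G\<lparr>arcs := T\<rparr>) e)"
      by (simp only:) (rule iffI)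
  qed
qed

section \<open>Cycles in multigraphs of minimum degree two\<close>

definition line_path :: "('v, 'e) pre_digraph \<Rightarrow> 'e set \<Rightarrow> 'v list \<Rightarrow> 'e list \<Rightarrow> bool" where
  "line_path G S vs es \<longleftrightarrow> distinct vs \<and> length vs = Suc (length es) \<and> set es \<subseteq> S \<and>
    (\<forall>k < length es. {tail G (es ! k), head G (es ! k)} = {vs ! k, vs ! Suc k})"

text \<open>The vertices are distinct, so the last vertex lies on the last line only. Consequently
  another line at the last vertex cannot already belong to the path.\<close>

lemma line_path_edge_last:
  assumes "line_path G S vs es" "k < length es" "last vs \<in> {tail G (es ! k), head G (es ! k)}"
  shows "Suc k = length es"
proof -
  have d: "distinct vs" "length vs = Suc (length es)" using assms by (auto simp: line_path_def)
  have "last vs = vs ! length es" using d by (metis Zero_not_Suc diff_Suc_1 last_conv_nth list.size(3))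
  moreover have "last vs \<in> {vs ! k, vs ! Suc k}" using assms by (auto simp: line_path_def)
  ultimately show ?thesis using d assms(2) by (auto simp: nth_eq_iff_index_eq)
qed

lemma line_path_distinct:
  assumes "line_path G S vs es"
  shows "distinct es"
proof -
  have d: "distinct vs" "length vs = Suc (length es)" using assms by (auto simp: line_path_def)
  have "k = l" if "k < length es" "l < length es" "es ! k = es ! l" for k l
  proof -
    have "{tail G (es ! j), head G (es ! j)} = {vs ! j, vs ! Suc j}" if "j < length es" for j
      using assms that by (simp add: line_path_def)
    from this[of k] this[of l] have "{vs ! k, vs ! Suc k} = {vs ! l, vs ! Suc l}" using that by simp
    then have "(k = l \<and> Suc k = Suc l) \<or> (k = Suc l \<and> Suc k = l)"
      using d that by (simp add: doubleton_eq_iff nth_eq_iff_index_eq)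
    then show ?thesis by auto
  qed
  then show ?thesis by (auto simp: distinct_conv_nth)
qed

text \<open>The last vertex of a longest path has a second line. Its other end point lies on the
  path, since otherwise the path could be extended; the line closes the rest of the path to a cycle,
  of length two if it is parallel to the last line.\<close>

lemma minimum_degree_two_cycle:
  assumes "loopfree_digraph G" "finite (verts G)" "S \<subseteq> arcs G" "S \<noteq> {}"
    and deg: "\<And>v e. e \<in> S \<Longrightarrow> v \<in> {tail G e, head G e} \<Longrightarrow> \<exists>e'\<in>S. e' \<noteq> e \<and> v \<in> {tail G e', head G e'}"
  shows "\<exists>vs es. undirected_cycle (G\<lparr>arcs := S\<rparr>) vs es"
proof -
  interpret loopfree_digraph G by fact
  obtain e0 where e0: "e0 \<in> S" using assms by auto
  let ?Q = "\<lambda>n. \<exists>vs es. line_path G S vs es \<and> es \<noteq> [] \<and> length es = n"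
  have "line_path G S [tail G e0, head G e0] [e0]"
    using e0 no_loops[of e0] assms by (auto simp: line_path_def)
  then have Q1: "?Q 1" by (intro exI) auto
  have bound: "n \<le> card (verts G)" if Q: "?Q n" for n
  proof -
    from Q obtain vs es where p: "line_path G S vs es" "es \<noteq> []" "length es = n" by auto
    have "set vs \<subseteq> verts G"
    proof
      fix v assume "v \<in> set vs"
      then obtain k where k: "k < length vs" "v = vs ! k" by (auto simp: in_set_conv_nth)
      have len: "length vs = Suc (length es)" using p by (simp add: line_path_def)
      have "k < length es \<or> k = Suc (length es - 1)" using k len p by (cases es) auto
      then obtain j where j: "j < length es" "v \<in> {vs ! j, vs ! Suc j}"
        by (rule disjE) (use k p in \<open>auto intro: that[of k] that[of "length es - 1"]\<close>)
      moreover have "es ! j \<in> S" using j(1) p(1) by (auto simp: line_path_def)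
      ultimately have "v \<in> {tail G (es ! j), head G (es ! j)}" "es ! j \<in> arcs G"
        using p assms(3) by (auto simp: line_path_def)
      then show "v \<in> verts G" by auto
    qed
    then have "card (set vs) \<le> card (verts G)" using assms(2) by (rule card_mono[rotated])
    then show ?thesis using p by (auto simp: line_path_def distinct_card)
  qed
  obtain n where n: "?Q n" "\<And>m. ?Q m \<Longrightarrow> m \<le> n"
  proof
    show "?Q (Greatest ?Q)" using Q1 bound by (rule GreatestI_nat)
    show "m \<le> Greatest ?Q" if "?Q m" for m using that bound by (rule Greatest_le_nat)
  qed
  then obtain vs es where p: "line_path G S vs es" "es \<noteq> []" "length es = n" by auto
  have len: "length vs = Suc (length es)" and dvs: "distinct vs" and esS: "set es \<subseteq> S" 
    and ends: "\<And>k. k < length es \<Longrightarrow> {tail G (es ! k), head G (es ! k)} = {vs ! k, vs ! Suc k}"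
    using p by (auto simp: line_path_def)
  define v where "v = last vs"
  have v: "v = vs ! length es" unfolding v_def using len by (metis Zero_not_Suc diff_Suc_1 last_conv_nth list.size(3))
  define e where "e = es ! (length es - 1)"
  have "v \<in> {tail G e, head G e}" "e \<in> S"
    unfolding e_def v using ends[of "length es - 1"] p(2) esS by auto
  then obtain e' where e': "e' \<in> S" "e' \<noteq> e" "v \<in> {tail G e', head G e'}" using deg by blast
  define w where "w = (if tail G e' = v then head G e' else tail G e')"
  have w: "{tail G e', head G e'} = {v, w}" "w \<noteq> v"
    using e' no_loops[of e'] assms(3) by (auto simp: w_def)
  have "w \<in> set vs"
  proof (rule ccontr)
    assume nw: "w \<notin> set vs"
    have "line_path G S (vs @ [w]) (es @ [e'])"
      unfolding line_path_def
    proof (intro conjI allI impI)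
      fix k assume "k < length (es @ [e'])"
      then consider "k < length es" | "k = length es" by fastforce
      then show "{tail G ((es @ [e']) ! k), head G ((es @ [e']) ! k)} = {(vs @ [w]) ! k, (vs @ [w]) ! Suc k}"
        by cases (use ends len w v in \<open>auto simp: nth_append\<close>)
    qed (use nw dvs len esS e' in auto)
    then have "?Q (Suc n)" using p(3) by (intro exI[of _ "vs @ [w]"] exI[of _ "es @ [e']"]) auto
    then show False using n(2) by fastforce
  qed
  then obtain j where j: "j < length vs" "w = vs ! j" by (auto simp: in_set_conv_nth)
  then have j': "j < length es" using w(2) v len by (metis less_antisym)
  have ne: "e' \<notin> set es"
  proof
    assume "e' \<in> set es"
    then obtain k where k: "k < length es" "e' = es ! k" by (auto simp: in_set_conv_nth)
    then have "Suc k = length es" using line_path_edge_last[OF p(1) k(1)] e' v_def by auto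
    then show False using k e'(2) e_def by (metis diff_Suc_1)
  qed
  have "undirected_cycle (G\<lparr>arcs := S\<rparr>) (drop j vs) (drop j es @ [e'])"
    unfolding undirected_cycle_def
  proof (intro conjI allI impI)
    fix k assume k: "k < length (drop j es @ [e'])"
    show "{tail (G\<lparr>arcs := S\<rparr>) ((drop j es @ [e']) ! k), head (G\<lparr>arcs := S\<rparr>) ((drop j es @ [e']) ! k)} =
      {drop j vs ! k, drop j vs ! (Suc k mod length (drop j es @ [e']))}"
    proof (cases "k < length es - j")
      case True
      then show ?thesis using ends[of "j + k"] len j' by (auto simp: nth_append)
    next
      case False
      then have "k = length es - j" using k by auto
      then show ?thesis using w len j j' v by (auto simp: nth_append)
    qed
  next
    show "set (drop j es @ [e']) \<subseteq> arcs (G\<lparr>arcs := S\<rparr>)"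
      using esS e' set_drop_subset[of j es] by auto
    show "distinct (drop j es @ [e'])"
      using line_path_distinct[OF p(1)] ne set_drop_subset[of j es] by auto
  qed (use dvs len j' in auto)
  then show ?thesis by blast
qed

text \<open>At a vertex on exactly one line of the support, the divergence would be plus or minus
  the value on that line. So a nonempty support has minimum degree two and contains a cycle.\<close>

lemma forest_flow_zero:
  fixes x :: "'e \<Rightarrow> 'a :: linordered_idom"
  assumes "fin_digraph G" "loopfree_digraph G" "T \<subseteq> arcs G"
    and acyclic: "\<nexists>vs es. undirected_cycle (G\<lparr>arcs := T\<rparr>) vs es"
    and supp: "\<And>i. i \<in> arcs G - T \<Longrightarrow> x i = 0"
    and div: "\<And>v. v \<in> verts G \<Longrightarrow> flow_divergence G x v = 0"
    and "i \<in> arcs G"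
  shows "x i = 0"
proof (rule ccontr)
  assume "x i \<noteq> 0"
  interpret fin_digraph G by fact
  interpret loopfree_digraph G by fact
  define S where "S = {i\<in>arcs G. x i \<noteq> 0}"
  have ST: "S \<subseteq> T" using supp by (auto simp: S_def)
  have "\<exists>vs es. undirected_cycle (G\<lparr>arcs := S\<rparr>) vs es"
  proof (rule minimum_degree_two_cycle)
    fix v e assume e: "e \<in> S" "v \<in> {tail G e, head G e}"
    then have eG: "e \<in> arcs G" "x e \<noteq> 0" by (auto simp: S_def)
    then have v: "v \<in> verts G" using e by auto
    show "\<exists>e'\<in>S. e' \<noteq> e \<and> v \<in> {tail G e', head G e'}"
    proof (rule ccontr)
      assume *: "\<not> ?thesis"
      have "flow_divergence G x v = (\<Sum>i\<in>arcs G. if i = e then of_int (incidence G v e) * x e else 0)"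
        unfolding flow_divergence_def
        by (intro sum.cong) (use * in \<open>auto simp: S_def incidence_eq\<close>)
      then have "flow_divergence G x v = of_int (incidence G v e) * x e" using eG by simp
      then show False using div[OF v] eG e no_loops[of e] by (auto simp: incidence_eq)
    qed
  qed (use assms \<open>x i \<noteq> 0\<close> in \<open>auto simp: S_def\<close>)
  then obtain vs es where "undirected_cycle (G\<lparr>arcs := S\<rparr>) vs es" by blast
  then have "undirected_cycle (G\<lparr>arcs := T\<rparr>) vs es"
    using ST by (auto simp: undirected_cycle_def)
  then show False using acyclic by blast
qed

section \<open>Solving the vertex equations along a spanning tree\<close>

locale matsubara_tree = matsubara_graph G
  for G :: "('v, 'e::finite) pre_digraph" +
  fixes T :: "'e set"
  assumes tree: "spanning_tree_lines G T"
begin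

definition root :: 'v where
  "root = (SOME r. r \<in> verts G)"

definition unit_flow :: "'v \<Rightarrow> 'e \<Rightarrow> int" where
  "unit_flow v = (SOME x. (\<forall>i. i \<notin> T \<longrightarrow> x i = 0) \<and>
    (\<forall>u\<in>verts G. flow_divergence G x u = of_bool (u = v) - of_bool (u = root)))"

text \<open>The chord values leave an excess at each vertex, which the tree carries there from the
  root. The coefficients are integers and the dependence on \<open>y\<close> is affine, so one
  formula serves the sum, the integral and the limits.\<close>

definition tree_flow :: "('v \<Rightarrow> int) \<Rightarrow> ('e \<Rightarrow> 'a::comm_ring_1) \<Rightarrow> 'e \<Rightarrow> 'a" where
  "tree_flow N y = (\<lambda>i\<in>arcs G. if i \<in> T
     then \<Sum>v\<in>verts G. (of_int (N v) - (\<Sum>l\<in>arcs G - T. of_int (incidence G v l) * y l)) * of_int (unit_flow v i)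
     else y i)"

lemma T_arcs: "T \<subseteq> arcs G"
  using tree by (simp add: spanning_tree_lines_def)

lemma root_in_verts: "root \<in> verts G"
  using connected_graph unfolding root_def Digraph_Component.connected_def strongly_connected_def
  by (auto intro: someI_ex)

lemma unit_flow:
  assumes "v \<in> verts G"
  shows "i \<notin> T \<Longrightarrow> unit_flow v i = 0"
    and "u \<in> verts G \<Longrightarrow> flow_divergence G (unit_flow v) u = of_bool (u = v) - of_bool (u = root)"
proof -
  have "\<exists>x :: 'e \<Rightarrow> int. (\<forall>i. i \<notin> T \<longrightarrow> x i = 0) \<and>
    (\<forall>u\<in>verts G. flow_divergence G x u = of_bool (u = v) - of_bool (u = root))"
    using connected_unit_flow[of G T root v] tree assms root_in_verts fin_digraph_axioms loopfree_digraph_axioms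
    by (auto simp: spanning_tree_lines_def)
  from someI_ex[OF this]
  show "i \<notin> T \<Longrightarrow> unit_flow v i = 0"
    "u \<in> verts G \<Longrightarrow> flow_divergence G (unit_flow v) u = of_bool (u = v) - of_bool (u = root)"
    unfolding unit_flow_def by blast+
qed

lemma sum_incidence: "i \<in> arcs G \<Longrightarrow> (\<Sum>v\<in>verts G. incidence G v i) = 0"
  by (simp add: incidence_eq sum_subtractf)

lemma flow_divergence_tree_flow:
  fixes y :: "'e \<Rightarrow> 'a::comm_ring_1"
  assumes N: "(\<Sum>v\<in>verts G. N v) = 0" and v: "v \<in> verts G"
  shows "flow_divergence G (tree_flow N y) v = of_int (N v)"
proof -
  \<comment> \<open>\<open>w u\<close> is the excess at \<open>u\<close> left to the tree. Every
    unit flow starts at the root, so the equation at the root holds because the excesses add up to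
    zero.\<close>
  define w where "w u = (of_int (N u) - (\<Sum>l\<in>arcs G - T. of_int (incidence G u l) * y l) :: 'a)" for u
  have w: "(\<Sum>u\<in>verts G. w u) = 0"
  proof -
    have "(\<Sum>u\<in>verts G. \<Sum>l\<in>arcs G - T. of_int (incidence G u l) * y l) =
      (\<Sum>l\<in>arcs G - T. of_int (\<Sum>u\<in>verts G. incidence G u l) * y l)"
      by (subst sum.swap) (simp add: sum_distrib_right)
    also have "\<dots> = 0" by (intro sum.neutral) (auto simp: sum_incidence)
    finally show ?thesis
      unfolding w_def sum_subtractf by (simp flip: of_int_sum add: N)
  qed
  have "flow_divergence G (tree_flow N y) v =
    (\<Sum>i\<in>T. of_int (incidence G v i) * tree_flow N y i) + (\<Sum>i\<in>arcs G - T. of_int (incidence G v i) * tree_flow N y i)"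
    unfolding flow_divergence_def using T_arcs by (subst sum.subset_diff[of T]) auto
  also have "(\<Sum>i\<in>T. of_int (incidence G v i) * tree_flow N y i) =
     (\<Sum>i\<in>T. \<Sum>u\<in>verts G. w u * (of_int (incidence G v i) * of_int (unit_flow u i)))"
    using T_arcs by (intro sum.cong) (auto simp: tree_flow_def w_def sum_distrib_left algebra_simps)
  also have "\<dots> = (\<Sum>u\<in>verts G. w u * of_int (\<Sum>i\<in>T. incidence G v i * unit_flow u i))"
    by (subst sum.swap) (simp add: sum_distrib_left)
  also have "\<dots> = (\<Sum>u\<in>verts G. w u * of_int (flow_divergence G (unit_flow u) v))"
  proof (intro sum.cong refl)
    fix u assume u: "u \<in> verts G"
    have "(\<Sum>i\<in>T. incidence G v i * unit_flow u i) = (\<Sum>i\<in>arcs G. incidence G v i * unit_flow u i)"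
      using T_arcs unit_flow(1)[OF u] by (intro sum.mono_neutral_left) auto
    then show "w u * of_int (\<Sum>i\<in>T. incidence G v i * unit_flow u i) = w u * of_int (flow_divergence G (unit_flow u) v)"
      by (simp add: flow_divergence_def)
  qed
  also have "\<dots> = (\<Sum>u\<in>verts G. (if u = v then w v else 0) - w u * of_bool (v = root))"
    using v by (intro sum.cong) (auto simp: unit_flow(2))
  also have "\<dots> = w v"
    using v w by (simp add: sum_subtractf sum_distrib_right[symmetric])
  also have "(\<Sum>i\<in>arcs G - T. of_int (incidence G v i) * tree_flow N y i) =
    (\<Sum>i\<in>arcs G - T. of_int (incidence G v i) * y i)"
    by (intro sum.cong) (auto simp: tree_flow_def)
  finally show ?thesis by (simp add: w_def)
qed

lemma tree_flow_unique:
  fixes x :: "'e \<Rightarrow> 'a::linordered_idom"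
  assumes N: "(\<Sum>v\<in>verts G. N v) = 0" and "x \<in> extensional (arcs G)"
    and "\<And>l. l \<in> arcs G - T \<Longrightarrow> x l = y l"
    and "\<And>v. v \<in> verts G \<Longrightarrow> flow_divergence G x v = of_int (N v)"
  shows "x = tree_flow N y"
proof (rule extensionalityI[of _ "arcs G"])
  fix i assume i: "i \<in> arcs G"
  have "x i - tree_flow N y i = 0"
  proof (rule forest_flow_zero[OF fin_digraph_axioms loopfree_digraph_axioms T_arcs _ _ _ i])
    show "\<nexists>vs es. undirected_cycle (G\<lparr>arcs := T\<rparr>) vs es"
      using tree by (simp add: spanning_tree_lines_def)
    show "flow_divergence G (\<lambda>i. x i - tree_flow N y i) v = 0" if "v \<in> verts G" for v
      using assms(4)[OF that] flow_divergence_tree_flow[OF N that, of y]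
      by (simp add: flow_divergence_def right_diff_distrib sum_subtractf)
    show "x l - tree_flow N y l = 0" if "l \<in> arcs G - T" for l
      using assms(3)[OF that] that by (simp add: tree_flow_def)
  qed
  then show "x i = tree_flow N y i" by simp
qed (use assms in \<open>auto simp: tree_flow_def\<close>)

lemma tree_solution_eq:
  assumes "(\<Sum>v\<in>verts G. N v) = 0"
  shows "tree_solution G N T y = tree_flow N y"
  unfolding tree_solution_def
proof (rule the_equality)
  show "tree_flow N y \<in> extensional (arcs G) \<and> (\<forall>l\<in>arcs G - T. tree_flow N y l = y l) \<and>
    (\<forall>v\<in>verts G. (\<Sum>i\<in>arcs G. real_of_int (incidence G v i) * tree_flow N y i) = real_of_int (N v))"
    using flow_divergence_tree_flow[OF assms, of _ y]
    by (auto simp: flow_divergence_def) (auto simp: tree_flow_def)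
  show "x = tree_flow N y" if "x \<in> extensional (arcs G) \<and> (\<forall>l\<in>arcs G - T. x l = y l) \<and>
    (\<forall>v\<in>verts G. (\<Sum>i\<in>arcs G. real_of_int (incidence G v i) * x i) = real_of_int (N v))" for x
    using that by (intro tree_flow_unique[OF assms]) (auto simp: flow_divergence_def)
qed

lemma tree_flow_of_int:
  "i \<in> arcs G \<Longrightarrow> tree_flow N (\<lambda>l. of_int (y l)) i = of_int (tree_flow N y i)"
  by (simp add: tree_flow_def)

lemma tree_flow_scale:
  "i \<in> arcs G \<Longrightarrow> tree_flow (\<lambda>v. M * N v) (\<lambda>l. of_int M * y l) i = of_int M * tree_flow N y i"
  by (auto simp: tree_flow_def sum_distrib_left algebra_simps)

lemma tree_flow_chord: "l \<in> arcs G - T \<Longrightarrow> tree_flow N y l = y l"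
  by (simp add: tree_flow_def)

lemma tendsto_tree_flow:
  fixes y :: "'b \<Rightarrow> 'e \<Rightarrow> real"
  assumes "\<And>l. l \<in> arcs G - T \<Longrightarrow> ((\<lambda>k. y k l) \<longlongrightarrow> z l) F" and "i \<in> arcs G"
  shows "((\<lambda>k. tree_flow N (y k) i) \<longlongrightarrow> tree_flow N z i) F"
  using assms by (cases "i \<in> T") (auto simp: tree_flow_def intro!: tendsto_intros)

text \<open>Because the unit flows are integral, arbitrary integers on the chords extend to integer
  solutions. The constrained sum thus becomes a free sum over the chords of the same function that
  is integrated in the Matsubara integral.\<close>

lemma bij_betw_tree_flow_int:
  assumes N: "(\<Sum>v\<in>verts G. N v) = 0"
  shows "bij_betw (tree_flow N) (arcs G - T \<rightarrow>\<^sub>E (UNIV :: int set))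
    {n \<in> arcs G \<rightarrow>\<^sub>E UNIV. \<forall>v\<in>verts G. flow_divergence G n v = N v}"
proof (rule bij_betw_byWitness[where f' = "\<lambda>n. restrict n (arcs G - T)"])
  show "\<forall>y\<in>arcs G - T \<rightarrow>\<^sub>E UNIV. restrict (tree_flow N y) (arcs G - T) = y"
    by (auto simp: fun_eq_iff tree_flow_def restrict_def PiE_def extensional_def)
  show "\<forall>n\<in>{n \<in> arcs G \<rightarrow>\<^sub>E UNIV. \<forall>v\<in>verts G. flow_divergence G n v = N v}.
    tree_flow N (restrict n (arcs G - T)) = n"
  proof
    fix n assume "n \<in> {n \<in> arcs G \<rightarrow>\<^sub>E UNIV. \<forall>v\<in>verts G. flow_divergence G n v = N v}"
    then have "n = tree_flow N (restrict n (arcs G - T))"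
      by (intro tree_flow_unique[OF N]) (auto simp: PiE_def)
    then show "tree_flow N (restrict n (arcs G - T)) = n" by simp
  qed
  show "tree_flow N ` (arcs G - T \<rightarrow>\<^sub>E UNIV) \<subseteq> {n \<in> arcs G \<rightarrow>\<^sub>E UNIV. \<forall>v\<in>verts G. flow_divergence G n v = N v}"
    using flow_divergence_tree_flow[OF N, where 'a = int]
    by (auto simp: PiE_def) (auto simp: tree_flow_def)
  show "(\<lambda>n. restrict n (arcs G - T)) ` {n \<in> arcs G \<rightarrow>\<^sub>E UNIV. \<forall>v\<in>verts G. flow_divergence G n v = N v}
    \<subseteq> arcs G - T \<rightarrow>\<^sub>E UNIV"
    by auto
qed

end

section \<open>Exponential integrals over ordered simplices\<close>

text \<open>The divided difference of a function with values \<open>\<phi> a\<close> at the nodes \<open>e a\<close>, up to sign.\<close>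

definition divided_difference :: "('i \<Rightarrow> 'a::field) \<Rightarrow> ('i \<Rightarrow> 'a) \<Rightarrow> 'i set \<Rightarrow> 'a" where
  "divided_difference e \<phi> K = (\<Sum>a\<in>K. \<phi> a * (\<Prod>k\<in>K - {a}. 1 / (e k - e a)))"

text \<open>Partial fractions at each node other than \<open>i\<close> and \<open>j\<close>; at
  these two nodes the factor \<open>e i - e j\<close> cancels one factor of the product, up to
  sign.\<close>

lemma divided_difference_rec:
  assumes "finite K" "inj_on e K" "i \<in> K" "j \<in> K" "i \<noteq> j"
  shows "(e i - e j) * divided_difference e \<phi> K =
    divided_difference e \<phi> (K - {i}) - divided_difference e \<phi> (K - {j})"
proof -
  define L where "L = K - {i, j}"
  have K: "K = insert i (insert j L)" "finite L" "i \<notin> L" "j \<notin> L" "i \<noteq> j"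
    using assms by (auto simp: L_def)
  have Ki: "K - {i} = insert j L" and Kj: "K - {j} = insert i L" using K by auto
  have ne: "e a \<noteq> e b" if "a \<in> K" "b \<in> K" "a \<noteq> b" for a b
    using assms(2) that by (auto simp: inj_on_def)
  have eij: "e i - e j \<noteq> 0" "e j - e i \<noteq> 0" using ne[of i j] assms by auto
  have "(e i - e j) * (\<phi> a * (\<Prod>k\<in>K - {a}. 1 / (e k - e a))) =
    \<phi> a * (\<Prod>k\<in>insert j L - {a}. 1 / (e k - e a)) - \<phi> a * (\<Prod>k\<in>insert i L - {a}. 1 / (e k - e a))"
    if a: "a \<in> L" for a
  proof -
    have s: "K - {a} = insert i (insert j (L - {a}))" "insert j L - {a} = insert j (L - {a})"
      "insert i L - {a} = insert i (L - {a})" using K a by auto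
    have "e i - e a \<noteq> 0" "e j - e a \<noteq> 0" using ne[of i a] ne[of j a] a K by auto
    then have "(e i - e j) * (1 / (e i - e a) * (1 / (e j - e a))) = 1 / (e j - e a) - 1 / (e i - e a)"
      by (simp add: field_simps)
    then have "(e i - e j) * (\<phi> a * (1 / (e i - e a) * (1 / (e j - e a) * P))) = \<phi> a * (1 / (e j - e a) * P) - \<phi> a * (1 / (e i - e a) * P)" for P
    proof -
      assume r: "(e i - e j) * (1 / (e i - e a) * (1 / (e j - e a))) = 1 / (e j - e a) - 1 / (e i - e a)"
      have "(e i - e j) * (\<phi> a * (1 / (e i - e a) * (1 / (e j - e a) * P))) =
        \<phi> a * ((e i - e j) * (1 / (e i - e a) * (1 / (e j - e a))) * P)"
        by (simp only: mult_ac)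
      then show ?thesis unfolding r by (simp only: left_diff_distrib right_diff_distrib)
    qed
    then show ?thesis unfolding s using K by simp
  qed
  then have "(e i - e j) * (\<Sum>a\<in>L. \<phi> a * (\<Prod>k\<in>K - {a}. 1 / (e k - e a))) =
     (\<Sum>a\<in>L. \<phi> a * (\<Prod>k\<in>insert j L - {a}. 1 / (e k - e a))) - (\<Sum>a\<in>L. \<phi> a * (\<Prod>k\<in>insert i L - {a}. 1 / (e k - e a)))"
    by (simp add: sum_distrib_left sum_subtractf)
  moreover have "(e i - e j) * (\<phi> i * (\<Prod>k\<in>K - {i}. 1 / (e k - e i))) = - (\<phi> i * (\<Prod>k\<in>insert i L - {i}. 1 / (e k - e i)))"
    using K eij unfolding Ki by (simp add: field_simps)
  moreover have "(e i - e j) * (\<phi> j * (\<Prod>k\<in>K - {j}. 1 / (e k - e j))) = \<phi> j * (\<Prod>k\<in>insert j L - {j}. 1 / (e k - e j))"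
    using K eij unfolding Kj by simp
  moreover have "divided_difference e \<phi> K = \<phi> i * (\<Prod>k\<in>K - {i}. 1 / (e k - e i)) +
      (\<phi> j * (\<Prod>k\<in>K - {j}. 1 / (e k - e j)) + (\<Sum>a\<in>L. \<phi> a * (\<Prod>k\<in>K - {a}. 1 / (e k - e a))))"
  proof -
    have "sum g K = g i + (g j + sum g L)" for g :: "_ \<Rightarrow> 'b" using K by simp
    then show ?thesis unfolding divided_difference_def .
  qed
  moreover have "divided_difference e \<phi> (insert x L) = \<phi> x * (\<Prod>k\<in>insert x L - {x}. 1 / (e k - e x)) +
      (\<Sum>a\<in>L. \<phi> a * (\<Prod>k\<in>insert x L - {a}. 1 / (e k - e a)))" if "x \<notin> L" for x
    unfolding divided_difference_def using K(2) that by simp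
  ultimately show ?thesis unfolding Ki Kj using K by (simp add: distrib_left)
qed

section \<open>Cubes of angles and their ordered sectors\<close>

abbreviation product_lborel :: "'v set \<Rightarrow> ('v \<Rightarrow> real) measure" where
  "product_lborel W \<equiv> Pi\<^sub>M W (\<lambda>_. lborel)"

interpretation lborel_product: product_sigma_finite "\<lambda>_ :: 'v. lborel :: real measure"
  by standard

definition open_cube :: "'v set \<Rightarrow> real \<Rightarrow> ('v \<Rightarrow> real) \<Rightarrow> bool" where
  "open_cube W b t \<longleftrightarrow> (\<forall>v\<in>W. 0 < t v \<and> t v < b)"

definition sector :: "'v list \<Rightarrow> real \<Rightarrow> ('v \<Rightarrow> real) \<Rightarrow> bool" where
  "sector vs b t \<longleftrightarrow> sorted_wrt (<) (map t vs) \<and> open_cube (set vs) b t"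

lemma pred_open_cube [measurable]: "finite W \<Longrightarrow> Measurable.pred (product_lborel W) (open_cube W b)"
  unfolding open_cube_def by measurable

lemma pred_sector [measurable]: "set vs \<subseteq> W \<Longrightarrow> Measurable.pred (product_lborel W) (sector vs b)"
proof -
  assume vs: "set vs \<subseteq> W"
  have [measurable]: "v \<in> W" if "v \<in> set vs" for v using vs that by auto
  have [measurable]: "vs ! i \<in> W" if "i < length vs" for i using vs that by auto
  have "sector vs b = (\<lambda>t. (\<forall>j\<in>{..<length vs}. \<forall>i\<in>{..<j}. t (vs ! i) < t (vs ! j)) \<and> (\<forall>v\<in>set vs. 0 < t v \<and> t v < b))"
    by (auto simp: sector_def open_cube_def fun_eq_iff sorted_wrt_iff_nth_less)
  moreover have "Measurable.pred (product_lborel W) (\<lambda>t. \<forall>v\<in>set vs. 0 < t v \<and> t v < b)"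
    by measurable
  moreover have "Measurable.pred (product_lborel W) (\<lambda>t. \<forall>j\<in>{..<length vs}. \<forall>i\<in>{..<j}. t (vs ! i) < t (vs ! j))"
  proof (intro pred_intros_finite)
    fix i j assume "j \<in> {..<length vs}" "i \<in> {..<j}"
    then have [measurable]: "vs ! i \<in> W" "vs ! j \<in> W" using vs by auto
    show "Measurable.pred (product_lborel W) (\<lambda>t. t (vs ! i) < t (vs ! j))" by measurable
  qed auto
  ultimately show ?thesis by simp
qed

lemma integrable_bounded_on_cube:
  fixes f :: "('v \<Rightarrow> real) \<Rightarrow> 'a::{banach, second_countable_topology}"
  assumes "finite W" and [measurable]: "f \<in> borel_measurable (product_lborel W)"
    and C: "\<And>t. open_cube W b t \<Longrightarrow> norm (f t) \<le> C" and 0: "\<And>t. \<not> open_cube W b t \<Longrightarrow> f t = 0"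
  shows "integrable (product_lborel W) f"
proof (rule Bochner_Integration.integrable_bound)
  show "integrable (product_lborel W) (\<lambda>t. \<bar>C\<bar> * (\<Prod>v\<in>W. indicator {0<..<b} (t v)))"
    using \<open>finite W\<close> by (intro integrable_mult_right lborel_product.product_integrable_prod integrable_real_indicator)
      (cases "0 \<le> b"; auto)+
  have "norm (f t) \<le> \<bar>C\<bar> * (\<Prod>v\<in>W. indicator {0<..<b} (t v))" for t
  proof (cases "open_cube W b t")
    case True
    then have "(\<Prod>v\<in>W. indicator {0<..<b} (t v)) = (1::real)"
      by (intro prod.neutral) (auto simp: open_cube_def)
    then show ?thesis using C[OF True] by simp
  qed (simp add: 0 prod_nonneg)
  then show "AE t in product_lborel W. norm (f t) \<le> norm (\<bar>C\<bar> * (\<Prod>v\<in>W. indicator {0<..<b} (t v) :: real))"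
    by (auto simp: abs_mult abs_prod intro!: always_eventually)
qed fact

lemma AE_product_lborel_neq:
  assumes "finite W" "u \<in> W" "v \<in> W" "u \<noteq> v"
  shows "AE t in product_lborel W. t u \<noteq> t v"
proof -
  define W' where "W' = W - {u}"
  have W: "W = insert u W'" "finite W'" "u \<notin> W'" "v \<in> W'" using assms by (auto simp: W'_def)
  have uW [measurable]: "u \<in> insert u W'" "v \<in> insert u W'" using W by auto
  define A where "A = {t \<in> space (product_lborel W). t u = t v}"
  have A [measurable]: "A \<in> sets (product_lborel (insert u W'))" unfolding A_def W(1) by measurable
  have "emeasure (product_lborel W) A = (\<integral>\<^sup>+t. indicator A t \<partial>product_lborel (insert u W'))"
    using A by (simp add: W(1))
  also have "\<dots> = (\<integral>\<^sup>+x. \<integral>\<^sup>+y. indicator A (x(u := y)) \<partial>lborel \<partial>product_lborel W')"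
    by (rule lborel_product.product_nn_integral_insert) (use W in auto)
  also have "\<dots> = (\<integral>\<^sup>+x. \<integral>\<^sup>+y. indicator {x v} y \<partial>lborel \<partial>product_lborel W')"
    by (intro nn_integral_cong) (use assms W in \<open>auto simp: A_def indicator_def space_PiM PiE_def extensional_def\<close>)
  also have "\<dots> = 0" by simp
  finally have "A \<in> null_sets (product_lborel W)" using A by (auto simp: W(1))
  then show ?thesis
    by (rule AE_I') (auto simp: A_def)
qed

lemma AE_product_lborel_inj:
  assumes "finite W"
  shows "AE t in product_lborel W. inj_on t W"
proof -
  have "AE t in product_lborel W. \<forall>u\<in>W. \<forall>v\<in>W. u \<noteq> v \<longrightarrow> t u \<noteq> t v"
    using assms by (intro AE_finite_allI AE_impI AE_product_lborel_neq) auto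
  then show ?thesis by eventually_elim (auto simp: inj_on_def)
qed

lemma ex1_sorted_enumeration:
  fixes t :: "'v \<Rightarrow> 'a::linorder"
  assumes "finite W" "inj_on t W"
  shows "\<exists>!vs. vs \<in> permutations_of_set W \<and> sorted_wrt (<) (map t vs)"
proof (rule ex_ex1I)
  let ?l = "map (the_inv_into W t) (sorted_list_of_set (t ` W))"
  have l: "map t ?l = sorted_list_of_set (t ` W)"
    using assms by (auto simp: map_idI f_the_inv_into_f intro!: map_idI)
  have "distinct ?l" using l distinct_sorted_list_of_set[of "t ` W"] distinct_map by metis
  moreover have "set ?l = W"
    using assms by (simp add: the_inv_into_onto)
  moreover have "sorted_wrt (<) (map t ?l)" unfolding l by simp
  ultimately show "\<exists>vs. vs \<in> permutations_of_set W \<and> sorted_wrt (<) (map t vs)"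
    unfolding permutations_of_set_def by blast
next
  fix vs ws
  assume *: "vs \<in> permutations_of_set W \<and> sorted_wrt (<) (map t vs)" "ws \<in> permutations_of_set W \<and> sorted_wrt (<) (map t ws)"
  then have "map t vs = map t ws"
    by (intro strict_sorted_equal) (auto simp: permutations_of_set_def)
  then show "vs = ws"
    using * assms(2) by (intro map_inj_on[of t vs ws]) (auto simp: permutations_of_set_def)
qed

text \<open>Points with two equal coordinates form a null set; any other point of the cube lies in
  exactly one sector.\<close>

lemma integral_cube_sectors:
  fixes f :: "('v \<Rightarrow> real) \<Rightarrow> 'a::{banach, second_countable_topology}"
  assumes W: "finite W" and [measurable]: "f \<in> borel_measurable (product_lborel W)"
    and int: "\<And>vs. vs \<in> permutations_of_set W \<Longrightarrow> integrable (product_lborel W) (\<lambda>t. if sector vs b t then f t else 0)"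
  shows "(\<integral>t. (if open_cube W b t then f t else 0) \<partial>product_lborel W) =
    (\<Sum>vs\<in>permutations_of_set W. \<integral>t. (if sector vs b t then f t else 0) \<partial>product_lborel W)"
proof -
  have [measurable]: "Measurable.pred (product_lborel W) (open_cube W b)" using W by (rule pred_open_cube)
  have eq: "(if open_cube W b t then f t else 0) = (\<Sum>vs\<in>permutations_of_set W. if sector vs b t then f t else 0)"
    if inj: "inj_on t W" for t
  proof (cases "open_cube W b t")
    case True
    obtain ws where ws: "ws \<in> permutations_of_set W" "sorted_wrt (<) (map t ws)"
      and uniq: "\<And>vs. vs \<in> permutations_of_set W \<Longrightarrow> sorted_wrt (<) (map t vs) \<Longrightarrow> vs = ws"
      using ex1_sorted_enumeration[OF W inj] by blast
    have "sector vs b t \<longleftrightarrow> vs = ws" if "vs \<in> permutations_of_set W" for vs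
      using uniq[OF that] ws(2) True permutations_of_setD(1)[OF that] unfolding sector_def by metis
    then have "(\<Sum>vs\<in>permutations_of_set W. if sector vs b t then f t else 0) = (\<Sum>vs\<in>permutations_of_set W. if vs = ws then f t else 0)"
      by (intro sum.cong) simp_all
    then show ?thesis using ws(1) True W by simp
  next
    case False
    then show ?thesis by (auto simp: sector_def permutations_of_set_def intro!: sum.neutral[symmetric])
  qed
  have "(\<integral>t. (if open_cube W b t then f t else 0) \<partial>product_lborel W) =
    (\<integral>t. (\<Sum>vs\<in>permutations_of_set W. if sector vs b t then f t else 0) \<partial>product_lborel W)"
  proof (rule integral_cong_AE)
    show "AE t in product_lborel W. (if open_cube W b t then f t else 0) = (\<Sum>vs\<in>permutations_of_set W. if sector vs b t then f t else 0)"
      using AE_product_lborel_inj[OF W] by eventually_elim (rule eq)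
    show "(\<lambda>t. \<Sum>vs\<in>permutations_of_set W. if sector vs b t then f t else 0) \<in> borel_measurable (product_lborel W)"
      using int by (intro borel_measurable_sum) auto
  qed measurable
  also have "\<dots> = (\<Sum>vs\<in>permutations_of_set W. \<integral>t. (if sector vs b t then f t else 0) \<partial>product_lborel W)"
    using int by (rule Bochner_Integration.integral_sum)
  finally show ?thesis .
qed

lemma sector_snoc:
  "sector (vs @ [v]) b t \<longleftrightarrow> sector vs b t \<and> (if vs = [] then 0 else t (last vs)) < t v \<and> t v < b"
proof (cases vs rule: rev_cases)
  case Nil
  then show ?thesis by (auto simp: sector_def open_cube_def)
next
  case (snoc us u)
  show ?thesis unfolding snoc by (auto simp: sector_def open_cube_def sorted_wrt_append intro: less_trans)
qed

lemma integral_exp_linear: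
  fixes A \<mu> :: complex and l b :: real
  assumes "l \<le> b" "\<mu> \<noteq> 0"
  shows "(\<integral>y. (if l < y \<and> y < b then exp (A + \<mu> * of_real y) else 0) \<partial>lborel) =
    (exp (A + \<mu> * of_real b) - exp (A + \<mu> * of_real l)) / \<mu>"
proof -
  have "(\<integral>y. (if l < y \<and> y < b then exp (A + \<mu> * of_real y) else 0) \<partial>lborel) =
     (LBINT y=l..b. exp (A + \<mu> * of_real y))"
    using assms(1) by (auto simp: interval_lebesgue_integral_def set_lebesgue_integral_def einterval_def indicator_def
        intro!: Bochner_Integration.integral_cong)
  also have "\<dots> = exp (A + \<mu> * of_real b) / \<mu> - exp (A + \<mu> * of_real l) / \<mu>"
  proof (rule interval_integral_FTC_finite)
    show "((\<lambda>y. exp (A + \<mu> * of_real y) / \<mu>) has_vector_derivative exp (A + \<mu> * of_real y)) (at y within {min l b..max l b})" for y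
      by (rule has_vector_derivative_real_field) (use assms(2) in \<open>auto intro!: derivative_eq_intros\<close>)
  qed (auto intro!: continuous_intros)
  finally show ?thesis by (simp add: diff_divide_distrib)
qed

text \<open>Writing the coefficients as increments of \<open>e\<close> makes the values
  \<open>e k\<close> the nodes of the divided difference.\<close>

definition sector_exponent :: "(nat \<Rightarrow> complex) \<Rightarrow> 'v list \<Rightarrow> ('v \<Rightarrow> real) \<Rightarrow> complex" where
  "sector_exponent e vs t = (\<Sum>k<length vs. (e (Suc k) - e k) * of_real (t (vs ! k)))"

lemma measurable_sector_exponent [measurable]:
  "set vs \<subseteq> W \<Longrightarrow> sector_exponent e vs \<in> borel_measurable (product_lborel W)"
  unfolding sector_exponent_def
proof (rule borel_measurable_sum)
  fix k assume "set vs \<subseteq> W" "k \<in> {..<length vs}"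
  then have [measurable]: "vs ! k \<in> W" by auto
  show "(\<lambda>t. (e (Suc k) - e k) * of_real (t (vs ! k))) \<in> borel_measurable (product_lborel W)" by measurable
qed

lemma integrable_sector_exponent:
  "integrable (product_lborel (set vs)) (\<lambda>t. if sector vs b t then exp (sector_exponent e vs t) else 0)"
proof (rule integrable_bounded_on_cube)
  show "(\<lambda>t. if sector vs b t then exp (sector_exponent e vs t) else 0) \<in> borel_measurable (product_lborel (set vs))"
    by measurable
  fix t
  show "norm (if sector vs b t then exp (sector_exponent e vs t) else 0) \<le> exp (\<Sum>k<length vs. norm (e (Suc k) - e k) * b)"
    if t: "open_cube (set vs) b t"
  proof -
    have "\<bar>t (vs ! k)\<bar> \<le> b" if "k < length vs" for k
      using t nth_mem[OF that] by (force simp: open_cube_def)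
    note bd = this
    have "norm (sector_exponent e vs t) \<le> (\<Sum>k<length vs. norm (e (Suc k) - e k) * b)"
      unfolding sector_exponent_def
      by (rule sum_norm_le) (auto simp: norm_mult bd intro!: mult_left_mono)
    then have "Re (sector_exponent e vs t) \<le> (\<Sum>k<length vs. norm (e (Suc k) - e k) * b)"
      using complex_Re_le_cmod[of "sector_exponent e vs t"] by linarith
    then show ?thesis by simp
  qed
qed (auto simp: sector_def)

text \<open>Integrating out the last coordinate is the recursion of divided differences.\<close>

lemma integral_sector_exponent:
  assumes "distinct vs" "inj_on e {..length vs}" "0 \<le> b"
  shows "(\<integral>t. (if sector vs b t then exp (sector_exponent e vs t) else 0) \<partial>product_lborel (set vs)) =
    divided_difference e (\<lambda>a. exp (of_real b * (e (length vs) - e a))) {..length vs}"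
  using assms(1,2)
proof (induction vs arbitrary: e rule: rev_induct)
  case Nil
  show ?case
    by (simp add: PiM_empty sector_def open_cube_def sector_exponent_def divided_difference_def
        lebesgue_integral_count_space_finite)
next
  case (snoc v vs)
  define m where "m = length vs"
  \<comment> \<open>At the lower limit the new coordinate equals the preceding one, so the last two
    increments merge: this is the exponent with node \<open>m\<close> replaced by node
    \<open>Suc m\<close>.\<close>
  define e' where "e' = e(m := e (Suc m))"
  define \<mu> where "\<mu> = e (Suc m) - e m"
  have \<mu>: "\<mu> \<noteq> 0" using inj_onD[OF snoc.prems(2), of "Suc m" m] by (auto simp: \<mu>_def m_def)
  have v: "v \<notin> set vs" "distinct vs" using snoc.prems by auto
  have "e a = e k \<longleftrightarrow> a = k" if "a \<le> Suc m" "k \<le> Suc m" for a k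
    using inj_on_eq_iff[OF snoc.prems(2), of a k] that by (auto simp: m_def)
  then have inj: "inj_on e {..m}" and inj': "inj_on e' {..m}"
    by (auto simp: inj_on_def e'_def)
  let ?J = "\<lambda>e t. if sector vs b t then exp (sector_exponent e vs t) else 0"
  \<comment> \<open>Lower limit for the new coordinate: the preceding coordinate, or 0 if there is
    none.\<close>
  let ?l = "\<lambda>t. if vs = [] then 0 else t (last vs)"
  have upd: "sector vs b (t(v := y)) = sector vs b t" "sector_exponent e vs (t(v := y)) = sector_exponent e vs t"
    "?l (t(v := y)) = ?l t" for t y
  proof -
    have "map (t(v := y)) vs = map t vs" using v by (auto intro: map_cong)
    then show "sector vs b (t(v := y)) = sector vs b t" using v by (auto simp: sector_def open_cube_def)
    have "vs ! k \<noteq> v" if "k < length vs" for k using v that by auto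
    then show "sector_exponent e vs (t(v := y)) = sector_exponent e vs t" by (simp add: sector_exponent_def)
    show "?l (t(v := y)) = ?l t" using v by (auto dest: last_in_set)
  qed
  have app: "sector_exponent e (vs @ [v]) t = sector_exponent e vs t + \<mu> * of_real (t v)" for t
    by (simp add: sector_exponent_def \<mu>_def m_def nth_append)
  have exp': "sector_exponent e vs t + \<mu> * of_real (?l t) = sector_exponent e' vs t" for t
  proof (cases vs rule: rev_cases)
    case Nil
    then show ?thesis by (simp add: sector_exponent_def)
  next
    case (snoc us u)
    then show ?thesis by (simp add: sector_exponent_def e'_def \<mu>_def m_def nth_append algebra_simps)
  qed
  have inner: "(\<integral>y. (if sector (vs @ [v]) b (t(v := y)) then exp (sector_exponent e (vs @ [v]) (t(v := y))) else 0) \<partial>lborel) =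
    (exp (\<mu> * of_real b) * ?J e t - ?J e' t) / \<mu>" for t
  proof (cases "sector vs b t")
    case True
    have l: "?l t \<le> b" using True assms(3) by (auto simp: sector_def open_cube_def dest: last_in_set intro: less_imp_le)
    have "(\<integral>y. (if sector (vs @ [v]) b (t(v := y)) then exp (sector_exponent e (vs @ [v]) (t(v := y))) else 0) \<partial>lborel) =
      (\<integral>y. (if ?l t < y \<and> y < b then exp (sector_exponent e vs t + \<mu> * of_real y) else 0) \<partial>lborel)"
      unfolding sector_snoc app upd using True by (intro Bochner_Integration.integral_cong) auto
    also have "\<dots> = (exp (sector_exponent e vs t + \<mu> * of_real b) - exp (sector_exponent e vs t + \<mu> * of_real (?l t))) / \<mu>"
      using l \<mu> by (rule integral_exp_linear)
    finally show ?thesis using True by (simp only: exp' exp_add if_True mult.commute)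
  next
    case False
    then show ?thesis unfolding sector_snoc upd by simp
  qed
  have "(\<integral>t. (if sector (vs @ [v]) b t then exp (sector_exponent e (vs @ [v]) t) else 0) \<partial>product_lborel (set (vs @ [v]))) =
    (\<integral>t. (exp (\<mu> * of_real b) * ?J e t - ?J e' t) / \<mu> \<partial>product_lborel (set vs))"
    using lborel_product.product_integral_insert[OF finite_set v(1), of "\<lambda>t. if sector (vs @ [v]) b t then exp (sector_exponent e (vs @ [v]) t) else 0"]
      integrable_sector_exponent[of "vs @ [v]" b e]
    by (simp add: inner)
  also have "\<dots> = (exp (\<mu> * of_real b) * (\<integral>t. ?J e t \<partial>product_lborel (set vs)) - (\<integral>t. ?J e' t \<partial>product_lborel (set vs))) / \<mu>"
    by (simp add: integrable_sector_exponent)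
  also have "\<dots> = (exp (\<mu> * of_real b) * divided_difference e (\<lambda>a. exp (of_real b * (e m - e a))) {..m}
     - divided_difference e' (\<lambda>a. exp (of_real b * (e' m - e' a))) {..m}) / \<mu>"
    using snoc.IH[OF v(2)] inj inj' by (simp add: m_def)
  \<comment> \<open>The upper limit \<open>b\<close> contributes the divided difference without node
    \<open>Suc m\<close>, the lower limit the one without node \<open>m\<close>; these are the two
    terms of the recursion.\<close>
  also have "exp (\<mu> * of_real b) * divided_difference e (\<lambda>a. exp (of_real b * (e m - e a))) {..m} =
     divided_difference e (\<lambda>a. exp (of_real b * (e (Suc m) - e a))) ({..Suc m} - {Suc m})"
  proof -
    have "{..Suc m} - {Suc m} = {..m}" by auto
    then show ?thesis
      unfolding divided_difference_def sum_distrib_left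
      by (simp only:) (intro sum.cong, auto simp: \<mu>_def mult_exp_exp mult.assoc[symmetric] algebra_simps)
  qed
  also have "divided_difference e' (\<lambda>a. exp (of_real b * (e' m - e' a))) {..m} =
     divided_difference e (\<lambda>a. exp (of_real b * (e (Suc m) - e a))) ({..Suc m} - {m})"
  proof -
    have s: "{..m} = insert m {..<m}" "{..Suc m} - {m} = insert (Suc m) {..<m}" by auto
    have s': "insert m {..<m} - {a} = insert m ({..<m} - {a})" "insert (Suc m) {..<m} - {a} = insert (Suc m) ({..<m} - {a})"
      if "a < m" for a using that by auto
    show ?thesis
      unfolding divided_difference_def s
      by (subst sum.insert, simp, simp, subst sum.insert, simp, simp, intro arg_cong2[of _ _ _ _ "(+)"] sum.cong)
        (auto simp: s' e'_def intro!: prod.cong)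
  qed
  also have "(divided_difference e (\<lambda>a. exp (of_real b * (e (Suc m) - e a))) ({..Suc m} - {Suc m})
     - divided_difference e (\<lambda>a. exp (of_real b * (e (Suc m) - e a))) ({..Suc m} - {m})) / \<mu> =
     divided_difference e (\<lambda>a. exp (of_real b * (e (Suc m) - e a))) {..Suc m}"
    using divided_difference_rec[of "{..Suc m}" e "Suc m" m "\<lambda>a. exp (of_real b * (e (Suc m) - e a))"] snoc.prems(2) \<mu>
    by (simp add: \<mu>_def[symmetric] m_def[symmetric] field_simps)
  finally show ?case by (simp add: m_def)
qed

section \<open>Time-ordered terms\<close>

lemma flip_signs_flip_signs:
  "flip_signs A (flip_signs B q) = flip_signs (sym_diff A B) q"
  by (auto simp: flip_signs_def vec_eq_iff)

lemma bij_betw_sym_diff: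
  assumes "C \<subseteq> S"
  shows "bij_betw (\<lambda>A. sym_diff A C) (Pow S) (Pow S)"
proof -
  have "\<forall>A\<in>Pow S. sym_diff (sym_diff A C) C = A" by blast
  moreover have "(\<lambda>A. sym_diff A C) ` Pow S \<subseteq> Pow S" using assms by blast
  ultimately show ?thesis by (intro bij_betw_byWitness[where f' = "\<lambda>A. sym_diff A C"])
qed

text \<open>The contribution of a line with end points \<open>x\<close> and \<open>y\<close> to the exponent in a sector.\<close>

lemma sector_line_exponent:
  fixes r x y :: 'v and t :: "'v \<Rightarrow> real"
  defines "c \<equiv> \<lambda>U. (of_bool ((x \<in> U) \<noteq> (y \<in> U)) :: real)" and "X \<equiv> \<lambda>v. if v = r then 0 else t v"
  assumes "x \<noteq> y" "r \<notin> set vs" "distinct vs" "sector vs b t"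
  shows "(\<Sum>k<length vs. (c (insert r (set (take (Suc k) vs))) - c (insert r (set (take k vs)))) * t (vs ! k)) =
    (if x \<in> insert r (set vs) \<and> y \<in> insert r (set vs) then - \<bar>X x - X y\<bar>
     else if x \<in> insert r (set vs) then X x else if y \<in> insert r (set vs) then X y else 0)"
  using assms(4-)
proof (induction vs rule: rev_induct)
  case Nil
  then show ?case using \<open>x \<noteq> y\<close> by (auto simp: X_def)
next
  case (snoc v vs)
  have sec: "sector vs b t" and b: "0 < t v" using snoc.prems(3) by (auto simp: sector_def open_cube_def sorted_wrt_append)
  have less: "X w < t v" if "w \<in> insert r (set vs)" for w
    using snoc.prems that by (auto simp: sector_def open_cube_def sorted_wrt_append X_def)
  have v: "v \<noteq> r" "v \<notin> set vs" "X v = t v" using snoc.prems by (auto simp: X_def)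
  have IH: "(\<Sum>k<length vs. (c (insert r (set (take (Suc k) vs))) - c (insert r (set (take k vs)))) * t (vs ! k)) =
    (if x \<in> insert r (set vs) \<and> y \<in> insert r (set vs) then - \<bar>X x - X y\<bar>
     else if x \<in> insert r (set vs) then X x else if y \<in> insert r (set vs) then X y else 0)"
    using snoc.prems sec by (intro snoc.IH) auto
  \<comment> \<open>A line is in the cut from the entry of its earlier end point to that of its
    later one, so its increments give plus the earlier and minus the later angle. By
    \<open>less\<close>, the new vertex \<open>v\<close> is later than all vertices entered so
    far.\<close>
  have "(\<Sum>k<length (vs @ [v]). (c (insert r (set (take (Suc k) (vs @ [v])))) - c (insert r (set (take k (vs @ [v]))))) * t ((vs @ [v]) ! k)) =
    (\<Sum>k<length vs. (c (insert r (set (take (Suc k) vs))) - c (insert r (set (take k vs)))) * t (vs ! k)) +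
    (c (insert r (insert v (set vs))) - c (insert r (set vs))) * t v"
    by (simp add: nth_append)
  also have "\<dots> = (if x \<in> insert v (insert r (set vs)) \<and> y \<in> insert v (insert r (set vs)) then - \<bar>X x - X y\<bar>
     else if x \<in> insert v (insert r (set vs)) then X x else if y \<in> insert v (insert r (set vs)) then X y else 0)"
    unfolding IH using less[of x] less[of y] v \<open>x \<noteq> y\<close> by (auto simp: c_def)
  finally show ?case by (simp only: set_append list.set Un_insert_right Un_empty_right insert_commute[of v r])
qed

section \<open>Energies of cuts and cyclic orders of the vertices\<close>

context matsubara_tree
begin

definition cut :: "'v set \<Rightarrow> 'e set" where
  "cut U = {i \<in> arcs G. (tail G i \<in> U) \<noteq> (head G i \<in> U)}"

text \<open>An energy denominator of time-ordered perturbation theory, with the external integers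
  entering as its imaginary part.\<close>

definition energy :: "('v \<Rightarrow> int) \<Rightarrow> real ^ 'e \<Rightarrow> 'v set \<Rightarrow> complex" where
  "energy N p U = of_real (\<Sum>i\<in>cut U. p $ i) - \<i> * of_int (\<Sum>v\<in>U. N v)"

definition ordered_term :: "('v \<Rightarrow> int) \<Rightarrow> real ^ 'e \<Rightarrow> 'v list \<Rightarrow> complex" where
  "ordered_term N p vs = (\<Prod>k=1..<length vs. 1 / energy N p (set (take k vs)))"

text \<open>All reflections are included because the torus integral is needed at every reflected
  \<open>q\<close>, and because differences of two energies are again energies after a further
  reflection.\<close>

definition generic :: "('v \<Rightarrow> int) \<Rightarrow> real ^ 'e \<Rightarrow> bool" where
  "generic N q \<longleftrightarrow> (\<forall>A\<subseteq>arcs G. \<forall>U. U \<noteq> {} \<longrightarrow> U \<subset> verts G \<longrightarrow> energy N (flip_signs A q) U \<noteq> 0)"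

definition inner_verts :: "'v set" where
  "inner_verts = verts G - {root}"

definition prefix :: "nat \<Rightarrow> 'v list \<Rightarrow> 'v set" where
  "prefix k vs = insert root (set (take k vs))"

text \<open>The cyclic order of \<open>root # vs\<close>, read from behind the first
  \<open>a\<close> entries of \<open>vs\<close>.\<close>

definition rotate_root :: "nat \<Rightarrow> 'v list \<Rightarrow> 'v list" where
  "rotate_root a vs = drop a vs @ root # take a vs"

text \<open>The exponent when each line carries the exponential that decays for positive
  \<open>p $ i\<close>; reflecting \<open>p\<close> on a set of lines gives them the growing one.
  The update places the root at angle 0.\<close>

definition kernel_phase :: "('v \<Rightarrow> int) \<Rightarrow> real ^ 'e \<Rightarrow> ('v \<Rightarrow> real) \<Rightarrow> complex" where
  "kernel_phase N p t = of_real (- (\<Sum>i\<in>arcs G. p $ i * \<bar>(t(root := 0)) (tail G i) - (t(root := 0)) (head G i)\<bar>))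
     - \<i> * of_real (\<Sum>v\<in>inner_verts. of_int (N v) * t v)"

definition torus_kernel :: "('v \<Rightarrow> int) \<Rightarrow> real ^ 'e \<Rightarrow> complex" where
  "torus_kernel N p = (\<integral>t. (if open_cube inner_verts (2 * pi) t then exp (kernel_phase N p t) else 0) \<partial>product_lborel inner_verts)"

definition bose_weight :: "real ^ 'e \<Rightarrow> 'e set \<Rightarrow> complex" where
  "bose_weight q A = (\<Prod>i\<in>arcs G. of_real (if i \<in> A then bose (q $ i) else 1 + bose (q $ i)))"

lemma cut_subset: "cut U \<subseteq> arcs G"
  by (auto simp: cut_def)

text \<open>Through connectedness, every energy of a proper nonempty vertex set depends on some
  \<open>q $ i\<close>. This keeps it nonzero at positive \<open>q\<close> and makes generic points
  dense.\<close>

lemma cut_nonempty: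
  assumes "U \<noteq> {}" "U \<subset> verts G"
  shows "cut U \<noteq> {}"
proof -
  obtain u v where "u \<in> U" "u \<in> verts G" "v \<in> verts G" "v \<notin> U" using assms by blast
  from connected_crossing_arc[OF connected_graph this] show ?thesis
    unfolding cut_def by blast
qed

lemma finite_inner_verts: "finite inner_verts"
  by (simp add: inner_verts_def)

lemma energy_alt:
  "energy N p U = of_real (\<Sum>i\<in>arcs G. p $ i * of_bool ((tail G i \<in> U) \<noteq> (head G i \<in> U))) - \<i> * of_int (\<Sum>v\<in>U. N v)"
proof -
  have "(\<Sum>i\<in>cut U. p $ i) = (\<Sum>i\<in>arcs G. if (tail G i \<in> U) \<noteq> (head G i \<in> U) then p $ i else 0)"
    unfolding cut_def by (rule sum.inter_filter) simp
  also have "\<dots> = (\<Sum>i\<in>arcs G. p $ i * of_bool ((tail G i \<in> U) \<noteq> (head G i \<in> U)))"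
    by (intro sum.cong) auto
  finally show ?thesis by (simp add: energy_def)
qed

text \<open>Split the vertices into \<open>W\<close>, \<open>W' - W\<close> and the rest. Lines
  between the first two parts count with a minus sign, which the reflection supplies; lines between
  the last two count with a plus sign; lines from \<open>W\<close> to the rest cancel.\<close>

lemma energy_diff:
  assumes "W \<subseteq> W'" "W' \<subseteq> verts G"
  shows "energy N (flip_signs (cut W) p) (W' - W) = energy N p W' - energy N p W"
proof -
  have "finite W'" using assms finite_verts finite_subset by blast
  then have N: "(\<Sum>v\<in>W' - W. N v) = (\<Sum>v\<in>W'. N v) - (\<Sum>v\<in>W. N v)"
    using assms by (simp add: sum_diff)
  have "(\<Sum>i\<in>arcs G. flip_signs (cut W) p $ i * of_bool ((tail G i \<in> W' - W) \<noteq> (head G i \<in> W' - W))) =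
    (\<Sum>i\<in>arcs G. p $ i * of_bool ((tail G i \<in> W') \<noteq> (head G i \<in> W'))) -
    (\<Sum>i\<in>arcs G. p $ i * of_bool ((tail G i \<in> W) \<noteq> (head G i \<in> W)))"
    unfolding sum_subtractf[symmetric]
    by (intro sum.cong refl) (use assms in \<open>auto simp: flip_signs_def cut_def\<close>)
  then show ?thesis unfolding energy_alt N by (simp add: right_diff_distrib)
qed

text \<open>The counterpart of \<open>energy_diff\<close> for a segment of the cyclic order that
  passes through the root. The complement of \<open>W\<close> carries minus the external integer of
  \<open>W\<close> because the total is zero.\<close>

lemma energy_complement_Un:
  assumes "W' \<subseteq> W" "W \<subseteq> verts G" "(\<Sum>v\<in>verts G. N v) = 0"
  shows "energy N (flip_signs (cut W) p) ((verts G - W) \<union> W') = energy N p W' - energy N p W"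
proof -
  have "(\<Sum>v\<in>(verts G - W) \<union> W'. N v) = (\<Sum>v\<in>verts G - W. N v) + (\<Sum>v\<in>W'. N v)"
    using assms finite_subset[OF _ finite_verts] by (intro sum.union_disjoint) auto
  also have "(\<Sum>v\<in>verts G - W. N v) = - (\<Sum>v\<in>W. N v)"
    using assms by (simp add: sum_diff)
  finally have N: "(\<Sum>v\<in>(verts G - W) \<union> W'. N v) = (\<Sum>v\<in>W'. N v) - (\<Sum>v\<in>W. N v)" by simp
  have "(\<Sum>i\<in>arcs G. flip_signs (cut W) p $ i * of_bool ((tail G i \<in> (verts G - W) \<union> W') \<noteq> (head G i \<in> (verts G - W) \<union> W'))) =
    (\<Sum>i\<in>arcs G. p $ i * of_bool ((tail G i \<in> W') \<noteq> (head G i \<in> W'))) -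
    (\<Sum>i\<in>arcs G. p $ i * of_bool ((tail G i \<in> W) \<noteq> (head G i \<in> W)))"
    unfolding sum_subtractf[symmetric]
  proof (intro sum.cong refl)
    fix i assume "i \<in> arcs G"
    then have "tail G i \<in> verts G" "head G i \<in> verts G" by auto
    then show "flip_signs (cut W) p $ i * of_bool ((tail G i \<in> (verts G - W) \<union> W') \<noteq> (head G i \<in> (verts G - W) \<union> W')) =
      p $ i * of_bool ((tail G i \<in> W') \<noteq> (head G i \<in> W')) - p $ i * of_bool ((tail G i \<in> W) \<noteq> (head G i \<in> W))"
      using assms(1) \<open>i \<in> arcs G\<close> by (auto simp: flip_signs_def cut_def)
  qed
  then show ?thesis unfolding energy_alt N by (simp add: right_diff_distrib)
qed

lemma energy_verts: "(\<Sum>v\<in>verts G. N v) = 0 \<Longrightarrow> energy N p (verts G) = 0"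
proof -
  have "cut (verts G) = {}" by (auto simp: cut_def)
  then show "(\<Sum>v\<in>verts G. N v) = 0 \<Longrightarrow> energy N p (verts G) = 0" by (simp add: energy_def)
qed

lemma generic_flip_signs:
  assumes "generic N q" "A \<subseteq> arcs G"
  shows "generic N (flip_signs A q)"
  unfolding generic_def flip_signs_flip_signs
proof (intro allI impI)
  fix B U assume "B \<subseteq> arcs G" "U \<noteq> {}" "U \<subset> verts G"
  moreover have "sym_diff B A \<subseteq> arcs G" using \<open>B \<subseteq> arcs G\<close> assms(2) by auto
  ultimately show "energy N (flip_signs (sym_diff B A) q) U \<noteq> 0"
    using assms(1) unfolding generic_def by blast
qed

lemma permutations_inner:
  assumes "vs \<in> permutations_of_set inner_verts"
  shows "set vs = inner_verts" "distinct vs" "root \<notin> set vs" "prefix k vs \<subseteq> verts G"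
    "insert root (set vs) = verts G" "length vs = card inner_verts"
proof -
  show 1: "set vs = inner_verts" "distinct vs" using assms by (auto simp: permutations_of_set_def)
  show "root \<notin> set vs" "insert root (set vs) = verts G" using 1 root_in_verts by (auto simp: inner_verts_def)
  show "prefix k vs \<subseteq> verts G"
    using 1 root_in_verts set_take_subset[of k vs] by (auto simp: inner_verts_def prefix_def)
  show "length vs = card inner_verts" using 1 distinct_card by metis
qed

lemma set_take_diff:
  assumes "distinct vs" "a \<le> k"
  shows "set (take k vs) - set (take a vs) = set (take (k - a) (drop a vs))"
proof -
  have "take k vs = take a vs @ take (k - a) (drop a vs)"
    using assms(2) take_add[of a "k - a" vs] by simp
  moreover have "set (take a vs) \<inter> set (drop a vs) = {}"
    using assms(1) by (simp add: set_take_disj_set_drop_if_distinct)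
  then have "set (take a vs) \<inter> set (take (k - a) (drop a vs)) = {}"
    using set_take_subset[of "k - a" "drop a vs"] by blast
  ultimately show ?thesis by auto
qed

lemma prefix_diff:
  assumes "vs \<in> permutations_of_set inner_verts" "a \<le> k"
  shows "prefix k vs - prefix a vs = set (take (k - a) (drop a vs))"
proof -
  have "root \<notin> set (take k vs)"
    using permutations_inner[OF assms(1)] set_take_subset[of k vs] by blast
  then show ?thesis
    using set_take_diff[OF permutations_inner(2)[OF assms(1)] assms(2)] by (auto simp: prefix_def)
qed

lemma verts_diff_prefix:
  assumes "vs \<in> permutations_of_set inner_verts"
  shows "verts G - prefix a vs = set (drop a vs)"
proof -
  have "verts G = insert root (set (take a vs) \<union> set (drop a vs))"
    using permutations_inner[OF assms] by (simp flip: set_append)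
  moreover have "set (take a vs) \<inter> set (drop a vs) = {}"
    using permutations_inner(2)[OF assms] by (simp add: set_take_disj_set_drop_if_distinct)
  moreover have "root \<notin> set (drop a vs)"
    using permutations_inner(3)[OF assms] set_drop_subset[of a vs] by blast
  ultimately show ?thesis by (auto simp: prefix_def)
qed

lemma prefix_mono: "a \<le> k \<Longrightarrow> prefix a vs \<subseteq> prefix k vs"
  unfolding prefix_def by (intro insert_mono set_take_subset_set_take)

text \<open>Two equal nodes would mean a vanishing energy at a reflected point, by
  \<open>energy_diff\<close>.\<close>

lemma inj_on_energy_prefix:
  assumes "generic N p" "vs \<in> permutations_of_set inner_verts"
  shows "inj_on (\<lambda>k. energy N p (prefix k vs)) {..length vs}"
proof -
  have "energy N p (prefix k vs) \<noteq> energy N p (prefix a vs)" if "a < k" "k \<le> length vs" for a k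
  proof -
    have "energy N (flip_signs (cut (prefix a vs)) p) (prefix k vs - prefix a vs) \<noteq> 0"
    proof -
      have "prefix k vs - prefix a vs \<noteq> {}" 
        using that by (simp add: prefix_diff[OF assms(2)])
      moreover have "prefix k vs - prefix a vs \<subset> verts G"
        using permutations_inner(4)[OF assms(2), of k] root_in_verts by (auto simp: prefix_def)
      ultimately show ?thesis
        by (rule assms(1)[unfolded generic_def, rule_format, OF cut_subset])
    qed
    then show ?thesis
      using energy_diff[OF prefix_mono[of a k vs] permutations_inner(4)[OF assms(2)]] that by auto
  qed
  then show ?thesis
    by (intro linorder_inj_onI) (auto simp: eq_commute)
qed

text \<open>After reflecting the cut of the node \<open>a\<close>, its distances to the other nodes
  are the energies of the initial segments of the rotated order. The weight of one node is thus a
  single time-ordered term.\<close>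

lemma prod_energy_rotate_root:
  assumes vs: "vs \<in> permutations_of_set inner_verts" and a: "a \<le> length vs" and N: "(\<Sum>v\<in>verts G. N v) = 0"
  shows "(\<Prod>k\<in>{..length vs} - {a}. 1 / (energy N p (prefix k vs) - energy N p (prefix a vs))) =
    ordered_term N (flip_signs (cut (prefix a vs)) p) (rotate_root a vs)"
  unfolding ordered_term_def
\<comment> \<open>In the rotated list the root is entry number \<open>Suc (length vs - a)\<close>.
  Nodes \<open>k > a\<close> correspond to initial segments ending before the root, nodes
  \<open>k < a\<close> to those containing it.\<close>
proof (rule prod.reindex_bij_witness[where i = "\<lambda>j. if j \<le> length vs - a then a + j else j - Suc (length vs - a)"
    and j = "\<lambda>k. if k > a then k - a else Suc (length vs - a) + k"])
  fix k assume k: "k \<in> {..length vs} - {a}"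
  show "1 / energy N (flip_signs (cut (prefix a vs)) p) (set (take (if k > a then k - a else Suc (length vs - a) + k) (rotate_root a vs))) =
    1 / (energy N p (prefix k vs) - energy N p (prefix a vs))"
  proof (cases "k > a")
    case True
    then have "set (take (k - a) (rotate_root a vs)) = prefix k vs - prefix a vs"
      using k a by (simp add: rotate_root_def prefix_diff[OF vs])
    then show ?thesis
      using True energy_diff[OF prefix_mono[of a k vs] permutations_inner(4)[OF vs]] by simp
  next
    case False
    then have "k < a" using k by auto
    then have "take (Suc (length vs - a) + k) (rotate_root a vs) = drop a vs @ root # take k vs"
      using a by (simp add: rotate_root_def)
    then have "set (take (Suc (length vs - a) + k) (rotate_root a vs)) = (verts G - prefix a vs) \<union> prefix k vs"
      unfolding verts_diff_prefix[OF vs] by (simp add: prefix_def)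
    then show ?thesis
      using False energy_complement_Un[OF prefix_mono[of k a vs] permutations_inner(4)[OF vs] N] \<open>k < a\<close> by simp
  qed
next
  have len: "length (rotate_root a vs) = Suc (length vs)" using a by (simp add: rotate_root_def)
  show "(if j \<le> length vs - a then a + j else j - Suc (length vs - a)) \<in> {..length vs} - {a}"
    if "j \<in> {1..<length (rotate_root a vs)}" for j
    using that a unfolding len by auto
  show "(if k > a then k - a else Suc (length vs - a) + k) \<in> {1..<length (rotate_root a vs)}"
    if "k \<in> {..length vs} - {a}" for k
    using that a unfolding len by auto
  show "(if (if j \<le> length vs - a then a + j else j - Suc (length vs - a)) > a
      then (if j \<le> length vs - a then a + j else j - Suc (length vs - a)) - a
      else Suc (length vs - a) + (if j \<le> length vs - a then a + j else j - Suc (length vs - a))) = j"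
    if "j \<in> {1..<length (rotate_root a vs)}" for j
    using that a unfolding len by auto
qed (use a in auto)

text \<open>Inside a sector the absolute values resolve, and the coefficient of each angle is the
  increment of energy caused by adding its vertex to the initial segment.\<close>

lemma kernel_phase_sector:
  assumes vs: "vs \<in> permutations_of_set inner_verts" and sec: "sector vs b t"
  shows "kernel_phase N p t = sector_exponent (\<lambda>k. energy N p (prefix k vs)) vs t"
proof -
  note vs' = permutations_inner[OF vs]
  let ?c = "\<lambda>i U. of_bool ((tail G i \<in> U) \<noteq> (head G i \<in> U)) :: real"
  have line: "(\<Sum>k<length vs. (?c i (prefix (Suc k) vs) - ?c i (prefix k vs)) * t (vs ! k)) =
     - \<bar>(t(root := 0)) (tail G i) - (t(root := 0)) (head G i)\<bar>" if i: "i \<in> arcs G" for i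
  proof -
    have "tail G i \<in> insert root (set vs)" "head G i \<in> insert root (set vs)" using i vs'(5) by auto
    then show ?thesis
      using sector_line_exponent[of "tail G i" "head G i" root vs b t] no_loops[OF i] vs' sec
      by (auto simp: prefix_def)
  qed
  have step: "energy N p (prefix (Suc k) vs) - energy N p (prefix k vs) =
    of_real (\<Sum>i\<in>arcs G. p $ i * (?c i (prefix (Suc k) vs) - ?c i (prefix k vs))) - \<i> * of_int (N (vs ! k))"
    if k: "k < length vs" for k
  proof -
    have "vs ! k \<notin> set (take k vs)" "vs ! k \<noteq> root"
      using vs' k by (auto simp: in_set_conv_nth nth_eq_iff_index_eq)
    then have "vs ! k \<notin> prefix k vs" "prefix (Suc k) vs = insert (vs ! k) (prefix k vs)" "finite (prefix k vs)"
      using k by (auto simp: prefix_def take_Suc_conv_app_nth)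
    then have "(\<Sum>v\<in>prefix (Suc k) vs. N v) = N (vs ! k) + (\<Sum>v\<in>prefix k vs. N v)"
      by simp
    moreover have "(of_real a - \<i> * of_int (n + k)) - (of_real b - \<i> * of_int k) = of_real (a - b) - \<i> * of_int n"
      for a b :: real and n k :: int by (simp add: algebra_simps)
    ultimately show ?thesis
      unfolding energy_alt right_diff_distrib sum_subtractf by (simp add: distrib_left)
  qed
  define S where "S k = (\<Sum>i\<in>arcs G. p $ i * (?c i (prefix (Suc k) vs) - ?c i (prefix k vs)))" for k
  have "sector_exponent (\<lambda>k. energy N p (prefix k vs)) vs t =
    (\<Sum>k<length vs. of_real (S k * t (vs ! k)) - \<i> * of_real (of_int (N (vs ! k)) * t (vs ! k)))"
    unfolding sector_exponent_def
  proof (intro sum.cong refl)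
    fix k assume "k \<in> {..<length vs}"
    then have "energy N p (prefix (Suc k) vs) - energy N p (prefix k vs) = of_real (S k) - \<i> * of_int (N (vs ! k))"
      unfolding S_def by (intro step) simp
    then show "(energy N p (prefix (Suc k) vs) - energy N p (prefix k vs)) * of_real (t (vs ! k)) =
      of_real (S k * t (vs ! k)) - \<i> * of_real (of_int (N (vs ! k)) * t (vs ! k))"
      by (simp add: left_diff_distrib)
  qed
  also have "\<dots> = of_real (\<Sum>k<length vs. S k * t (vs ! k)) -
      \<i> * of_real (\<Sum>k<length vs. of_int (N (vs ! k)) * t (vs ! k))"
    unfolding sum_subtractf of_real_sum sum_distrib_left ..
  also have "(\<Sum>k<length vs. S k * t (vs ! k)) =
    (\<Sum>i\<in>arcs G. \<Sum>k<length vs. p $ i * ((?c i (prefix (Suc k) vs) - ?c i (prefix k vs)) * t (vs ! k)))"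
    unfolding S_def sum_distrib_right mult.assoc by (rule sum.swap)
  also have "\<dots> = (\<Sum>i\<in>arcs G. - (p $ i * \<bar>(t(root := 0)) (tail G i) - (t(root := 0)) (head G i)\<bar>))"
  proof (intro sum.cong refl)
    fix i assume "i \<in> arcs G"
    from line[OF this] show "(\<Sum>k<length vs. p $ i * ((?c i (prefix (Suc k) vs) - ?c i (prefix k vs)) * t (vs ! k))) =
      - (p $ i * \<bar>(t(root := 0)) (tail G i) - (t(root := 0)) (head G i)\<bar>)"
      unfolding sum_distrib_left[symmetric] by simp
  qed
  also have "(\<Sum>k<length vs. of_int (N (vs ! k)) * t (vs ! k)) = (\<Sum>v\<in>inner_verts. of_int (N v) * t v)"
    using bij_betw_nth[OF vs'(2), of "{..<length vs}" inner_verts] vs'(1)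
    by (intro sum.reindex_bij_betw) auto
  finally show ?thesis unfolding kernel_phase_def sum_negf by (rule sym)
qed

lemma measurable_kernel_phase [measurable]:
  "kernel_phase N p \<in> borel_measurable (product_lborel inner_verts)"
proof -
  have "(\<lambda>t. (t(root := 0)) v) \<in> borel_measurable (product_lborel inner_verts)" if "v \<in> verts G" for v
    using that by (cases "v = root") (auto simp: inner_verts_def)
  then have [measurable]: "(\<lambda>t. (t(root := 0)) (tail G i)) \<in> borel_measurable (product_lborel inner_verts)"
    "(\<lambda>t. (t(root := 0)) (head G i)) \<in> borel_measurable (product_lborel inner_verts)" if "i \<in> arcs G" for i
    using that by auto
  show ?thesis unfolding kernel_phase_def by measurable
qed

lemma torus_kernel_eq:
  assumes "generic N p"
  shows "torus_kernel N p = (\<Sum>vs\<in>permutations_of_set inner_verts.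
    divided_difference (\<lambda>k. energy N p (prefix k vs))
      (\<lambda>a. exp (of_real (2 * pi) * (energy N p (prefix (length vs) vs) - energy N p (prefix a vs)))) {..length vs})"
proof -
  have eq: "(if sector vs (2 * pi) t then exp (kernel_phase N p t) else 0) =
    (if sector vs (2 * pi) t then exp (sector_exponent (\<lambda>k. energy N p (prefix k vs)) vs t) else 0)"
    if "vs \<in> permutations_of_set inner_verts" for vs t
    using kernel_phase_sector[OF that] by auto
  have "torus_kernel N p = (\<Sum>vs\<in>permutations_of_set inner_verts.
    \<integral>t. (if sector vs (2 * pi) t then exp (kernel_phase N p t) else 0) \<partial>product_lborel inner_verts)"
    unfolding torus_kernel_def
  proof (rule integral_cube_sectors[OF finite_inner_verts])
    fix vs assume vs: "vs \<in> permutations_of_set inner_verts"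
    show "integrable (product_lborel inner_verts) (\<lambda>t. if sector vs (2 * pi) t then exp (kernel_phase N p t) else 0)"
      unfolding eq[OF vs] using integrable_sector_exponent[of vs] permutations_inner(1)[OF vs] by metis
  qed measurable
  also have "\<dots> = (\<Sum>vs\<in>permutations_of_set inner_verts.
    divided_difference (\<lambda>k. energy N p (prefix k vs))
      (\<lambda>a. exp (of_real (2 * pi) * (energy N p (prefix (length vs) vs) - energy N p (prefix a vs)))) {..length vs})"
  proof (intro sum.cong refl)
    fix vs assume vs: "vs \<in> permutations_of_set inner_verts"
    show "(\<integral>t. (if sector vs (2 * pi) t then exp (kernel_phase N p t) else 0) \<partial>product_lborel inner_verts) =
      divided_difference (\<lambda>k. energy N p (prefix k vs))
      (\<lambda>a. exp (of_real (2 * pi) * (energy N p (prefix (length vs) vs) - energy N p (prefix a vs)))) {..length vs}"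
      unfolding eq[OF vs]
      using integral_sector_exponent[OF permutations_inner(2)[OF vs] inj_on_energy_prefix[OF assms vs], of "2 * pi"]
        permutations_inner(1)[OF vs] by simp
  qed
  finally show ?thesis .
qed

text \<open>The root occurs exactly once in a linear order of all vertices. Putting the part behind
  it in front of the part before it recovers \<open>vs\<close>, and the length of the moved part is
  \<open>a\<close>.\<close>

lemma bij_betw_rotate_root:
  "bij_betw (\<lambda>(vs, a). rotate_root a vs)
    (permutations_of_set inner_verts \<times> {..card inner_verts}) (permutations_of_set (verts G))"
proof -
  define before after where "before = takeWhile (\<lambda>v. v \<noteq> root)" and "after \<sigma> = tl (dropWhile (\<lambda>v. v \<noteq> root) \<sigma>)" for \<sigma>
  have split: "before (xs @ root # ys) = xs" "after (xs @ root # ys) = ys" if "root \<notin> set xs" for xs ys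
  proof -
    have "\<And>v. v \<in> set xs \<Longrightarrow> v \<noteq> root" using that by auto
    then show "before (xs @ root # ys) = xs" "after (xs @ root # ys) = ys"
      by (simp_all add: before_def after_def takeWhile_append2 dropWhile_append2)
  qed
  have inner: "root \<notin> set (drop a vs)" if "vs \<in> permutations_of_set inner_verts" for a vs
    using permutations_inner(3)[OF that] set_drop_subset[of a vs] by auto
  have perm: "\<exists>xs ys. \<sigma> = xs @ root # ys \<and> root \<notin> set xs \<and> ys @ xs \<in> permutations_of_set inner_verts \<and> length ys \<le> card inner_verts"
    if "\<sigma> \<in> permutations_of_set (verts G)" for \<sigma>
  proof -
    have \<sigma>: "set \<sigma> = verts G" "distinct \<sigma>" using that by (auto simp: permutations_of_set_def)
    then obtain xs ys where s: "\<sigma> = xs @ root # ys"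
      using split_list[of root \<sigma>] root_in_verts by auto
    have p: "ys @ xs \<in> permutations_of_set inner_verts"
      using \<sigma> unfolding s by (auto simp: permutations_of_set_def inner_verts_def)
    have "length ys \<le> card inner_verts" using permutations_inner(6)[OF p] by simp
    then show ?thesis using s p \<sigma> by auto
  qed
  show ?thesis
  proof (rule bij_betw_byWitness[where f' = "\<lambda>\<sigma>. (after \<sigma> @ before \<sigma>, length (after \<sigma>))"])
    show "\<forall>x\<in>permutations_of_set inner_verts \<times> {..card inner_verts}.
      (after (case x of (vs, a) \<Rightarrow> rotate_root a vs) @ before (case x of (vs, a) \<Rightarrow> rotate_root a vs),
       length (after (case x of (vs, a) \<Rightarrow> rotate_root a vs))) = x"
      by (auto simp: rotate_root_def split[OF inner] permutations_inner(6) min_absorb2)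
    show "\<forall>\<sigma>\<in>permutations_of_set (verts G).
      (case (after \<sigma> @ before \<sigma>, length (after \<sigma>)) of (vs, a) \<Rightarrow> rotate_root a vs) = \<sigma>"
      using perm by (fastforce simp: split rotate_root_def)
    show "(\<lambda>\<sigma>. (after \<sigma> @ before \<sigma>, length (after \<sigma>))) ` permutations_of_set (verts G)
      \<subseteq> permutations_of_set inner_verts \<times> {..card inner_verts}"
      using perm by (fastforce simp: split)
    show "(\<lambda>(vs, a). rotate_root a vs) ` (permutations_of_set inner_verts \<times> {..card inner_verts}) \<subseteq> permutations_of_set (verts G)"
    proof clarify
      fix vs a assume vs: "vs \<in> permutations_of_set inner_verts"
      have "distinct (take a vs @ drop a vs)" "set (take a vs @ drop a vs) = inner_verts"
        using permutations_inner(1,2)[OF vs] by simp_all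
      then show "rotate_root a vs \<in> permutations_of_set (verts G)"
        using root_in_verts unfolding permutations_of_set_def rotate_root_def inner_verts_def distinct_append set_append
        by (simp only: mem_Collect_eq distinct_append set_append distinct.simps list.set) blast
    qed
  qed
qed

text \<open>The whole vertex set has energy 0, and the imaginary part of the exponent is
  \<open>2 * pi\<close> times an integer. Only the real factor of the cut remains.\<close>

lemma exp_energy_prefix:
  assumes N: "(\<Sum>v\<in>verts G. N v) = 0" and vs: "vs \<in> permutations_of_set inner_verts"
  shows "exp (of_real (2 * pi) * (energy N p (prefix (length vs) vs) - energy N p (prefix a vs))) =
    of_real (exp (- (2 * pi) * (\<Sum>i\<in>cut (prefix a vs). p $ i)))"
proof -
  have "prefix (length vs) vs = verts G" using permutations_inner[OF vs] by (simp add: prefix_def)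
  then have "of_real (2 * pi) * (energy N p (prefix (length vs) vs) - energy N p (prefix a vs)) =
    of_real (- (2 * pi) * (\<Sum>i\<in>cut (prefix a vs). p $ i)) + (2 * of_int (\<Sum>v\<in>prefix a vs. N v) * of_real pi) * \<i>"
    using energy_verts[OF N, of p] by (simp add: energy_def algebra_simps)
  then have "exp (of_real (2 * pi) * (energy N p (prefix (length vs) vs) - energy N p (prefix a vs))) =
    exp (of_real (- (2 * pi) * (\<Sum>i\<in>cut (prefix a vs). p $ i))) * exp ((2 * of_int (\<Sum>v\<in>prefix a vs. N v) * of_real pi) * \<i>)"
    by (simp only: exp_add)
  also have "exp ((2 * of_int (\<Sum>v\<in>prefix a vs. N v) * of_real pi) * \<i>) = 1"
  proof -
    have "exp ((2 * of_int k * of_real pi) * \<i>) = 1" for k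
      using exp_integer_2pi[of "of_int k"] by simp
    then show ?thesis .
  qed
  finally show ?thesis by (simp only: exp_of_real mult_1_right)
qed

lemma torus_kernel_rotations:
  assumes "generic N p" and N: "(\<Sum>v\<in>verts G. N v) = 0"
  shows "torus_kernel N p = (\<Sum>(vs, a)\<in>permutations_of_set inner_verts \<times> {..card inner_verts}.
    of_real (exp (- (2 * pi) * (\<Sum>i\<in>cut (prefix a vs). p $ i))) *
    ordered_term N (flip_signs (cut (prefix a vs)) p) (rotate_root a vs))"
  unfolding torus_kernel_eq[OF assms(1)] sum.cartesian_product[symmetric] divided_difference_def
proof (intro sum.cong)
  fix vs a
  assume vs: "vs \<in> permutations_of_set inner_verts" and a: "a \<in> {..card inner_verts}"
  show "exp (of_real (2 * pi) * (energy N p (prefix (length vs) vs) - energy N p (prefix a vs))) *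
      (\<Prod>k\<in>{..length vs} - {a}. 1 / (energy N p (prefix k vs) - energy N p (prefix a vs))) =
    of_real (exp (- (2 * pi) * (\<Sum>i\<in>cut (prefix a vs). p $ i))) *
    ordered_term N (flip_signs (cut (prefix a vs)) p) (rotate_root a vs)"
    using exp_energy_prefix[OF N vs, of p a] prod_energy_rotate_root[OF vs _ N, of a p] a permutations_inner(6)[OF vs]
    by simp
qed (auto simp: permutations_inner(6))

text \<open>Since \<open>exp (2 * pi * x) * bose x = 1 + bose x\<close>, going once around the torus exchanges the
  two weights of a line.\<close>

lemma bose_weight_sym_diff:
  assumes q: "\<And>i. i \<in> arcs G \<Longrightarrow> 0 < q $ i" and C: "C \<subseteq> arcs G"
  shows "bose_weight q A * of_real (exp (- (2 * pi) * (\<Sum>i\<in>C. flip_signs A q $ i))) = bose_weight q (sym_diff A C)"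
proof -
  have b: "exp (2 * pi * x) * bose x = 1 + bose x" "exp (- (2 * pi * x)) * (1 + bose x) = bose x" if "x > 0" for x :: real
  proof -
    define y where "y = exp (2 * pi * x)"
    have "y > 1" using that by (simp add: y_def)
    then show "exp (2 * pi * x) * bose x = 1 + bose x" "exp (- (2 * pi * x)) * (1 + bose x) = bose x"
      unfolding bose_def exp_minus y_def[symmetric] by (simp_all add: field_simps)
  qed
  have "(\<Sum>i\<in>C. flip_signs A q $ i) = (\<Sum>i\<in>arcs G. if i \<in> C then flip_signs A q $ i else 0)"
    using C by (subst sum.inter_restrict[symmetric]) (auto simp: Int_absorb1)
  then have "exp (- (2 * pi) * (\<Sum>i\<in>C. flip_signs A q $ i)) =
    (\<Prod>i\<in>arcs G. exp (- (2 * pi) * (if i \<in> C then flip_signs A q $ i else 0)))"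
    by (simp add: sum_distrib_left exp_sum)
  then have "bose_weight q A * of_real (exp (- (2 * pi) * (\<Sum>i\<in>C. flip_signs A q $ i))) =
    (\<Prod>i\<in>arcs G. of_real ((if i \<in> A then bose (q $ i) else 1 + bose (q $ i)) *
      exp (- (2 * pi) * (if i \<in> C then flip_signs A q $ i else 0))))"
    by (simp only: bose_weight_def of_real_prod of_real_mult prod.distrib)
  also have "\<dots> = bose_weight q (sym_diff A C)"
    unfolding bose_weight_def
  proof (intro prod.cong refl arg_cong[of _ _ of_real])
    fix i assume "i \<in> arcs G"
    then show "(if i \<in> A then bose (q $ i) else 1 + bose (q $ i)) *
      exp (- (2 * pi) * (if i \<in> C then flip_signs A q $ i else 0)) =
      (if i \<in> sym_diff A C then bose (q $ i) else 1 + bose (q $ i))"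
      using b[OF q] by (auto simp: flip_signs_def mult.commute)
  qed
  finally show ?thesis .
qed

lemma sum_bose_weight_torus_kernel:
  assumes q: "\<And>i. i \<in> arcs G \<Longrightarrow> 0 < q $ i" and "generic N q" and N: "(\<Sum>v\<in>verts G. N v) = 0"
  shows "(\<Sum>A\<in>Pow (arcs G). bose_weight q A * torus_kernel N (flip_signs A q)) =
    (\<Sum>A\<in>Pow (arcs G). bose_weight q A * (\<Sum>\<sigma>\<in>permutations_of_set (verts G). ordered_term N (flip_signs A q) \<sigma>))"
proof -
  let ?X = "permutations_of_set inner_verts \<times> {..card inner_verts}"
  have "(\<Sum>A\<in>Pow (arcs G). bose_weight q A * torus_kernel N (flip_signs A q)) =
    (\<Sum>A\<in>Pow (arcs G). \<Sum>(vs, a)\<in>?X. bose_weight q (sym_diff A (cut (prefix a vs))) *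
      ordered_term N (flip_signs (sym_diff A (cut (prefix a vs))) q) (rotate_root a vs))"
  proof (intro sum.cong refl)
    fix A assume A: "A \<in> Pow (arcs G)"
    have "flip_signs (cut U) (flip_signs A q) = flip_signs (sym_diff A (cut U)) q" for U
      by (simp add: flip_signs_flip_signs Un_commute)
    moreover have "bose_weight q A * (of_real (exp (- (2 * pi) * (\<Sum>i\<in>cut U. flip_signs A q $ i))) * z) = bose_weight q (sym_diff A (cut U)) * z" for U z
    proof -
      have "bose_weight q A * of_real (exp (- (2 * pi) * (\<Sum>i\<in>cut U. flip_signs A q $ i))) = bose_weight q (sym_diff A (cut U))"
        by (rule bose_weight_sym_diff) (rule q cut_subset, assumption?)+
      then show ?thesis by (simp only: mult.assoc[symmetric])
    qed
    moreover have "generic N (flip_signs A q)" using A generic_flip_signs[OF assms(2), of A] by simp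
    ultimately show "bose_weight q A * torus_kernel N (flip_signs A q) = (\<Sum>(vs, a)\<in>?X. bose_weight q (sym_diff A (cut (prefix a vs))) *
      ordered_term N (flip_signs (sym_diff A (cut (prefix a vs))) q) (rotate_root a vs))"
      by (simp only: torus_kernel_rotations[OF _ N] sum_distrib_left case_prod_unfold)
  qed
  \<comment> \<open>The cut depends on the order and the position but not on \<open>A\<close>, so
    once the sums are exchanged the symmetric difference with it merely permutes the sets of
    reflected lines.\<close>
  also have "\<dots> = (\<Sum>(vs, a)\<in>?X. \<Sum>A\<in>Pow (arcs G). bose_weight q (sym_diff A (cut (prefix a vs))) *
      ordered_term N (flip_signs (sym_diff A (cut (prefix a vs))) q) (rotate_root a vs))"
    by (subst sum.swap) (simp add: case_prod_unfold)
  also have "\<dots> = (\<Sum>(vs, a)\<in>?X. \<Sum>A\<in>Pow (arcs G). bose_weight q A * ordered_term N (flip_signs A q) (rotate_root a vs))"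
  proof (intro sum.cong refl, clarify)
    fix vs a
    show "(\<Sum>A\<in>Pow (arcs G). bose_weight q (sym_diff A (cut (prefix a vs))) *
      ordered_term N (flip_signs (sym_diff A (cut (prefix a vs))) q) (rotate_root a vs)) =
      (\<Sum>A\<in>Pow (arcs G). bose_weight q A * ordered_term N (flip_signs A q) (rotate_root a vs))"
      by (rule sum.reindex_bij_betw[OF bij_betw_sym_diff[OF cut_subset]])
  qed
  also have "\<dots> = (\<Sum>x\<in>?X. \<Sum>A\<in>Pow (arcs G). bose_weight q A * ordered_term N (flip_signs A q) ((\<lambda>(vs, a). rotate_root a vs) x))"
    by (simp add: case_prod_unfold)
  also have "\<dots> = (\<Sum>\<sigma>\<in>permutations_of_set (verts G). \<Sum>A\<in>Pow (arcs G). bose_weight q A * ordered_term N (flip_signs A q) \<sigma>)"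
    by (rule sum.reindex_bij_betw[OF bij_betw_rotate_root])
  also have "\<dots> = (\<Sum>A\<in>Pow (arcs G). bose_weight q A * (\<Sum>\<sigma>\<in>permutations_of_set (verts G). ordered_term N (flip_signs A q) \<sigma>))"
    by (subst sum.swap) (simp add: sum_distrib_left)
  finally show ?thesis .
qed

end

section \<open>The Matsubara sum as an integral over a torus\<close>

lemma integral_cis_period:
  "(\<integral>s. (if 0 < s \<and> s < 2 * pi then cis (real_of_int k * s) else 0) \<partial>lborel) = (if k = 0 then of_real (2 * pi) else 0)"
proof (cases "k = 0")
  case True
  have "(\<integral>s. (if 0 < s \<and> s < 2 * pi then cis (real_of_int k * s) else 0) \<partial>lborel) =
    (\<integral>s. indicator {0<..<2 * pi} s *\<^sub>R (1::complex) \<partial>lborel)"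
    using True by (intro Bochner_Integration.integral_cong) (auto simp: indicator_def)
  then show ?thesis using True by (simp add: scaleR_conv_of_real)
next
  case False
  have "exp (\<i> * of_int k * of_real (2 * pi)) = 1"
    using exp_integer_2pi[of "of_int k"] by (simp add: mult_ac)
  moreover have "(\<integral>s. (if 0 < s \<and> s < 2 * pi then cis (real_of_int k * s) else 0) \<partial>lborel) =
    (\<integral>s. (if 0 < s \<and> s < 2 * pi then exp (0 + (\<i> * of_int k) * of_real s) else 0) \<partial>lborel)"
    by (intro Bochner_Integration.integral_cong) (simp_all add: cis_conv_exp mult.assoc)
  ultimately show ?thesis
    using integral_exp_linear[of 0 "2 * pi" "\<i> * of_int k" 0] False by simp
qed

lemma integrable_cis_period:
  "integrable lborel (\<lambda>s. if 0 < s \<and> s < 2 * pi then cis (real_of_int k * s) else 0)"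
proof (rule Bochner_Integration.integrable_bound)
  show "integrable lborel (indicator {0<..<2 * pi} :: real \<Rightarrow> real)"
    by (rule integrable_real_indicator) auto
  show "(\<lambda>s. if 0 < s \<and> s < 2 * pi then cis (real_of_int k * s) else 0) \<in> borel_measurable lborel"
    unfolding cis_conv_exp by measurable
qed (auto intro!: always_eventually)

lemma measurable_cis [measurable (raw)]:
  "f \<in> borel_measurable M \<Longrightarrow> (\<lambda>x. cis (f x)) \<in> borel_measurable M"
  unfolding cis_conv_exp by measurable

lemma cis_sum: "finite A \<Longrightarrow> cis (\<Sum>a\<in>A. f a) = (\<Prod>a\<in>A. cis (f a))"
  by (induction A rule: finite_induct) (auto simp: cis_mult[symmetric])

lemma integral_cis_cube:
  assumes "finite W"
  shows "(\<integral>t. (if open_cube W (2 * pi) t then cis (\<Sum>v\<in>W. real_of_int (k v) * t v) else 0) \<partial>product_lborel W) =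
    (if \<forall>v\<in>W. k v = 0 then of_real ((2 * pi) ^ card W) else 0)"
proof -
  have "(if open_cube W (2 * pi) t then cis (\<Sum>v\<in>W. real_of_int (k v) * t v) else 0) =
    (\<Prod>v\<in>W. if 0 < t v \<and> t v < 2 * pi then cis (real_of_int (k v) * t v) else 0)" for t
    using assms by (auto simp: open_cube_def cis_sum intro!: prod.cong)
  then have "(\<integral>t. (if open_cube W (2 * pi) t then cis (\<Sum>v\<in>W. real_of_int (k v) * t v) else 0) \<partial>product_lborel W) =
    (\<Prod>v\<in>W. \<integral>s. (if 0 < s \<and> s < 2 * pi then cis (real_of_int (k v) * s) else 0) \<partial>lborel)"
    using lborel_product.product_integral_prod[OF assms, of "\<lambda>v s. if 0 < s \<and> s < 2 * pi then cis (real_of_int (k v) * s) else 0"]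
      integrable_cis_period by simp
  also have "\<dots> = (\<Prod>v\<in>W. if k v = 0 then of_real (2 * pi) else 0)"
    by (simp only: integral_cis_period)
  also have "\<dots> = (if \<forall>v\<in>W. k v = 0 then of_real ((2 * pi) ^ card W) else 0)"
    using assms by auto
  finally show ?thesis .
qed

context matsubara_tree
begin

lemma summable_on_matsubara_propagators:
  assumes "\<And>i. i \<in> arcs G \<Longrightarrow> q $ i \<noteq> 0"
  shows "(\<lambda>n. \<Prod>i\<in>arcs G. 1 / ((real_of_int (n i))\<^sup>2 + (q $ i)\<^sup>2)) summable_on (arcs G \<rightarrow>\<^sub>E UNIV)"
  using assms by (intro summable_on_prod_PiE summable_on_int_inverse_square) auto

lemma matsubara_summand_le:
  "0 \<le> matsubara_summand G N q n" "matsubara_summand G N q n \<le> (\<Prod>i\<in>arcs G. 1 / ((real_of_int (n i))\<^sup>2 + (q $ i)\<^sup>2))"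
proof -
  have d: "0 \<le> (\<Prod>i\<in>arcs G. (real_of_int (n i))\<^sup>2 + (q $ i)\<^sup>2)" by (intro prod_nonneg) simp
  have "(\<Prod>v\<in>verts G. of_bool ((\<Sum>i\<in>arcs G. incidence G v i * n i) = N v)) \<le> (1::real)"
    by (intro prod_le_1) simp
  with d show "matsubara_summand G N q n \<le> (\<Prod>i\<in>arcs G. 1 / ((real_of_int (n i))\<^sup>2 + (q $ i)\<^sup>2))"
    unfolding matsubara_summand_def prod_dividef by (intro divide_right_mono) auto
  show "0 \<le> matsubara_summand G N q n"
    unfolding matsubara_summand_def by (intro divide_nonneg_nonneg d prod_nonneg) simp
qed

lemma summable_on_matsubara_summand:
  assumes "\<And>i. i \<in> arcs G \<Longrightarrow> q $ i \<noteq> 0"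
  shows "matsubara_summand G N q summable_on (arcs G \<rightarrow>\<^sub>E UNIV)"
  using matsubara_summand_le
  by (intro summable_on_comparison_test[OF summable_on_matsubara_propagators[OF assms]]) auto

text \<open>The vertex equations add up to zero on both sides, so the one at the root follows from
  the others. This is why no angle is assigned to the root.\<close>

lemma flow_divergence_eq_inner:
  fixes n :: "'e \<Rightarrow> int"
  assumes N: "(\<Sum>v\<in>verts G. N v) = 0"
  shows "(\<forall>v\<in>verts G. flow_divergence G n v = N v) \<longleftrightarrow> (\<forall>v\<in>inner_verts. flow_divergence G n v = N v)"
proof -
  have "(\<Sum>v\<in>verts G. flow_divergence G n v) = (\<Sum>i\<in>arcs G. (\<Sum>v\<in>verts G. incidence G v i) * n i)"
    unfolding flow_divergence_def by (subst sum.swap) (simp add: sum_distrib_right)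
  also have "\<dots> = 0" by (simp add: sum_incidence)
  finally have "(\<Sum>v\<in>verts G. flow_divergence G n v - N v) = 0" using N by (simp add: sum_subtractf)
  moreover have "(\<Sum>v\<in>verts G. flow_divergence G n v - N v) =
    (flow_divergence G n root - N root) + (\<Sum>v\<in>inner_verts. flow_divergence G n v - N v)"
    unfolding inner_verts_def using root_in_verts by (intro sum.remove) auto
  ultimately show ?thesis unfolding inner_verts_def by (auto simp: sum.neutral)
qed

lemma matsubara_summand_eq:
  "matsubara_summand G N q n =
    of_bool (\<forall>v\<in>verts G. flow_divergence G n v = N v) * (\<Prod>i\<in>arcs G. 1 / ((real_of_int (n i))\<^sup>2 + (q $ i)\<^sup>2))"
proof -
  have "(\<Prod>v\<in>verts G. of_bool ((\<Sum>i\<in>arcs G. incidence G v i * n i) = N v)) =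
    (of_bool (\<forall>v\<in>verts G. flow_divergence G n v = N v) :: real)"
    by (auto simp: flow_divergence_def intro!: prod.neutral)
  then show ?thesis by (simp add: matsubara_summand_def prod_dividef)
qed

text \<open>Discrete integration by parts: taking differences along the lines is adjoint to the
  divergence. The root drops out because its angle is 0.\<close>

lemma sum_potential_differences:
  fixes n :: "'e \<Rightarrow> int"
  shows "(\<Sum>i\<in>arcs G. real_of_int (n i) * ((t(root := 0)) (head G i) - (t(root := 0)) (tail G i))) =
    (\<Sum>v\<in>inner_verts. real_of_int (flow_divergence G n v) * t v)"
proof -
  have "(t(root := 0)) (head G i) - (t(root := 0)) (tail G i) = (\<Sum>v\<in>inner_verts. real_of_int (incidence G v i) * t v)"
    if i: "i \<in> arcs G" for i
  proof -
    have "(\<Sum>v\<in>inner_verts. real_of_int (incidence G v i) * t v) =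
      (\<Sum>v\<in>inner_verts. (if v = head G i then t v else 0) - (if v = tail G i then t v else 0))"
      by (intro sum.cong refl) (simp add: incidence_eq[OF i])
    also have "\<dots> = (t(root := 0)) (head G i) - (t(root := 0)) (tail G i)"
      using i by (simp add: sum_subtractf finite_inner_verts) (simp add: inner_verts_def)
    finally show ?thesis by simp
  qed
  then have "(\<Sum>i\<in>arcs G. real_of_int (n i) * ((t(root := 0)) (head G i) - (t(root := 0)) (tail G i))) =
    (\<Sum>i\<in>arcs G. \<Sum>v\<in>inner_verts. real_of_int (incidence G v i * n i) * t v)"
    by (intro sum.cong refl) (simp add: sum_distrib_left mult_ac)
  also have "\<dots> = (\<Sum>v\<in>inner_verts. real_of_int (flow_divergence G n v) * t v)"
    by (subst sum.swap) (simp add: flow_divergence_def sum_distrib_right)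
  finally show ?thesis .
qed

lemma potential_difference_bound:
  assumes "open_cube inner_verts b t" "0 < b" "i \<in> arcs G"
  shows "\<bar>(t(root := 0)) (tail G i) - (t(root := 0)) (head G i)\<bar> \<le> b"
proof -
  have "0 \<le> (t(root := 0)) v \<and> (t(root := 0)) v \<le> b" if "v \<in> verts G" for v
    using assms(1,2) that by (auto simp: open_cube_def inner_verts_def intro: less_imp_le)
  from this[of "head G i"] this[of "tail G i"] show ?thesis using assms(3) by auto
qed

lemma integrable_torus_kernel:
  "integrable (product_lborel inner_verts) (\<lambda>t. if open_cube inner_verts (2 * pi) t then exp (kernel_phase N p t) else 0)"
proof (rule integrable_bounded_on_cube[OF finite_inner_verts])
  have [measurable]: "Measurable.pred (product_lborel inner_verts) (open_cube inner_verts (2 * pi))"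
    by (rule pred_open_cube[OF finite_inner_verts])
  show "(\<lambda>t. if open_cube inner_verts (2 * pi) t then exp (kernel_phase N p t) else 0) \<in> borel_measurable (product_lborel inner_verts)"
    by measurable
  fix t assume t: "open_cube inner_verts (2 * pi) t"
  let ?d = "\<lambda>i. \<bar>(t(root := 0)) (tail G i) - (t(root := 0)) (head G i)\<bar>"
  have "- (p $ i * ?d i) \<le> \<bar>p $ i\<bar> * (2 * pi)" if "i \<in> arcs G" for i
  proof -
    have "\<bar>p $ i\<bar> * ?d i \<le> \<bar>p $ i\<bar> * (2 * pi)"
      using potential_difference_bound[OF t _ that] by (intro mult_left_mono) auto
    moreover have "- (p $ i * ?d i) \<le> \<bar>p $ i\<bar> * ?d i"
      unfolding minus_mult_left by (intro mult_right_mono) auto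
    ultimately show ?thesis by linarith
  qed
  then have "(\<Sum>i\<in>arcs G. - (p $ i * ?d i)) \<le> (\<Sum>i\<in>arcs G. \<bar>p $ i\<bar> * (2 * pi))"
    by (intro sum_mono) auto
  then show "norm (if open_cube inner_verts (2 * pi) t then exp (kernel_phase N p t) else 0) \<le> exp (\<Sum>i\<in>arcs G. \<bar>p $ i\<bar> * (2 * pi))"
    using t by (simp add: kernel_phase_def sum_negf del: fun_upd_apply)
qed auto

text \<open>Integrating characters over the torus produces the constraints at the inner vertices.
  Under the integral the sum over \<open>n\<close> is unconstrained and factorises into one Fourier
  series per line; the summable weights \<open>D\<close> justify the exchange.\<close>

lemma matsubara_sum_torus:
  assumes q: "\<And>i. i \<in> arcs G \<Longrightarrow> 0 < q $ i" and N: "(\<Sum>v\<in>verts G. N v) = 0"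
  shows "of_real ((2 * pi) ^ card inner_verts * matsubara_sum G N q) =
    (\<Prod>i\<in>arcs G. of_real (pi / q $ i)) * (\<Sum>A\<in>Pow (arcs G). bose_weight q A * torus_kernel N (flip_signs A q))"
proof -
  define X where "X t i = (t(root := 0)) (head G i) - (t(root := 0)) (tail G i)" for t :: "'v \<Rightarrow> real" and i
  define D where "D n = (\<Prod>i\<in>arcs G. 1 / ((real_of_int (n i))\<^sup>2 + (q $ i)\<^sup>2))" for n :: "'e \<Rightarrow> int"
  define \<theta> where "\<theta> t = (\<Sum>v\<in>inner_verts. real_of_int (N v) * t v)" for t :: "'v \<Rightarrow> real"
  define f where "f n t = (if open_cube inner_verts (2 * pi) t
    then (\<Prod>i\<in>arcs G. cis (real_of_int (n i) * X t i) / complex_of_real ((real_of_int (n i))\<^sup>2 + (q $ i)\<^sup>2)) * cis (- \<theta> t) else 0)"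
    for n t
  have D: "D summable_on (arcs G \<rightarrow>\<^sub>E UNIV)"
    unfolding D_def using q by (intro summable_on_matsubara_propagators) (auto simp: less_imp_neq[THEN not_sym])
  have D0: "D n \<ge> 0" for n unfolding D_def by (intro prod_nonneg) auto
  have f_eq: "f n t = of_real (D n) * (if open_cube inner_verts (2 * pi) t
    then cis (\<Sum>v\<in>inner_verts. real_of_int (flow_divergence G n v - N v) * t v) else 0)" for n t
  proof -
    have "(\<Prod>i\<in>arcs G. cis (real_of_int (n i) * X t i)) * cis (- \<theta> t) =
      cis ((\<Sum>v\<in>inner_verts. real_of_int (flow_divergence G n v) * t v) + - \<theta> t)"
      by (simp only: cis_sum[symmetric] finite_arcs sum_potential_differences[symmetric] X_def cis_mult)
    also have "(\<Sum>v\<in>inner_verts. real_of_int (flow_divergence G n v) * t v) + - \<theta> t =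
      (\<Sum>v\<in>inner_verts. real_of_int (flow_divergence G n v - N v) * t v)"
      by (simp add: \<theta>_def sum_subtractf left_diff_distrib)
    finally show ?thesis
      unfolding f_def D_def by (simp add: prod_dividef)
  qed
  have norm_f: "norm (f n t) = D n * (if open_cube inner_verts (2 * pi) t then 1 else 0)" for n t
    using D0 by (simp add: f_eq norm_mult)
  have meas [measurable]: "(\<lambda>t. if open_cube inner_verts (2 * pi) t then cis (\<Sum>v\<in>inner_verts. real_of_int (k v) * t v) else 0)
    \<in> borel_measurable (product_lborel inner_verts)" for k
  proof -
    have [measurable]: "Measurable.pred (product_lborel inner_verts) (open_cube inner_verts (2 * pi))"
      by (rule pred_open_cube[OF finite_inner_verts])
    have [measurable]: "(\<lambda>t. \<Sum>v\<in>inner_verts. real_of_int (k v) * t v) \<in> borel_measurable (product_lborel inner_verts)"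
      by (intro borel_measurable_sum) measurable
    show ?thesis by measurable
  qed
  have int_f: "integrable (product_lborel inner_verts) (f n)" for n
    unfolding f_eq by (intro integrable_mult_right integrable_bounded_on_cube[OF finite_inner_verts meas, where C = 1]) auto
  have int_1: "(\<integral>t. (if open_cube inner_verts (2 * pi) t then 1 else 0 :: real) \<partial>product_lborel inner_verts) = (2 * pi) ^ card inner_verts"
  proof -
    have "complex_of_real (\<integral>t. (if open_cube inner_verts (2 * pi) t then 1 else 0 :: real) \<partial>product_lborel inner_verts) =
      (\<integral>t. (if open_cube inner_verts (2 * pi) t then cis (\<Sum>v\<in>inner_verts. real_of_int 0 * t v) else 0) \<partial>product_lborel inner_verts)"
      unfolding integral_complex_of_real[symmetric] by (intro Bochner_Integration.integral_cong) auto
    also have "\<dots> = of_real ((2 * pi) ^ card inner_verts)"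
      using integral_cis_cube[OF finite_inner_verts, of "\<lambda>_. 0"] by simp
    finally show ?thesis by (simp only: of_real_eq_iff)
  qed
  have hs: "((\<lambda>n. \<integral>t. f n t \<partial>product_lborel inner_verts) has_sum
    (\<integral>t. (\<Sum>\<^sub>\<infinity>n\<in>arcs G \<rightarrow>\<^sub>E UNIV. f n t) \<partial>product_lborel inner_verts)) (arcs G \<rightarrow>\<^sub>E UNIV)"
  proof (rule has_sum_integral[OF _ int_f, where c = "\<lambda>n. D n * (2 * pi) ^ card inner_verts"])
    show "countable (arcs G \<rightarrow>\<^sub>E (UNIV :: int set))" by (intro countable_PiE) auto
    show "(\<lambda>n. norm (f n t)) summable_on (arcs G \<rightarrow>\<^sub>E UNIV)" for t
      unfolding norm_f by (intro summable_on_cmult_left D)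
    show "(\<integral>t. norm (f n t) \<partial>product_lborel inner_verts) \<le> D n * (2 * pi) ^ card inner_verts" for n
      unfolding norm_f by (simp add: int_1)
    show "(\<lambda>n. D n * (2 * pi) ^ card inner_verts) summable_on (arcs G \<rightarrow>\<^sub>E UNIV)"
      by (intro summable_on_cmult_left D)
  qed
  have lhs: "(\<integral>t. f n t \<partial>product_lborel inner_verts) = of_real ((2 * pi) ^ card inner_verts * matsubara_summand G N q n)" for n
  proof -
    have "(\<integral>t. f n t \<partial>product_lborel inner_verts) = of_real (D n) *
      (if \<forall>v\<in>inner_verts. flow_divergence G n v - N v = 0 then of_real ((2 * pi) ^ card inner_verts) else 0)"
      unfolding f_eq integral_mult_right_zero by (simp only: integral_cis_cube[OF finite_inner_verts])
    then show ?thesis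
      using flow_divergence_eq_inner[OF N, of n] unfolding matsubara_summand_eq D_def[symmetric] by simp
  qed
  have "((\<lambda>n. complex_of_real ((2 * pi) ^ card inner_verts * matsubara_summand G N q n)) has_sum
    of_real ((2 * pi) ^ card inner_verts * matsubara_sum G N q)) (arcs G \<rightarrow>\<^sub>E UNIV)"
    unfolding matsubara_sum_def using q
    by (intro has_sum_of_real has_sum_cmult_right has_sum_infsum summable_on_matsubara_summand) (auto simp: less_imp_neq[THEN not_sym])
  with hs have "of_real ((2 * pi) ^ card inner_verts * matsubara_sum G N q) =
    (\<integral>t. (\<Sum>\<^sub>\<infinity>n\<in>arcs G \<rightarrow>\<^sub>E UNIV. f n t) \<partial>product_lborel inner_verts)"
    unfolding lhs using has_sum_unique by blast
  also have "\<dots> = (\<integral>t. (\<Prod>i\<in>arcs G. of_real (pi / q $ i)) *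
    (\<Sum>A\<in>Pow (arcs G). bose_weight q A * (if open_cube inner_verts (2 * pi) t then exp (kernel_phase N (flip_signs A q) t) else 0)) \<partial>product_lborel inner_verts)"
  proof (intro Bochner_Integration.integral_cong refl)
    fix t :: "'v \<Rightarrow> real"
    show "(\<Sum>\<^sub>\<infinity>n\<in>arcs G \<rightarrow>\<^sub>E UNIV. f n t) = (\<Prod>i\<in>arcs G. of_real (pi / q $ i)) *
    (\<Sum>A\<in>Pow (arcs G). bose_weight q A * (if open_cube inner_verts (2 * pi) t then exp (kernel_phase N (flip_signs A q) t) else 0))"
    proof (cases "open_cube inner_verts (2 * pi) t")
      case False
      then show ?thesis by (simp add: f_def)
    next
      case True
      have X: "\<bar>X t i\<bar> \<le> 2 * pi" if "i \<in> arcs G" for i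
        using potential_difference_bound[OF True _ that] by (simp add: X_def abs_minus_commute del: fun_upd_apply)
      have sm: "(\<lambda>k. norm (cis (real_of_int k * X t i) / complex_of_real ((real_of_int k)\<^sup>2 + (q $ i)\<^sup>2))) summable_on UNIV"
        if "i \<in> arcs G" for i
      proof -
        have "norm (cis (real_of_int k * X t i) / complex_of_real ((real_of_int k)\<^sup>2 + (q $ i)\<^sup>2)) = 1 / ((real_of_int k)\<^sup>2 + (q $ i)\<^sup>2)" for k
          by (simp only: norm_divide norm_cis norm_of_real) (simp add: abs_of_nonneg)
        then show ?thesis using summable_on_int_inverse_square[of "q $ i"] q[OF that] by simp
      qed
      have "(\<Sum>\<^sub>\<infinity>n\<in>arcs G \<rightarrow>\<^sub>E UNIV. f n t) =
        (\<Sum>\<^sub>\<infinity>n\<in>arcs G \<rightarrow>\<^sub>E UNIV. \<Prod>i\<in>arcs G. cis (real_of_int (n i) * X t i) / complex_of_real ((real_of_int (n i))\<^sup>2 + (q $ i)\<^sup>2)) * cis (- \<theta> t)"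
        using True unfolding f_def by (simp only: if_True infsum_cmult_left')
      also have "(\<Sum>\<^sub>\<infinity>n\<in>arcs G \<rightarrow>\<^sub>E UNIV. \<Prod>i\<in>arcs G. cis (real_of_int (n i) * X t i) / complex_of_real ((real_of_int (n i))\<^sup>2 + (q $ i)\<^sup>2)) =
        (\<Prod>i\<in>arcs G. \<Sum>\<^sub>\<infinity>k. cis (real_of_int k * X t i) / complex_of_real ((real_of_int k)\<^sup>2 + (q $ i)\<^sup>2))"
        using sm by (intro infsum_prod_PiE_abs) auto
      also have "\<dots> = (\<Prod>i\<in>arcs G. of_real (pi / q $ i) *
         (of_real (bose (q $ i) * exp (q $ i * \<bar>X t i\<bar>)) + of_real ((1 + bose (q $ i)) * exp (- (q $ i) * \<bar>X t i\<bar>))))"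
        by (intro prod.cong refl) (use infsum_cis_propagator[OF q X] in \<open>simp add: add.commute\<close>)
      also have "\<dots> = (\<Prod>i\<in>arcs G. of_real (pi / q $ i)) *
         (\<Sum>A\<in>Pow (arcs G). bose_weight q A * of_real (exp (- (\<Sum>i\<in>arcs G. flip_signs A q $ i * \<bar>X t i\<bar>))))"
      proof -
        \<comment> \<open>\<open>A\<close> is the set of lines whose growing exponential, of weight
          \<open>bose (q $ i)\<close>, is chosen when the product of two-term sums is
          expanded.\<close>
        have "(\<Prod>i\<in>A. of_real (bose (q $ i) * exp (q $ i * \<bar>X t i\<bar>))) *
          (\<Prod>i\<in>arcs G - A. of_real ((1 + bose (q $ i)) * exp (- (q $ i) * \<bar>X t i\<bar>))) =
          bose_weight q A * complex_of_real (exp (- (\<Sum>i\<in>arcs G. flip_signs A q $ i * \<bar>X t i\<bar>)))" if A: "A \<subseteq> arcs G" for A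
        proof -
          have "bose_weight q A * complex_of_real (exp (- (\<Sum>i\<in>arcs G. flip_signs A q $ i * \<bar>X t i\<bar>))) =
            (\<Prod>i\<in>arcs G. of_real ((if i \<in> A then bose (q $ i) else 1 + bose (q $ i)) * exp (- (flip_signs A q $ i * \<bar>X t i\<bar>))))"
            unfolding bose_weight_def sum_negf[symmetric] exp_sum[OF finite_arcs] of_real_prod of_real_mult prod.distrib ..
          also have "\<dots> = (\<Prod>i\<in>A. of_real ((if i \<in> A then bose (q $ i) else 1 + bose (q $ i)) * exp (- (flip_signs A q $ i * \<bar>X t i\<bar>)))) *
            (\<Prod>i\<in>arcs G - A. of_real ((if i \<in> A then bose (q $ i) else 1 + bose (q $ i)) * exp (- (flip_signs A q $ i * \<bar>X t i\<bar>))))"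
            by (subst mult.commute) (rule prod.subset_diff[OF A finite_arcs])
          finally show ?thesis by (simp add: flip_signs_def)
        qed
        note weight = this
        show ?thesis
          unfolding prod.distrib prod_add[OF finite_arcs]
          by (intro arg_cong[of _ _ "\<lambda>z. (\<Prod>i\<in>arcs G. complex_of_real (pi / q $ i)) * z"] sum.cong refl weight) simp
      qed
      also have "\<dots> * cis (- \<theta> t) = (\<Prod>i\<in>arcs G. of_real (pi / q $ i)) * (\<Sum>A\<in>Pow (arcs G). bose_weight q A * exp (kernel_phase N (flip_signs A q) t))"
      proof -
        have "exp (of_real (- a) - \<i> * of_real b) = of_real (exp (- a)) * cis (- b)" for a b
          by (simp add: exp_diff exp_of_real cis_conv_exp exp_minus field_simps)
        then have "exp (kernel_phase N (flip_signs A q) t) = of_real (exp (- (\<Sum>i\<in>arcs G. flip_signs A q $ i * \<bar>X t i\<bar>))) * cis (- \<theta> t)" for A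
          unfolding kernel_phase_def X_def \<theta>_def abs_minus_commute[of "(t(root := 0)) (tail G _)"] .
        then show ?thesis by (simp add: sum_distrib_right mult.assoc)
      qed
      finally show ?thesis using True by simp
    qed
  qed
  also have "\<dots> = (\<Prod>i\<in>arcs G. of_real (pi / q $ i)) * (\<Sum>A\<in>Pow (arcs G). bose_weight q A * torus_kernel N (flip_signs A q))"
    by (simp add: torus_kernel_def integrable_torus_kernel)
  finally show ?thesis .
qed

end

section \<open>The Matsubara integral as a limit of Matsubara sums\<close>

lemma integrable_inverse_one_plus_square: "integrable lborel (\<lambda>x::real. 1 / (1 + x\<^sup>2))"
proof -
  have half: "integrable lborel (\<lambda>x::real. indicator {0..} x *\<^sub>R (1 / (1 + x\<^sup>2)))"
  proof -
    have "(\<integral>\<^sup>+(x::real). ennreal (1 / (1 + x\<^sup>2)) * indicator {0..} x \<partial>lborel) = ennreal (pi / 2 - arctan 0)"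
      by (rule nn_integral_FTC_atLeast[where F = arctan])
        (auto intro!: derivative_eq_intros tendsto_arctan_at_top simp: inverse_eq_divide)
    also have "(\<integral>\<^sup>+(x::real). ennreal (1 / (1 + x\<^sup>2)) * indicator {0..} x \<partial>lborel) =
      (\<integral>\<^sup>+(x::real). ennreal (indicator {0..} x *\<^sub>R (1 / (1 + x\<^sup>2))) \<partial>lborel)"
      by (intro nn_integral_cong) (auto simp: indicator_def)
    finally have fin: "(\<integral>\<^sup>+(x::real). ennreal (indicator {0..} x *\<^sub>R (1 / (1 + x\<^sup>2))) \<partial>lborel) < \<infinity>" by simp
    show ?thesis by (rule integrableI_nonneg[OF _ _ fin]) auto
  qed
  have "integrable lborel (\<lambda>x::real. indicator {0..} (0 + -1 * x) *\<^sub>R (1 / (1 + (0 + -1 * x)\<^sup>2)) :: real)"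
    using half by (intro lborel_integrable_real_affine) auto
  with half have "integrable lborel (\<lambda>x::real. indicator {0..} x *\<^sub>R (1 / (1 + x\<^sup>2)) + indicator {0..} (0 + -1 * x) *\<^sub>R (1 / (1 + (0 + -1 * x)\<^sup>2)) :: real)"
    by (rule Bochner_Integration.integrable_add)
  then show ?thesis
    by (rule Bochner_Integration.integrable_bound) (auto intro!: always_eventually simp: indicator_def)
qed

text \<open>Riemann sums with mesh \<open>1 / M\<close> are integrals of step functions.\<close>

lemma has_sum_grid:
  fixes F :: "('e \<Rightarrow> real) \<Rightarrow> real"
  assumes L: "finite L" and M: "M > 0" and nonneg: "\<And>y. 0 \<le> F y"
    and sum: "(\<lambda>n. F (\<lambda>l. real_of_int (n l) / M)) summable_on (L \<rightarrow>\<^sub>E UNIV)"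
  shows "((\<lambda>n. F (\<lambda>l. real_of_int (n l) / M)) has_sum
    (M ^ card L * (\<integral>y. F (\<lambda>l. real_of_int ((\<lambda>l\<in>L. \<lfloor>M * y l\<rfloor>) l) / M) \<partial>product_lborel L))) (L \<rightarrow>\<^sub>E UNIV)"
proof -
  \<comment> \<open>The half-open cells tile the space and only the index \<open>fl y\<close> has
    its cell around \<open>y\<close>, so the sum over all cells has at most one nonzero term at each
    point.\<close>
  define cell where "cell n y = (\<Prod>l\<in>L. indicator {real_of_int (n l) / M ..< (real_of_int (n l) + 1) / M} (y l) :: real)"
    for n :: "'e \<Rightarrow> int" and y :: "'e \<Rightarrow> real"
  define fl where "fl y = (\<lambda>l\<in>L. \<lfloor>M * y l\<rfloor>)" for y :: "'e \<Rightarrow> real"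
  have cell: "cell n y = (if n = fl y then 1 else 0)" if n: "n \<in> L \<rightarrow>\<^sub>E UNIV" for n y
  proof -
    have "y l \<in> {real_of_int (n l) / M ..< (real_of_int (n l) + 1) / M} \<longleftrightarrow> n l = \<lfloor>M * y l\<rfloor>" for l
      using M by (auto simp: field_simps floor_eq_iff eq_commute[of "n l"])
    then have "cell n y = (\<Prod>l\<in>L. if n l = \<lfloor>M * y l\<rfloor> then 1 else 0)"
      unfolding cell_def by (intro prod.cong refl) (simp only: indicator_def of_bool_def)
    moreover have "n = fl y \<longleftrightarrow> (\<forall>l\<in>L. n l = \<lfloor>M * y l\<rfloor>)"
      using n by (auto simp: fl_def fun_eq_iff PiE_def extensional_def restrict_def)
    ultimately show ?thesis using L by auto
  qed
  have fl: "fl y \<in> L \<rightarrow>\<^sub>E UNIV" for y by (auto simp: fl_def)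
  have int1: "integrable lborel (indicator {real_of_int k / M ..< (real_of_int k + 1) / M} :: real \<Rightarrow> real)"
    and val1: "(\<integral>x. indicator {real_of_int k / M ..< (real_of_int k + 1) / M} x \<partial>lborel) = 1 / M" for k
  proof -
    have k: "real_of_int k / M \<le> (real_of_int k + 1) / M" using M by (simp add: divide_right_mono)
    then show "integrable lborel (indicator {real_of_int k / M ..< (real_of_int k + 1) / M} :: real \<Rightarrow> real)"
      by (intro integrable_real_indicator) auto
    show "(\<integral>x. indicator {real_of_int k / M ..< (real_of_int k + 1) / M} x \<partial>lborel) = 1 / M"
      using k by (simp add: diff_divide_distrib[symmetric])
  qed
  have int: "integrable (product_lborel L) (cell n)" and val: "(\<integral>y. cell n y \<partial>product_lborel L) = 1 / M ^ card L" for n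
  proof -
    show "integrable (product_lborel L) (cell n)"
      unfolding cell_def using L int1 by (intro lborel_product.product_integrable_prod) auto
    have "(\<integral>y. cell n y \<partial>product_lborel L) =
      (\<Prod>l\<in>L. \<integral>x. indicator {real_of_int (n l) / M ..< (real_of_int (n l) + 1) / M} x \<partial>lborel)"
      unfolding cell_def by (rule lborel_product.product_integral_prod[OF L int1])
    then show "(\<integral>y. cell n y \<partial>product_lborel L) = 1 / M ^ card L"
      unfolding val1 by (simp add: power_one_over)
  qed
  define g where "g n y = F (\<lambda>l. real_of_int (n l) / M) * cell n y" for n y
  have g: "g n y = (if n = fl y then F (\<lambda>l. real_of_int (fl y l) / M) else 0)" if "n \<in> L \<rightarrow>\<^sub>E UNIV" for n y
    using cell[OF that] by (simp add: g_def)
  have "((\<lambda>n. \<integral>y. g n y \<partial>product_lborel L) has_sum (\<integral>y. (\<Sum>\<^sub>\<infinity>n\<in>L \<rightarrow>\<^sub>E UNIV. g n y) \<partial>product_lborel L)) (L \<rightarrow>\<^sub>E UNIV)"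
  proof (rule has_sum_integral[where c = "\<lambda>n. F (\<lambda>l. real_of_int (n l) / M) * (1 / M ^ card L)"])
    show "countable (L \<rightarrow>\<^sub>E (UNIV :: int set))" using L by (intro countable_PiE) auto
    show "integrable (product_lborel L) (g n)" for n unfolding g_def by (intro integrable_mult_right int)
    show "(\<lambda>n. norm (g n y)) summable_on (L \<rightarrow>\<^sub>E UNIV)" for y
    proof -
      have "(\<lambda>n. norm (g n y)) summable_on {fl y}" by simp
      then show ?thesis
        by (rule summable_on_cong_neutral[THEN iffD1, rotated -1]) (use fl g in auto)
    qed
    have "norm (g n y) = g n y" for n y
      using nonneg by (simp add: g_def cell_def prod_nonneg)
    then show "(\<integral>y. norm (g n y) \<partial>product_lborel L) \<le> F (\<lambda>l. real_of_int (n l) / M) * (1 / M ^ card L)" for n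
      by (simp add: g_def val)
    show "(\<lambda>n. F (\<lambda>l. real_of_int (n l) / M) * (1 / M ^ card L)) summable_on (L \<rightarrow>\<^sub>E UNIV)"
      by (intro summable_on_cmult_left sum)
  qed
  also have "(\<lambda>n. \<integral>y. g n y \<partial>product_lborel L) = (\<lambda>n. (1 / M ^ card L) * F (\<lambda>l. real_of_int (n l) / M))"
    by (simp add: g_def val)
  also have "(\<lambda>y. \<Sum>\<^sub>\<infinity>n\<in>L \<rightarrow>\<^sub>E UNIV. g n y) = (\<lambda>y. F (\<lambda>l. real_of_int (fl y l) / M))"
  proof
    fix y
    have "(\<Sum>\<^sub>\<infinity>n\<in>L \<rightarrow>\<^sub>E UNIV. g n y) = (\<Sum>\<^sub>\<infinity>n\<in>{fl y}. g n y)"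
      using fl g by (intro infsum_cong_neutral) auto
    then show "(\<Sum>\<^sub>\<infinity>n\<in>L \<rightarrow>\<^sub>E UNIV. g n y) = F (\<lambda>l. real_of_int (fl y l) / M)"
      using g[OF fl] by simp
  qed
  finally have "((\<lambda>n. M ^ card L * ((1 / M ^ card L) * F (\<lambda>l. real_of_int (n l) / M))) has_sum
    M ^ card L * (\<integral>y. F (\<lambda>l. real_of_int (fl y l) / M) \<partial>product_lborel L)) (L \<rightarrow>\<^sub>E UNIV)"
    by (rule has_sum_cmult_right)
  then show ?thesis using M by (simp add: fl_def)
qed

context matsubara_tree
begin

abbreviation chords :: "'e set" where
  "chords \<equiv> arcs G - T"

lemma matsubara_integrand_eq:
  "(\<Sum>v\<in>verts G. N v) = 0 \<Longrightarrow>
    matsubara_integrand G N T q y = (\<Prod>i\<in>arcs G. 1 / ((tree_flow N y i)\<^sup>2 + (q $ i)\<^sup>2))"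
  by (simp add: matsubara_integrand_def tree_solution_eq)

lemma matsubara_integrand_nonneg: "0 \<le> matsubara_integrand G N T q y"
  unfolding matsubara_integrand_def by (intro prod_nonneg) simp

text \<open>Tree factors are bounded by a constant, and each chord factor depends on its own
  variable only. The resulting product bound is uniform in \<open>q\<close> above \<epsilon> and
  serves for integrals and grid sums alike.\<close>

lemma matsubara_integrand_le:
  assumes N: "(\<Sum>v\<in>verts G. N v) = 0" and "0 < \<epsilon>" and q: "\<And>i. i \<in> arcs G \<Longrightarrow> \<epsilon> \<le> q $ i"
  shows "matsubara_integrand G N T q y \<le> (1 / \<epsilon>\<^sup>2) ^ card T * (\<Prod>l\<in>chords. 1 / ((y l)\<^sup>2 + \<epsilon>\<^sup>2))"
proof -
  have e: "0 < \<epsilon>\<^sup>2" using assms by simp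
  have sq: "\<epsilon>\<^sup>2 \<le> (q $ i)\<^sup>2" if "i \<in> arcs G" for i
    using q[OF that] \<open>0 < \<epsilon>\<close> by (intro power_mono) auto
  have "matsubara_integrand G N T q y =
    (\<Prod>i\<in>chords. 1 / ((tree_flow N y i)\<^sup>2 + (q $ i)\<^sup>2)) * (\<Prod>i\<in>T. 1 / ((tree_flow N y i)\<^sup>2 + (q $ i)\<^sup>2))"
    unfolding matsubara_integrand_eq[OF N] by (rule prod.subset_diff[OF T_arcs finite_arcs])
  also have "\<dots> \<le> (\<Prod>l\<in>chords. 1 / ((y l)\<^sup>2 + \<epsilon>\<^sup>2)) * (\<Prod>i\<in>T. 1 / \<epsilon>\<^sup>2)"
  proof (intro mult_mono prod_mono conjI)
    fix i assume i: "i \<in> chords"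
    then show "1 / ((tree_flow N y i)\<^sup>2 + (q $ i)\<^sup>2) \<le> 1 / ((y i)\<^sup>2 + \<epsilon>\<^sup>2)"
      using sq[of i] e by (intro frac_le) (auto simp: tree_flow_chord intro: add_nonneg_pos)
  next
    fix i assume i: "i \<in> T"
    then have "\<epsilon>\<^sup>2 \<le> (tree_flow N y i)\<^sup>2 + (q $ i)\<^sup>2" using sq[OF subsetD[OF T_arcs i]] by (simp add: add_increasing)
    then show "1 / ((tree_flow N y i)\<^sup>2 + (q $ i)\<^sup>2) \<le> 1 / \<epsilon>\<^sup>2" using e by (intro frac_le) auto
  qed (auto intro!: prod_nonneg)
  finally show ?thesis by (simp add: mult.commute)
qed

lemma measurable_matsubara_integrand:
  assumes N: "(\<Sum>v\<in>verts G. N v) = 0" and h: "\<And>l. l \<in> chords \<Longrightarrow> (\<lambda>y. h y l) \<in> borel_measurable M"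
  shows "(\<lambda>y. matsubara_integrand G N T q (h y)) \<in> borel_measurable M"
proof -
  have "(\<lambda>y. tree_flow N (h y) i) \<in> borel_measurable M" if "i \<in> arcs G" for i
    using that h by (cases "i \<in> T")
      (auto simp: tree_flow_def intro!: borel_measurable_sum borel_measurable_times borel_measurable_diff)
  then show ?thesis unfolding matsubara_integrand_eq[OF N]
    by (intro borel_measurable_prod borel_measurable_divide borel_measurable_add borel_measurable_power) auto
qed

text \<open>One dominated convergence argument for three purposes: grid points of shrinking mesh for
  the Riemann sums, a fixed grid of mesh 1 with moving \<open>q\<close> for the continuity of the
  sum, and \<open>h k y = y\<close> with moving \<open>q\<close> for the continuity of the
  integral.\<close>

lemma matsubara_integral_limit:
  fixes h :: "nat \<Rightarrow> ('e \<Rightarrow> real) \<Rightarrow> 'e \<Rightarrow> real" and q :: "nat \<Rightarrow> real ^ 'e"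
  assumes N: "(\<Sum>v\<in>verts G. N v) = 0" and "0 < \<epsilon>"
    and q: "\<And>k i. i \<in> arcs G \<Longrightarrow> \<epsilon> \<le> q k $ i" and q': "\<And>i. i \<in> arcs G \<Longrightarrow> (\<lambda>k. q k $ i) \<longlonglongrightarrow> q' $ i"
    and h: "\<And>k y l. l \<in> chords \<Longrightarrow> \<bar>h k y l - y l\<bar> \<le> 1"
    and h': "\<And>y l. l \<in> chords \<Longrightarrow> (\<lambda>k. h k y l) \<longlonglongrightarrow> h' y l"
    and hm: "\<And>k l. l \<in> chords \<Longrightarrow> (\<lambda>y. h k y l) \<in> borel_measurable (product_lborel chords)"
  shows "integrable (product_lborel chords) (\<lambda>y. matsubara_integrand G N T (q k) (h k y))"
    and "(\<lambda>k. \<integral>y. matsubara_integrand G N T (q k) (h k y) \<partial>product_lborel chords) \<longlonglongrightarrow>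
      (\<integral>y. matsubara_integrand G N T q' (h' y) \<partial>product_lborel chords)"
proof -
  \<comment> \<open>Chosen so that \<open>3 + 2 * z\<^sup>2\<close> is at most
    \<open>C * (z\<^sup>2 + \<epsilon>\<^sup>2)\<close> for all \<open>z\<close>; the left side
    bounds \<open>1 + (y l)\<^sup>2\<close> when \<open>z\<close> is within distance 1 of
    \<open>y l\<close>.\<close>
  define C where "C = 2 + 3 / \<epsilon>\<^sup>2"
  have e: "0 < \<epsilon>\<^sup>2" using assms by simp
  have C: "C > 0" using e by (auto simp: C_def intro: add_pos_nonneg)
  define w where "w y = (1 / \<epsilon>\<^sup>2) ^ card T * (\<Prod>l\<in>chords. C * (1 / (1 + (y l)\<^sup>2)))" for y :: "'e \<Rightarrow> real"
  have w: "integrable (product_lborel chords) w"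
    unfolding w_def
    by (intro integrable_mult_right lborel_product.product_integrable_prod integrable_inverse_one_plus_square) auto
  have le: "matsubara_integrand G N T (q k) (h k y) \<le> w y" for k y
  proof -
    have "1 / ((h k y l)\<^sup>2 + \<epsilon>\<^sup>2) \<le> C * (1 / (1 + (y l)\<^sup>2))" if l: "l \<in> chords" for l
    proof -
      have "(y l)\<^sup>2 \<le> 2 * (h k y l)\<^sup>2 + 2 * (h k y l - y l)\<^sup>2"
        using zero_le_power2[of "2 * h k y l - y l"] by (simp add: power2_eq_square algebra_simps)
      moreover have "(h k y l - y l)\<^sup>2 \<le> 1" using h[OF l] by (simp add: abs_square_le_1)
      ultimately have "1 + (y l)\<^sup>2 \<le> 3 + 2 * (h k y l)\<^sup>2" by simp
      also have "\<dots> \<le> C * ((h k y l)\<^sup>2 + \<epsilon>\<^sup>2)"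
        using e by (simp add: C_def distrib_right distrib_left)
      finally show ?thesis
        using e by (simp add: divide_simps add_nonneg_pos add_pos_nonneg)
    qed
    then have "(\<Prod>l\<in>chords. 1 / ((h k y l)\<^sup>2 + \<epsilon>\<^sup>2)) \<le> (\<Prod>l\<in>chords. C * (1 / (1 + (y l)\<^sup>2)))"
      by (intro prod_mono) auto
    then have "(1 / \<epsilon>\<^sup>2) ^ card T * (\<Prod>l\<in>chords. 1 / ((h k y l)\<^sup>2 + \<epsilon>\<^sup>2)) \<le> w y"
      unfolding w_def using e by (intro mult_left_mono) auto
    then show ?thesis
      using matsubara_integrand_le[OF N \<open>0 < \<epsilon>\<close>, of "q k" "h k y"] q by fastforce
  qed
  have meas: "(\<lambda>y. matsubara_integrand G N T (q k) (h k y)) \<in> borel_measurable (product_lborel chords)" for k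
    using hm by (intro measurable_matsubara_integrand[OF N])
  have norm: "norm (matsubara_integrand G N T (q k) (h k y)) \<le> w y" for k y
    using le matsubara_integrand_nonneg by simp
  show "integrable (product_lborel chords) (\<lambda>y. matsubara_integrand G N T (q k) (h k y))"
    by (rule Bochner_Integration.integrable_bound[OF w meas])
      (use norm in \<open>auto intro!: always_eventually intro: order_trans[OF _ abs_ge_self]\<close>)
  have lim: "(\<lambda>k. matsubara_integrand G N T (q k) (h k y)) \<longlonglongrightarrow> matsubara_integrand G N T q' (h' y)" for y
  proof -
    have "(tree_flow N (h' y) i)\<^sup>2 + (q' $ i)\<^sup>2 \<noteq> 0" if "i \<in> arcs G" for i
    proof -
      have "\<epsilon> \<le> q' $ i" by (rule LIMSEQ_le_const[OF q'[OF that]]) (use q[OF that] in auto)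
      then show ?thesis using \<open>0 < \<epsilon>\<close> by (auto simp: sum_power2_eq_zero_iff)
    qed
    then show ?thesis
      unfolding matsubara_integrand_eq[OF N] using h' q'
      by (intro tendsto_prod tendsto_divide tendsto_const tendsto_add tendsto_power tendsto_tree_flow q') auto
  qed
  have lim_meas: "(\<lambda>y. matsubara_integrand G N T q' (h' y)) \<in> borel_measurable (product_lborel chords)"
    by (rule borel_measurable_LIMSEQ_real[OF lim meas])
  show "(\<lambda>k. \<integral>y. matsubara_integrand G N T (q k) (h k y) \<partial>product_lborel chords) \<longlonglongrightarrow>
      (\<integral>y. matsubara_integrand G N T q' (h' y) \<partial>product_lborel chords)"
    by (rule integral_dominated_convergence[OF lim_meas meas w]) (use lim norm in auto)
qed

lemma uniform_lower_bound:
  fixes q :: "real ^ 'e"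
  assumes "\<And>i. i \<in> arcs G \<Longrightarrow> 0 < q $ i"
  obtains \<epsilon> where "0 < \<epsilon>" "\<And>i. i \<in> arcs G \<Longrightarrow> \<epsilon> \<le> q $ i"
proof
  \<comment> \<open>Inserting 1 makes this the minimum of a visibly nonempty set.\<close>
  show "0 < Min (insert 1 ((\<lambda>i. q $ i) ` arcs G))" using assms by simp
  show "Min (insert 1 ((\<lambda>i. q $ i) ` arcs G)) \<le> q $ i" if "i \<in> arcs G" for i
    using that by (intro Min_le) auto
qed

lemma matsubara_sum_chords:
  assumes N: "(\<Sum>v\<in>verts G. N v) = 0"
  shows "matsubara_sum G N q = (\<Sum>\<^sub>\<infinity>y\<in>chords \<rightarrow>\<^sub>E UNIV. matsubara_integrand G N T q (\<lambda>l. real_of_int (y l)))"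
proof -
  let ?P = "\<lambda>n. \<Prod>i\<in>arcs G. 1 / ((real_of_int (n i))\<^sup>2 + (q $ i)\<^sup>2)"
  let ?S = "{n \<in> arcs G \<rightarrow>\<^sub>E UNIV. \<forall>v\<in>verts G. flow_divergence G n v = N v}"
  have "matsubara_sum G N q = infsum ?P ?S"
    unfolding matsubara_sum_def by (rule infsum_cong_neutral) (auto simp: matsubara_summand_eq)
  also have "\<dots> = (\<Sum>\<^sub>\<infinity>y\<in>chords \<rightarrow>\<^sub>E UNIV. ?P (tree_flow N y))"
    by (rule infsum_reindex_bij_betw[OF bij_betw_tree_flow_int[OF N], symmetric])
  also have "\<dots> = (\<Sum>\<^sub>\<infinity>y\<in>chords \<rightarrow>\<^sub>E UNIV. matsubara_integrand G N T q (\<lambda>l. real_of_int (y l)))"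
    unfolding matsubara_integrand_eq[OF N]
    by (intro infsum_cong prod.cong refl) (simp add: tree_flow_of_int)
  finally show ?thesis .
qed

definition grid_point :: "real \<Rightarrow> ('e \<Rightarrow> real) \<Rightarrow> 'e \<Rightarrow> real" where
  "grid_point M y = (\<lambda>l. real_of_int ((\<lambda>l\<in>chords. \<lfloor>M * y l\<rfloor>) l) / M)"

lemma grid_point_near:
  assumes "1 \<le> M" "l \<in> chords"
  shows "\<bar>grid_point M y l - y l\<bar> \<le> 1 / M" "\<bar>grid_point M y l - y l\<bar> \<le> 1"
proof -
  have "\<bar>real_of_int \<lfloor>M * y l\<rfloor> - M * y l\<bar> \<le> 1" by linarith
  then have "\<bar>real_of_int \<lfloor>M * y l\<rfloor> - M * y l\<bar> / M \<le> 1 / M" using assms(1) by (intro divide_right_mono) auto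
  moreover have "grid_point M y l - y l = (real_of_int \<lfloor>M * y l\<rfloor> - M * y l) / M"
    using assms by (simp add: grid_point_def field_simps)
  ultimately show 1: "\<bar>grid_point M y l - y l\<bar> \<le> 1 / M" using assms(1) by (simp add: abs_divide)
  have "1 / M \<le> 1" using assms(1) by simp
  then show "\<bar>grid_point M y l - y l\<bar> \<le> 1" using 1 by linarith
qed

lemma measurable_grid_point:
  "l \<in> chords \<Longrightarrow> (\<lambda>y. grid_point M y l) \<in> borel_measurable (product_lborel chords)"
  unfolding grid_point_def restrict_def by auto

text \<open>Each propagator has degree -2 under joint scaling of momentum and \<open>q\<close>, and
  dividing integer chord values by \<open>M\<close> gives the grid of mesh
  \<open>1 / M\<close>.\<close>

lemma matsubara_sum_grid:
  assumes N: "(\<Sum>v\<in>verts G. N v) = 0" and q: "\<And>i. i \<in> arcs G \<Longrightarrow> 0 < q $ i" and M: "0 < (M::nat)"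
  shows "real M ^ (2 * card (arcs G)) * matsubara_sum G (\<lambda>v. int M * N v) (real M *\<^sub>R q) =
    real M ^ card chords * (\<integral>y. matsubara_integrand G N T q (grid_point (real M) y) \<partial>product_lborel chords)"
proof -
  have N': "(\<Sum>v\<in>verts G. int M * N v) = 0" using N by (simp flip: sum_distrib_left)
  obtain \<epsilon> where \<epsilon>: "0 < \<epsilon>" "\<And>i. i \<in> arcs G \<Longrightarrow> \<epsilon> \<le> q $ i" using uniform_lower_bound[OF q] by blast
  let ?F = "matsubara_integrand G N T q"
  have scale: "real M ^ (2 * card (arcs G)) * matsubara_integrand G (\<lambda>v. int M * N v) T (real M *\<^sub>R q) (\<lambda>l. real_of_int (y l)) =
    ?F (\<lambda>l. real_of_int (y l) / real M)" for y
  proof -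
    have "real M ^ (2 * card (arcs G)) = (\<Prod>i\<in>arcs G. (real M)\<^sup>2)" by (simp add: power_mult)
    then have "real M ^ (2 * card (arcs G)) * matsubara_integrand G (\<lambda>v. int M * N v) T (real M *\<^sub>R q) (\<lambda>l. real_of_int (y l)) =
      (\<Prod>i\<in>arcs G. (real M)\<^sup>2 * (1 / ((tree_flow (\<lambda>v. int M * N v) (\<lambda>l. real_of_int (y l)) i)\<^sup>2 + ((real M *\<^sub>R q) $ i)\<^sup>2)))"
      unfolding matsubara_integrand_eq[OF N'] by (simp only: prod.distrib)
    also have "\<dots> = ?F (\<lambda>l. real_of_int (y l) / real M)"
      unfolding matsubara_integrand_eq[OF N]
    proof (intro prod.cong refl)
      fix i assume i: "i \<in> arcs G"
      let ?x = "tree_flow N (\<lambda>l. real_of_int (y l) / real M) i"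
      have "tree_flow (\<lambda>v. int M * N v) (\<lambda>l. real_of_int (y l)) i = real M * ?x"
        using tree_flow_scale[OF i, of "int M" N "\<lambda>l. real_of_int (y l) / real M"] M by simp
      then have "(tree_flow (\<lambda>v. int M * N v) (\<lambda>l. real_of_int (y l)) i)\<^sup>2 + ((real M *\<^sub>R q) $ i)\<^sup>2 =
        (real M)\<^sup>2 * (?x\<^sup>2 + (q $ i)\<^sup>2)"
        by (simp add: power_mult_distrib distrib_left)
      then show "(real M)\<^sup>2 * (1 / ((tree_flow (\<lambda>v. int M * N v) (\<lambda>l. real_of_int (y l)) i)\<^sup>2 + ((real M *\<^sub>R q) $ i)\<^sup>2)) =
        1 / (?x\<^sup>2 + (q $ i)\<^sup>2)" using M by simp
    qed
    finally show ?thesis .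
  qed
  have "((\<lambda>n. ?F (\<lambda>l. real_of_int (n l) / real M)) has_sum
    (real M ^ card chords * (\<integral>y. ?F (grid_point (real M) y) \<partial>product_lborel chords))) (chords \<rightarrow>\<^sub>E UNIV)"
    unfolding grid_point_def
  proof (rule has_sum_grid)
    have "(\<lambda>n. (1 / \<epsilon>\<^sup>2) ^ card T * (\<Prod>l\<in>chords. 1 / ((real_of_int (n l) / real M)\<^sup>2 + \<epsilon>\<^sup>2))) summable_on (chords \<rightarrow>\<^sub>E UNIV)"
    proof (intro summable_on_cmult_right summable_on_prod_PiE)
      have "1 / ((real_of_int k / real M)\<^sup>2 + \<epsilon>\<^sup>2) = (real M)\<^sup>2 * (1 / ((real_of_int k)\<^sup>2 + (real M * \<epsilon>)\<^sup>2))" for k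
        using M by (simp add: power_divide power_mult_distrib field_simps)
      moreover have "(\<lambda>k. (real M)\<^sup>2 * (1 / ((real_of_int k)\<^sup>2 + (real M * \<epsilon>)\<^sup>2))) summable_on UNIV"
        using M \<epsilon> by (intro summable_on_cmult_right summable_on_int_inverse_square) auto
      ultimately show "(\<lambda>k. 1 / ((real_of_int k / real M)\<^sup>2 + \<epsilon>\<^sup>2)) summable_on UNIV" by simp
    qed auto
    then show "(\<lambda>n. ?F (\<lambda>l. real_of_int (n l) / real M)) summable_on (chords \<rightarrow>\<^sub>E UNIV)"
      by (rule summable_on_comparison_test)
        (auto intro!: matsubara_integrand_le[OF N \<epsilon>(1)] \<epsilon>(2) matsubara_integrand_nonneg)
  qed (use M matsubara_integrand_nonneg in auto)
  then have "real M ^ card chords * (\<integral>y. ?F (grid_point (real M) y) \<partial>product_lborel chords) =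
    (\<Sum>\<^sub>\<infinity>n\<in>chords \<rightarrow>\<^sub>E UNIV. ?F (\<lambda>l. real_of_int (n l) / real M))"
    by (rule infsumI[symmetric])
  also have "\<dots> = real M ^ (2 * card (arcs G)) * matsubara_sum G (\<lambda>v. int M * N v) (real M *\<^sub>R q)"
    unfolding matsubara_sum_chords[OF N'] scale[symmetric] by (rule infsum_cmult_right')
  finally show ?thesis ..
qed

lemma integrable_matsubara_integrand:
  assumes N: "(\<Sum>v\<in>verts G. N v) = 0" and q: "\<And>i. i \<in> arcs G \<Longrightarrow> 0 < q $ i"
  shows "integrable (product_lborel chords) (matsubara_integrand G N T q)"
proof -
  obtain \<epsilon> where \<epsilon>: "0 < \<epsilon>" "\<And>i. i \<in> arcs G \<Longrightarrow> \<epsilon> \<le> q $ i" using uniform_lower_bound[OF q] by blast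
  show ?thesis
    using matsubara_integral_limit(1)[OF N \<epsilon>(1), of "\<lambda>_. q" q "\<lambda>_ y. y" "\<lambda>y. y"] \<epsilon>(2) by simp
qed

lemma matsubara_integral_grid_limit:
  assumes N: "(\<Sum>v\<in>verts G. N v) = 0" and q: "\<And>i. i \<in> arcs G \<Longrightarrow> 0 < q $ i"
  shows "(\<lambda>k. \<integral>y. matsubara_integrand G N T q (grid_point (real (Suc k)) y) \<partial>product_lborel chords)
    \<longlonglongrightarrow> matsubara_integral G N T q"
proof -
  obtain \<epsilon> where \<epsilon>: "0 < \<epsilon>" "\<And>i. i \<in> arcs G \<Longrightarrow> \<epsilon> \<le> q $ i" using uniform_lower_bound[OF q] by blast
  show ?thesis
    unfolding matsubara_integral_def
  proof (rule matsubara_integral_limit(2)[OF N \<epsilon>(1), of "\<lambda>_. q" q "\<lambda>k. grid_point (real (Suc k))" "\<lambda>y. y"])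
    fix k y l assume l: "l \<in> chords"
    show "\<bar>grid_point (real (Suc k)) y l - y l\<bar> \<le> 1" by (rule grid_point_near(2)) (use l in auto)
    show "(\<lambda>y. grid_point (real (Suc k)) y l) \<in> borel_measurable (product_lborel chords)"
      using l by (rule measurable_grid_point)
    have "(\<lambda>k. grid_point (real (Suc k)) y l - y l) \<longlonglongrightarrow> 0"
    proof (rule Lim_null_comparison[OF always_eventually])
      show "\<forall>k. norm (grid_point (real (Suc k)) y l - y l) \<le> inverse (real (Suc k))"
        using grid_point_near(1)[OF _ l, of "real (Suc _)" y] by (simp add: inverse_eq_divide)
    qed (rule LIMSEQ_inverse_real_of_nat)
    then show "(\<lambda>k. grid_point (real (Suc k)) y l) \<longlonglongrightarrow> y l" by (simp add: LIM_zero_cancel)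
  qed (use \<epsilon> in auto)
qed

lemma eventually_lower_bound:
  fixes X :: "nat \<Rightarrow> real ^ 'e"
  assumes q: "\<And>i. i \<in> arcs G \<Longrightarrow> 0 < q $ i" and X: "X \<longlonglongrightarrow> q"
  obtains \<epsilon> K where "0 < \<epsilon>" "\<And>i k. i \<in> arcs G \<Longrightarrow> \<epsilon> \<le> X (k + K) $ i"
proof -
  obtain \<epsilon> where \<epsilon>: "0 < \<epsilon>" "\<And>i. i \<in> arcs G \<Longrightarrow> \<epsilon> \<le> q $ i" using uniform_lower_bound[OF q] by blast
  have "\<forall>\<^sub>F k in sequentially. \<forall>i\<in>arcs G. \<epsilon> / 2 < X k $ i"
  proof (intro eventually_ball_finite ballI)
    fix i assume "i \<in> arcs G"
    then have "\<epsilon> / 2 < q $ i" using \<epsilon>(1) \<epsilon>(2)[of i] by simp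
    then show "\<forall>\<^sub>F k in sequentially. \<epsilon> / 2 < X k $ i"
      using tendsto_vec_nth[OF X, of i] by (rule order_tendstoD(1)[rotated])
  qed simp
  then obtain K where "\<And>k. k \<ge> K \<Longrightarrow> \<forall>i\<in>arcs G. \<epsilon> / 2 < X k $ i"
    unfolding eventually_sequentially by blast
  then show thesis using \<epsilon>(1) by (intro that[of "\<epsilon> / 2" K]) (auto intro: less_imp_le)
qed

text \<open>With mesh 1 the sum is itself an integral of the integrand sampled at grid points, so
  its continuity is another instance of dominated convergence.\<close>

lemma tendsto_matsubara_sum:
  assumes N: "(\<Sum>v\<in>verts G. N v) = 0" and q: "\<And>i. i \<in> arcs G \<Longrightarrow> 0 < q $ i" and X: "X \<longlonglongrightarrow> q"
  shows "(\<lambda>k. matsubara_sum G N (X k)) \<longlonglongrightarrow> matsubara_sum G N q"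
proof -
  obtain \<epsilon> K where \<epsilon>: "0 < \<epsilon>" "\<And>i k. i \<in> arcs G \<Longrightarrow> \<epsilon> \<le> X (k + K) $ i"
    using eventually_lower_bound[OF q X] by blast
  have sum: "matsubara_sum G N p = (\<integral>y. matsubara_integrand G N T p (grid_point 1 y) \<partial>product_lborel chords)"
    if "\<And>i. i \<in> arcs G \<Longrightarrow> 0 < p $ i" for p
    using matsubara_sum_grid[OF N that, of 1] by simp
  have "(\<lambda>k. \<integral>y. matsubara_integrand G N T (X (k + K)) (grid_point 1 y) \<partial>product_lborel chords) \<longlonglongrightarrow>
    (\<integral>y. matsubara_integrand G N T q (grid_point 1 y) \<partial>product_lborel chords)"
    using \<epsilon>(2) tendsto_vec_nth[OF LIMSEQ_ignore_initial_segment[OF X, of K]] grid_point_near(2)[of 1] measurable_grid_point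
    by (intro matsubara_integral_limit(2)[OF N \<epsilon>(1)]) auto
  moreover have "0 < X (k + K) $ i" if "i \<in> arcs G" for i k
    using \<epsilon>(1) \<epsilon>(2)[OF that, of k] by linarith
  ultimately have "(\<lambda>k. matsubara_sum G N (X (k + K))) \<longlonglongrightarrow> matsubara_sum G N q"
    using sum q by simp
  then show ?thesis by (rule LIMSEQ_offset)
qed

lemma tendsto_matsubara_integral:
  assumes N: "(\<Sum>v\<in>verts G. N v) = 0" and q: "\<And>i. i \<in> arcs G \<Longrightarrow> 0 < q $ i" and X: "X \<longlonglongrightarrow> q"
  shows "(\<lambda>k. matsubara_integral G N T (X k)) \<longlonglongrightarrow> matsubara_integral G N T q"
proof -
  obtain \<epsilon> K where \<epsilon>: "0 < \<epsilon>" "\<And>i k. i \<in> arcs G \<Longrightarrow> \<epsilon> \<le> X (k + K) $ i"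
    using eventually_lower_bound[OF q X] by blast
  have "(\<lambda>k. \<integral>y. matsubara_integrand G N T (X (k + K)) y \<partial>product_lborel chords) \<longlonglongrightarrow>
    (\<integral>y. matsubara_integrand G N T q y \<partial>product_lborel chords)"
    using \<epsilon>(2) tendsto_vec_nth[OF LIMSEQ_ignore_initial_segment[OF X, of K]]
    by (intro matsubara_integral_limit(2)[OF N \<epsilon>(1)]) auto
  then have "(\<lambda>k. matsubara_integral G N T (X (k + K))) \<longlonglongrightarrow> matsubara_integral G N T q"
    by (simp add: matsubara_integral_def)
  then show ?thesis by (rule LIMSEQ_offset)
qed

text \<open>The unit flows from the root form a basis of the space of flows supported on the tree.\<close>

lemma card_tree: "card T = card inner_verts"
proof -
  define u :: "'v \<Rightarrow> real ^ 'e" where "u v = (\<chi> i. real_of_int (unit_flow v i))" for v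
  let ?S = "{x :: real ^ 'e. \<forall>i. i \<notin> T \<longrightarrow> x $ i = 0}"
  have inner: "v \<in> verts G" "v \<noteq> root" if "v \<in> inner_verts" for v using that by (auto simp: inner_verts_def)
  have div_u: "flow_divergence G (\<lambda>i. u v $ i) w = of_bool (w = v)" if "v \<in> inner_verts" "w \<in> inner_verts" for v w
  proof -
    have "flow_divergence G (\<lambda>i. u v $ i) w = real_of_int (flow_divergence G (unit_flow v) w)"
      by (simp add: flow_divergence_def u_def)
    then show ?thesis using unit_flow(2)[of v w] inner that by simp
  qed
  have div_sum: "flow_divergence G (\<lambda>i. (\<Sum>v\<in>inner_verts. c v *\<^sub>R u v) $ i) w = c w" if "w \<in> inner_verts" for c w
  proof -
    have "flow_divergence G (\<lambda>i. (\<Sum>v\<in>inner_verts. c v *\<^sub>R u v) $ i) w =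
      (\<Sum>v\<in>inner_verts. c v * flow_divergence G (\<lambda>i. u v $ i) w)"
      unfolding flow_divergence_def by (simp add: sum_distrib_left) (subst sum.swap, simp add: mult_ac)
    also have "\<dots> = (\<Sum>v\<in>inner_verts. if v = w then c w else 0)"
      by (intro sum.cong) (use that in \<open>auto simp: div_u\<close>)
    finally show ?thesis using that by (simp add: finite_inner_verts)
  qed
  have inj: "inj_on u inner_verts"
    using div_u by (intro inj_onI) (metis of_bool_eq_iff)
  have uS: "u ` inner_verts \<subseteq> ?S" using unit_flow(1) inner by (auto simp: u_def)
  have ind: "independent (u ` inner_verts)"
  proof (rule independent_if_scalars_zero)
    fix f x assume f: "(\<Sum>x\<in>u ` inner_verts. f x *\<^sub>R x) = 0" and x: "x \<in> u ` inner_verts"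
    then obtain w where w: "w \<in> inner_verts" "x = u w" by auto
    have "(\<Sum>v\<in>inner_verts. f (u v) *\<^sub>R u v) = 0" using f by (simp add: sum.reindex[OF inj])
    then show "f x = 0" using div_sum[OF w(1), of "\<lambda>v. f (u v)"] w by (simp add: flow_divergence_def)
  qed (simp add: finite_inner_verts)
  have span: "?S \<subseteq> span (u ` inner_verts)"
  proof
    fix x assume x: "x \<in> ?S"
    define c where "c v = flow_divergence G (\<lambda>i. x $ i) v" for v
    \<comment> \<open>Subtracting the combination with the same divergence leaves a divergence-free
      flow on the tree, and such a flow is zero.\<close>
    define z where "z = x - (\<Sum>v\<in>inner_verts. c v *\<^sub>R u v)"
    have zS: "z $ i = 0" if "i \<notin> T" for i
      using x that uS by (auto simp: z_def intro!: sum.neutral)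
    have z0: "flow_divergence G (\<lambda>i. z $ i) v = 0" if "v \<in> inner_verts" for v
      using div_sum[OF that, of c] by (simp add: z_def flow_divergence_def right_diff_distrib sum_subtractf c_def)
    have "(\<Sum>v\<in>verts G. flow_divergence G (\<lambda>i. z $ i) v) = (\<Sum>i\<in>arcs G. real_of_int (\<Sum>v\<in>verts G. incidence G v i) * z $ i)"
      unfolding flow_divergence_def by (subst sum.swap) (simp add: sum_distrib_right)
    also have "\<dots> = 0" by (simp only: sum_incidence cong: sum.cong) simp
    finally have "flow_divergence G (\<lambda>i. z $ i) root = 0"
      using z0 root_in_verts by (subst (asm) sum.remove[of _ root]) (auto simp: inner_verts_def)
    then have div0: "flow_divergence G (\<lambda>i. z $ i) v = 0" if "v \<in> verts G" for v
      using z0 that by (cases "v = root") (auto simp: inner_verts_def)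
    have "z $ i = 0" if "i \<in> arcs G" for i
    proof (rule forest_flow_zero[OF fin_digraph_axioms loopfree_digraph_axioms T_arcs _ _ div0 that])
      show "\<nexists>vs es. undirected_cycle (G\<lparr>arcs := T\<rparr>) vs es"
        using tree by (simp add: spanning_tree_lines_def)
    qed (simp add: zS)
    then have "z = 0" using zS T_arcs by (auto simp: vec_eq_iff)
    then have "x = (\<Sum>v\<in>inner_verts. c v *\<^sub>R u v)" by (simp add: z_def)
    also have "\<dots> \<in> span (u ` inner_verts)"
      by (intro span_sum span_scale span_base imageI)
    finally show "x \<in> span (u ` inner_verts)" .
  qed
  have "dim ?S = card (u ` inner_verts)"
    using basis_card_eq_dim[OF uS span ind] by simp
  moreover have "dim ?S = card T"
    using dim_substandard_cart[of T, where 'a = real] by (simp add: dim_vec_eq)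
  ultimately show ?thesis by (simp add: card_image[OF inj])
qed

end

section \<open>The scaling limit and the time-ordered expression\<close>

lemma bose_bounds:
  assumes "0 < z"
  shows "0 \<le> bose z" "bose z \<le> 1 / (2 * pi * z)"
proof -
  have "0 < 2 * pi * z" using assms by simp
  moreover have "2 * pi * z \<le> exp (2 * pi * z) - 1" using exp_ge_add_one_self[of "2 * pi * z"] by linarith
  ultimately show "0 \<le> bose z" "bose z \<le> 1 / (2 * pi * z)"
    unfolding bose_def by (auto intro!: frac_le divide_nonneg_nonneg)
qed

lemma tendsto_bose_scaled:
  assumes "0 < c"
  shows "(\<lambda>k. bose (real (Suc k) * c)) \<longlonglongrightarrow> 0"
proof (rule Lim_null_comparison[OF always_eventually])
  have "norm (bose (real (Suc k) * c)) \<le> 1 / (2 * pi * c) * inverse (real (Suc k))" for k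
  proof -
    have "1 / (2 * pi * (real (Suc k) * c)) = 1 / (2 * pi * c) * inverse (real (Suc k))"
      by (simp only: inverse_eq_divide times_divide_times_eq mult_1_right mult.assoc mult.commute[of c])
    moreover have "0 < real (Suc k) * c" using assms by simp
    ultimately show ?thesis using bose_bounds[of "real (Suc k) * c"] by (simp only: real_norm_def abs_of_nonneg)
  qed
  then show "\<forall>k. norm (bose (real (Suc k) * c)) \<le> 1 / (2 * pi * c) * inverse (real (Suc k))" by blast
  show "(\<lambda>k. 1 / (2 * pi * c) * inverse (real (Suc k))) \<longlonglongrightarrow> 0"
    using tendsto_mult_left[OF LIMSEQ_inverse_real_of_nat, of "1 / (2 * pi * c)"] by simp
qed

lemma flip_signs_scaleR: "flip_signs A (c *\<^sub>R q) = c *\<^sub>R flip_signs A q"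
  by (simp add: flip_signs_def vec_eq_iff)

lemma flip_signs_nth: "flip_signs A q $ i = (if i \<in> A then - (q $ i) else q $ i)"
  by (simp add: flip_signs_def)

lemma real_polynomial_function_flip_signs_nth:
  "real_polynomial_function (\<lambda>q :: real ^ 'e. flip_signs A q $ i)"
proof -
  have "bounded_linear (\<lambda>q :: real ^ 'e. flip_signs A q $ i)"
    by (cases "i \<in> A") (auto simp: flip_signs_nth intro: bounded_linear_minus bounded_linear_vec_nth)
  then show ?thesis by (rule real_polynomial_function.intros)
qed

context matsubara_tree
begin

text \<open>Each line contributes \<open>pi / q $ i\<close> from its Fourier series, and the torus
  of inner angles has volume \<open>(2 * pi) ^ card inner_verts\<close>. The single terms are
  complex in general.\<close>

definition time_ordered :: "('v \<Rightarrow> int) \<Rightarrow> real ^ 'e \<Rightarrow> complex" where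
  "time_ordered N p = of_real (pi ^ card (arcs G) / (2 * pi) ^ card inner_verts) *
    (\<Prod>i\<in>arcs G. 1 / of_real (p $ i)) * (\<Sum>\<sigma>\<in>permutations_of_set (verts G). ordered_term N p \<sigma>)"

definition positive :: "(real ^ 'e) set" where
  "positive = {q. \<forall>i\<in>arcs G. 0 < q $ i}"

lemma open_positive: "open positive"
proof -
  have "positive = (\<Inter>i\<in>arcs G. {q. 0 < q $ i})" by (auto simp: positive_def)
  moreover have "open {q :: real ^ 'e. 0 < q $ i}" for i
    by (intro open_Collect_less continuous_intros)
  ultimately show ?thesis by (auto intro: open_INT)
qed

text \<open>The sign with which the operator reflects a line is compensated by the odd prefactor
  \<open>1 / q $ i\<close>; this is why all terms of the torus integral carry positive
  weights.\<close>

lemma prod_inverse_flip_signs: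
  assumes "A \<subseteq> arcs G"
  shows "(- 1) ^ card A * (\<Prod>i\<in>arcs G. 1 / complex_of_real (flip_signs A q $ i)) = (\<Prod>i\<in>arcs G. 1 / of_real (q $ i))"
proof -
  have "(- 1 :: complex) ^ card A = (\<Prod>i\<in>arcs G. if i \<in> A then - 1 else 1)"
    using assms by (subst prod.inter_restrict[symmetric]) (auto simp: Int_absorb1)
  then have "(- 1) ^ card A * (\<Prod>i\<in>arcs G. 1 / complex_of_real (flip_signs A q $ i)) =
    (\<Prod>i\<in>arcs G. (if i \<in> A then - 1 else 1) * (1 / complex_of_real (flip_signs A q $ i)))"
    by (simp only: prod.distrib)
  also have "\<dots> = (\<Prod>i\<in>arcs G. 1 / of_real (q $ i))"
    by (intro prod.cong refl) (simp add: flip_signs_nth)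
  finally show ?thesis .
qed

lemma matsubara_sum_generic:
  assumes q: "q \<in> positive" and "generic N q" and N: "(\<Sum>v\<in>verts G. N v) = 0"
  shows "of_real (matsubara_sum G N q) =
    (\<Sum>A\<in>Pow (arcs G). bose_weight q A * ((- 1) ^ card A * time_ordered N (flip_signs A q)))"
proof -
  have q': "\<And>i. i \<in> arcs G \<Longrightarrow> 0 < q $ i" using q by (simp add: positive_def)
  define c where "c = complex_of_real (pi ^ card (arcs G) / (2 * pi) ^ card inner_verts)"
  define Z where "Z = (\<Prod>i\<in>arcs G. 1 / complex_of_real (q $ i))"
  define S where "S A = (\<Sum>\<sigma>\<in>permutations_of_set (verts G). ordered_term N (flip_signs A q) \<sigma>)" for A
  have t: "(- 1) ^ card A * time_ordered N (flip_signs A q) = c * Z * S A" if A: "A \<subseteq> arcs G" for A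
    unfolding time_ordered_def Z_def prod_inverse_flip_signs[OF A, of q, symmetric] c_def S_def by (simp only: mult_ac)
  have "(2 * pi) ^ card inner_verts \<noteq> 0" by simp
  moreover have "(\<Prod>i\<in>arcs G. complex_of_real (pi / q $ i)) = of_real (pi ^ card (arcs G)) * Z"
    by (simp add: Z_def prod_dividef)
  moreover have "(\<Sum>A\<in>Pow (arcs G). bose_weight q A * torus_kernel N (flip_signs A q)) = (\<Sum>A\<in>Pow (arcs G). bose_weight q A * S A)"
    unfolding S_def using q' assms(2) N by (rule sum_bose_weight_torus_kernel)
  moreover have "of_real ((2 * pi) ^ card inner_verts * matsubara_sum G N q) =
    (\<Prod>i\<in>arcs G. of_real (pi / q $ i)) * (\<Sum>A\<in>Pow (arcs G). bose_weight q A * torus_kernel N (flip_signs A q))"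
    using q' N by (rule matsubara_sum_torus)
  ultimately have "of_real (matsubara_sum G N q) = c * Z * (\<Sum>A\<in>Pow (arcs G). bose_weight q A * S A)"
    unfolding c_def by (simp add: field_simps)
  also have "\<dots> = (\<Sum>A\<in>Pow (arcs G). bose_weight q A * (c * Z * S A))"
    by (simp add: sum_distrib_left mult_ac)
  also have "\<dots> = (\<Sum>A\<in>Pow (arcs G). bose_weight q A * ((- 1) ^ card A * time_ordered N (flip_signs A q)))"
    by (intro sum.cong refl) (simp add: t)
  finally show ?thesis .
qed

lemma energy_scale: "energy (\<lambda>v. int M * N v) (real M *\<^sub>R p) U = of_nat M * energy N p U"
  by (simp add: energy_def sum_distrib_left right_diff_distrib mult_ac)

lemma generic_scale: "0 < M \<Longrightarrow> generic N q \<Longrightarrow> generic (\<lambda>v. int M * N v) (real M *\<^sub>R q)"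
  by (simp add: generic_def flip_signs_scaleR energy_scale)

lemma length_permutation: "\<sigma> \<in> permutations_of_set (verts G) \<Longrightarrow> length \<sigma> = Suc (card inner_verts)"
proof -
  assume "\<sigma> \<in> permutations_of_set (verts G)"
  then have "length \<sigma> = card (verts G)" by (metis length_finite_permutations_of_set)
  also have "card (verts G) = Suc (card inner_verts)"
    unfolding inner_verts_def using card_Suc_Diff1[OF finite_verts root_in_verts] by simp
  finally show ?thesis .
qed

lemma time_ordered_scale:
  "time_ordered (\<lambda>v. int M * N v) (real M *\<^sub>R p) = (1 / of_nat M) ^ (card (arcs G) + card inner_verts) * time_ordered N p"
proof -
  have "ordered_term (\<lambda>v. int M * N v) (real M *\<^sub>R p) \<sigma> = (1 / of_nat M) ^ card inner_verts * ordered_term N p \<sigma>"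
    if "\<sigma> \<in> permutations_of_set (verts G)" for \<sigma>
    unfolding ordered_term_def energy_scale length_permutation[OF that]
    by (simp add: prod_dividef power_one_over prod.distrib)
  then have "(\<Sum>\<sigma>\<in>permutations_of_set (verts G). ordered_term (\<lambda>v. int M * N v) (real M *\<^sub>R p) \<sigma>) =
     (1 / of_nat M) ^ card inner_verts * (\<Sum>\<sigma>\<in>permutations_of_set (verts G). ordered_term N p \<sigma>)"
    unfolding sum_distrib_left by (rule sum.cong[OF refl])
  moreover have "(\<Prod>i\<in>arcs G. 1 / complex_of_real ((real M *\<^sub>R p) $ i)) = (1 / of_nat M) ^ card (arcs G) * (\<Prod>i\<in>arcs G. 1 / of_real (p $ i))"
    by (simp add: prod_dividef power_one_over prod.distrib)
  ultimately show ?thesis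
    unfolding time_ordered_def power_add by (simp only: mult_ac)
qed

lemma tendsto_bose_weight_scaled:
  assumes "q \<in> positive" "A \<subseteq> arcs G"
  shows "(\<lambda>k. bose_weight (real (Suc k) *\<^sub>R q) A) \<longlonglongrightarrow> of_bool (A = {})"
proof -
  have "(\<lambda>k. bose_weight (real (Suc k) *\<^sub>R q) A) \<longlonglongrightarrow> (\<Prod>i\<in>arcs G. complex_of_real (if i \<in> A then 0 else 1 + 0))"
    unfolding bose_weight_def
  proof (intro tendsto_prod tendsto_of_real)
    fix i assume "i \<in> arcs G"
    then have "(\<lambda>k. bose (real (Suc k) * q $ i)) \<longlonglongrightarrow> 0"
      using assms by (intro tendsto_bose_scaled) (auto simp: positive_def)
    then show "(\<lambda>k. if i \<in> A then bose ((real (Suc k) *\<^sub>R q) $ i) else 1 + bose ((real (Suc k) *\<^sub>R q) $ i)) \<longlonglongrightarrow> (if i \<in> A then 0 else 1 + 0)"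
      by (cases "i \<in> A") (auto simp del: of_nat_Suc intro!: tendsto_add tendsto_eq_intros)
  qed
  also have "(\<Prod>i\<in>arcs G. complex_of_real (if i \<in> A then 0 else 1 + 0)) = of_bool (A = {})"
    using assms(2) by (auto simp: prod_zero_iff intro!: prod.neutral)
  finally show ?thesis .
qed

lemma matsubara_integral_generic:
  assumes q: "q \<in> positive" and gen: "generic N q" and N: "(\<Sum>v\<in>verts G. N v) = 0"
  shows "of_real (matsubara_integral G N T q) = time_ordered N q"
proof -
  have q': "\<And>i. i \<in> arcs G \<Longrightarrow> 0 < q $ i" using q by (simp add: positive_def)
  \<comment> \<open>Here the size of the tree enters: with \<open>2 * I\<close> powers of
    \<open>M\<close> from the propagators and one per chord from the mesh, \<open>I + V - 1\<close>
    remain, exactly the degree of the time-ordered expression.\<close>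
  have card: "card (arcs G) = card chords + card inner_verts"
    using T_arcs card_tree card_mono[OF finite_arcs T_arcs] by (simp add: card_Diff_subset finite_subset)
  have eq: "of_real (\<integral>y. matsubara_integrand G N T q (grid_point (real M) y) \<partial>product_lborel chords) =
    (\<Sum>A\<in>Pow (arcs G). bose_weight (real M *\<^sub>R q) A * ((- 1) ^ card A * time_ordered N (flip_signs A q)))"
    if M: "0 < (M::nat)" for M
  proof -
    have N': "(\<Sum>v\<in>verts G. int M * N v) = 0" using N by (simp flip: sum_distrib_left)
    have pos: "real M *\<^sub>R q \<in> positive" using q M by (simp add: positive_def)
    have "2 * card (arcs G) = card chords + (card (arcs G) + card inner_verts)" using card by simp
    then have "real M ^ card chords * (real M ^ (card (arcs G) + card inner_verts) * matsubara_sum G (\<lambda>v. int M * N v) (real M *\<^sub>R q)) =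
      real M ^ card chords * (\<integral>y. matsubara_integrand G N T q (grid_point (real M) y) \<partial>product_lborel chords)"
      using matsubara_sum_grid[OF N q' M] by (simp only: power_add mult.assoc)
    then have "(\<integral>y. matsubara_integrand G N T q (grid_point (real M) y) \<partial>product_lborel chords) =
      real M ^ (card (arcs G) + card inner_verts) * matsubara_sum G (\<lambda>v. int M * N v) (real M *\<^sub>R q)"
      using M by simp
    then have "complex_of_real (\<integral>y. matsubara_integrand G N T q (grid_point (real M) y) \<partial>product_lborel chords) =
      of_nat M ^ (card (arcs G) + card inner_verts) * of_real (matsubara_sum G (\<lambda>v. int M * N v) (real M *\<^sub>R q))"
      by simp
    also have "\<dots> = (\<Sum>A\<in>Pow (arcs G). bose_weight (real M *\<^sub>R q) A * ((- 1) ^ card A *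
        (of_nat M ^ (card (arcs G) + card inner_verts) * time_ordered (\<lambda>v. int M * N v) (real M *\<^sub>R flip_signs A q))))"
      unfolding matsubara_sum_generic[OF pos generic_scale[OF M gen] N'] flip_signs_scaleR sum_distrib_left
      by (simp only: mult_ac)
    also have "\<dots> = (\<Sum>A\<in>Pow (arcs G). bose_weight (real M *\<^sub>R q) A * ((- 1) ^ card A * time_ordered N (flip_signs A q)))"
      unfolding time_ordered_scale using M by (simp add: power_one_over)
    finally show ?thesis .
  qed
  \<comment> \<open>Every reflected line brings a factor \<open>bose (M * q $ i)\<close> tending to
    0, so only the unreflected term survives.\<close>
  have "(\<lambda>k. \<Sum>A\<in>Pow (arcs G). bose_weight (real (Suc k) *\<^sub>R q) A * ((- 1) ^ card A * time_ordered N (flip_signs A q))) \<longlonglongrightarrow>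
    (\<Sum>A\<in>Pow (arcs G). of_bool (A = {}) * ((- 1) ^ card A * time_ordered N (flip_signs A q)))"
    using q by (intro tendsto_sum tendsto_mult tendsto_const tendsto_bose_weight_scaled) auto
  also have "(\<Sum>A\<in>Pow (arcs G). of_bool (A = {}) * ((- 1) ^ card A * time_ordered N (flip_signs A q))) =
    (\<Sum>A\<in>Pow (arcs G). if A = {} then time_ordered N q else 0)"
    by (intro sum.cong refl) (simp add: flip_signs_def)
  also have "\<dots> = time_ordered N q" by simp
  finally have "(\<lambda>k. complex_of_real (\<integral>y. matsubara_integrand G N T q (grid_point (real (Suc k)) y) \<partial>product_lborel chords)) \<longlonglongrightarrow> time_ordered N q"
    using eq[of "Suc _"] by (simp only: zero_less_Suc)
  moreover have "(\<lambda>k. complex_of_real (\<integral>y. matsubara_integrand G N T q (grid_point (real (Suc k)) y) \<partial>product_lborel chords)) \<longlonglongrightarrow>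
    of_real (matsubara_integral G N T q)"
    by (intro tendsto_of_real matsubara_integral_grid_limit N q')
  ultimately show ?thesis by (rule LIMSEQ_unique[symmetric])
qed

text \<open>The set \<open>F\<close> allows further polynomials to be kept nonzero at the same
  approximating points; it will hold the reflected denominators of closed forms.\<close>

lemma generic_islimpt:
  assumes q: "q \<in> positive" and "finite F"
    and F: "\<And>p. p \<in> F \<Longrightarrow> real_polynomial_function p \<and> (\<exists>a. p a \<noteq> 0)"
  shows "q islimpt {x \<in> positive. generic N x \<and> (\<forall>p\<in>F. p x \<noteq> 0)}"
proof -
  \<comment> \<open>Only the real parts of the energies are kept nonzero. They are polynomials in
    \<open>q\<close> that do not involve \<open>N\<close>, and this suffices for genericity.\<close>
  define p where "p AU x = (\<Sum>i\<in>cut (snd AU). flip_signs (fst AU) x $ i)" for AU :: "'e set \<times> 'v set" and x :: "real ^ 'e"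
  define E where "E = p ` (Pow (arcs G) \<times> (Pow (verts G) - {{}, verts G}))"
  have "finite E" unfolding E_def by auto
  have E: "real_polynomial_function g \<and> (\<exists>a. g a \<noteq> 0)" if g: "g \<in> E" for g
  proof -
    obtain A U where AU: "g = p (A, U)" "U \<noteq> {}" "U \<subset> verts G" using g by (auto simp: E_def)
    have "real_polynomial_function g"
      unfolding AU(1) p_def using cut_subset[of U]
      by (auto intro!: real_polynomial_function_sum real_polynomial_function_flip_signs_nth intro: finite_subset)
    \<comment> \<open>At the reflected all-ones vector the real part counts the lines of the cut, so
      the polynomial is not identically zero.\<close>
    moreover have "flip_signs A (flip_signs A (\<chi> i. 1)) $ i = (1 :: real)" for i :: 'e
      by (cases "i \<in> A") (simp_all add: flip_signs_nth)
    then have "g (flip_signs A (\<chi> i. 1)) = real (card (cut U))"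
      by (simp add: AU(1) p_def)
    moreover have "card (cut U) \<noteq> 0"
      using cut_nonempty[OF AU(2,3)] finite_subset[OF cut_subset finite_arcs] by simp
    ultimately show ?thesis by (metis of_nat_eq_0_iff)
  qed
  have gen: "generic N x" if "\<forall>g\<in>E. g x \<noteq> 0" for x
    unfolding generic_def
  proof (intro allI impI)
    fix A U assume AU: "A \<subseteq> arcs G" "U \<noteq> {}" "U \<subset> verts G"
    then have "p (A, U) \<in> E" unfolding E_def by auto
    then have "Re (energy N (flip_signs A x) U) \<noteq> 0" using that by (auto simp: energy_def p_def)
    then show "energy N (flip_signs A x) U \<noteq> 0" by auto
  qed
  have "q islimpt (positive \<inter> {x. \<forall>g\<in>E \<union> F. g x \<noteq> 0})"
    using \<open>finite E\<close> assms(2) E F q open_positive by (intro common_nonzero_islimpt) auto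
  then show ?thesis by (rule islimpt_subset) (use gen in auto)
qed

lemma energy_nonzero:
  assumes "q \<in> positive" "U \<noteq> {}" "U \<subset> verts G"
  shows "energy N q U \<noteq> 0"
proof -
  have "0 < (\<Sum>i\<in>cut U. q $ i)"
    using cut_nonempty[OF assms(2,3)] assms(1) finite_subset[OF cut_subset finite_arcs]
    by (intro sum_pos) (auto simp: positive_def cut_def)
  then have "Re (energy N q U) \<noteq> 0" by (simp add: energy_def)
  then show ?thesis by auto
qed

lemma set_take_permutation:
  assumes "\<sigma> \<in> permutations_of_set (verts G)" "k \<in> {1..<length \<sigma>}"
  shows "set (take k \<sigma>) \<noteq> {}" "set (take k \<sigma>) \<subset> verts G"
proof -
  have \<sigma>: "set \<sigma> = verts G" "distinct \<sigma>" using assms(1) by (auto simp: permutations_of_set_def)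
  show "set (take k \<sigma>) \<noteq> {}" using assms(2) by auto
  have "card (set (take k \<sigma>)) = k" using \<sigma>(2) assms(2) by (simp add: distinct_card)
  moreover have "card (verts G) = length \<sigma>" using \<sigma> distinct_card by metis
  ultimately have "set (take k \<sigma>) \<noteq> verts G" using assms(2) by auto
  then show "set (take k \<sigma>) \<subset> verts G" using set_take_subset[of k \<sigma>] \<sigma>(1) by auto
qed

lemma tendsto_time_ordered:
  assumes q: "q \<in> positive" and X: "X \<longlonglongrightarrow> q"
  shows "(\<lambda>k. time_ordered N (X k)) \<longlonglongrightarrow> time_ordered N q"
  unfolding time_ordered_def ordered_term_def
proof (intro tendsto_mult tendsto_const tendsto_prod tendsto_sum tendsto_divide)
  show "(\<lambda>k. complex_of_real (X k $ i)) \<longlonglongrightarrow> of_real (q $ i)" for i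
    by (intro tendsto_of_real tendsto_vec_nth X)
  show "complex_of_real (q $ i) \<noteq> 0" if "i \<in> arcs G" for i using q that by (auto simp: positive_def)
  show "(\<lambda>k. energy N (X k) U) \<longlonglongrightarrow> energy N q U" for U
    unfolding energy_def by (intro tendsto_intros tendsto_vec_nth X)
  show "energy N q (set (take k \<sigma>)) \<noteq> 0" if "\<sigma> \<in> permutations_of_set (verts G)" "k \<in> {1..<length \<sigma>}" for k \<sigma>
    using energy_nonzero[OF q set_take_permutation[OF that]] .
qed

lemma matsubara_integral_eq:
  assumes q: "q \<in> positive" and N: "(\<Sum>v\<in>verts G. N v) = 0"
  shows "of_real (matsubara_integral G N T q) = time_ordered N q"
proof -
  obtain X where X: "\<And>k. X k \<in> positive \<and> generic N (X k)" "X \<longlonglongrightarrow> q"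
    using generic_islimpt[OF q, of "{}" N] unfolding islimpt_sequential by auto
  have "(\<lambda>k. complex_of_real (matsubara_integral G N T (X k))) \<longlonglongrightarrow> of_real (matsubara_integral G N T q)"
    using q by (intro tendsto_of_real tendsto_matsubara_integral N X) (auto simp: positive_def)
  moreover have "(\<lambda>k. complex_of_real (matsubara_integral G N T (X k))) \<longlonglongrightarrow> time_ordered N q"
    using matsubara_integral_generic[OF _ _ N] X tendsto_time_ordered[OF q X(2), of N] by simp
  ultimately show ?thesis by (rule LIMSEQ_unique)
qed

subsection \<open>Closed forms\<close>

text \<open>\<open>P1\<close> and \<open>P2\<close> are the real and imaginary parts of the
  numerator. The equation is required wherever \<open>Q\<close> is nonzero, not only at positive
  \<open>q\<close>, because it is to be used at reflected points.\<close>

definition rational_on_positive :: "(real ^ 'e \<Rightarrow> complex) \<Rightarrow> bool" where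
  "rational_on_positive f \<longleftrightarrow> (\<exists>P1 P2 Q. real_polynomial_function P1 \<and> real_polynomial_function P2 \<and>
     real_polynomial_function Q \<and> (\<forall>q\<in>positive. Q q \<noteq> 0) \<and>
     (\<forall>q. Q q \<noteq> 0 \<longrightarrow> f q = Complex (P1 q) (P2 q) / of_real (Q q)))"

lemma rational_on_positiveI:
  assumes "real_polynomial_function P1" "real_polynomial_function P2" "real_polynomial_function Q"
    and "\<And>q. q \<in> positive \<Longrightarrow> Q q \<noteq> 0"
    and "\<And>q. Q q \<noteq> 0 \<Longrightarrow> f q = Complex (P1 q) (P2 q) / of_real (Q q)"
  shows "rational_on_positive f"
  using assms unfolding rational_on_positive_def by blast

lemma rational_on_positiveE:
  assumes "rational_on_positive f"
  obtains P1 P2 Q where "real_polynomial_function P1" "real_polynomial_function P2" "real_polynomial_function Q"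
    "\<And>q. q \<in> positive \<Longrightarrow> Q q \<noteq> 0"
    "\<And>q. Q q \<noteq> 0 \<Longrightarrow> f q = Complex (P1 q) (P2 q) / of_real (Q q)"
  using assms unfolding rational_on_positive_def by blast

lemma rational_on_positive_const: "rational_on_positive (\<lambda>_. c)"
  by (rule rational_on_positiveI[of "\<lambda>_. Re c" "\<lambda>_. Im c" "\<lambda>_. 1"])
    (auto intro: real_polynomial_function.intros)

lemma rational_on_positive_add:
  assumes "rational_on_positive f" "rational_on_positive g"
  shows "rational_on_positive (\<lambda>q. f q + g q)"
proof -
  obtain P1 P2 Q where f: "real_polynomial_function P1" "real_polynomial_function P2" "real_polynomial_function Q"
    "\<And>q. q \<in> positive \<Longrightarrow> Q q \<noteq> 0" "\<And>q. Q q \<noteq> 0 \<Longrightarrow> f q = Complex (P1 q) (P2 q) / of_real (Q q)"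
    by (rule rational_on_positiveE[OF assms(1)]) (rule that)
  obtain P1' P2' Q' where g: "real_polynomial_function P1'" "real_polynomial_function P2'" "real_polynomial_function Q'"
    "\<And>q. q \<in> positive \<Longrightarrow> Q' q \<noteq> 0" "\<And>q. Q' q \<noteq> 0 \<Longrightarrow> g q = Complex (P1' q) (P2' q) / of_real (Q' q)"
    by (rule rational_on_positiveE[OF assms(2)]) (rule that)
  show ?thesis
  proof (rule rational_on_positiveI)
    show "real_polynomial_function (\<lambda>q. P1 q * Q' q + P1' q * Q q)" "real_polynomial_function (\<lambda>q. P2 q * Q' q + P2' q * Q q)"
      "real_polynomial_function (\<lambda>q. Q q * Q' q)"
      using f g by (auto intro: real_polynomial_function.intros)
    show "f q + g q = Complex (P1 q * Q' q + P1' q * Q q) (P2 q * Q' q + P2' q * Q q) / of_real (Q q * Q' q)"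
      if "Q q * Q' q \<noteq> 0" for q
      using that f(5)[of q] g(5)[of q]
      by (simp add: complex_eq_iff Re_divide_of_real Im_divide_of_real field_simps del: of_real_mult)
  qed (use f g in auto)
qed

lemma rational_on_positive_mult:
  assumes "rational_on_positive f" "rational_on_positive g"
  shows "rational_on_positive (\<lambda>q. f q * g q)"
proof -
  obtain P1 P2 Q where f: "real_polynomial_function P1" "real_polynomial_function P2" "real_polynomial_function Q"
    "\<And>q. q \<in> positive \<Longrightarrow> Q q \<noteq> 0" "\<And>q. Q q \<noteq> 0 \<Longrightarrow> f q = Complex (P1 q) (P2 q) / of_real (Q q)"
    by (rule rational_on_positiveE[OF assms(1)]) (rule that)
  obtain P1' P2' Q' where g: "real_polynomial_function P1'" "real_polynomial_function P2'" "real_polynomial_function Q'"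
    "\<And>q. q \<in> positive \<Longrightarrow> Q' q \<noteq> 0" "\<And>q. Q' q \<noteq> 0 \<Longrightarrow> g q = Complex (P1' q) (P2' q) / of_real (Q' q)"
    by (rule rational_on_positiveE[OF assms(2)]) (rule that)
  show ?thesis
  proof (rule rational_on_positiveI)
    show "real_polynomial_function (\<lambda>q. P1 q * P1' q - P2 q * P2' q)" "real_polynomial_function (\<lambda>q. P1 q * P2' q + P2 q * P1' q)"
      "real_polynomial_function (\<lambda>q. Q q * Q' q)"
      using f g by (auto intro: real_polynomial_function.intros)
    have "Complex a b * Complex c d = Complex (a * c - b * d) (a * d + b * c)" for a b c d
      by (simp add: complex_eq_iff)
    then show "f q * g q = Complex (P1 q * P1' q - P2 q * P2' q) (P1 q * P2' q + P2 q * P1' q) / of_real (Q q * Q' q)"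
      if "Q q * Q' q \<noteq> 0" for q
      using that f(5)[of q] g(5)[of q] by simp
  qed (use f g in auto)
qed

lemma rational_on_positive_sum:
  "finite A \<Longrightarrow> (\<And>a. a \<in> A \<Longrightarrow> rational_on_positive (f a)) \<Longrightarrow> rational_on_positive (\<lambda>q. \<Sum>a\<in>A. f a q)"
  by (induction A rule: finite_induct) (auto intro: rational_on_positive_const rational_on_positive_add)

lemma rational_on_positive_prod:
  "finite A \<Longrightarrow> (\<And>a. a \<in> A \<Longrightarrow> rational_on_positive (f a)) \<Longrightarrow> rational_on_positive (\<lambda>q. \<Prod>a\<in>A. f a q)"
  by (induction A rule: finite_induct) (auto intro: rational_on_positive_const rational_on_positive_mult)

lemma real_polynomial_function_nth: "real_polynomial_function (\<lambda>q :: real ^ 'e. q $ i)"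
  by (rule real_polynomial_function.intros) (rule bounded_linear_vec_nth)

lemma rational_on_positive_coordinate:
  "i \<in> arcs G \<Longrightarrow> rational_on_positive (\<lambda>q. 1 / of_real (q $ i))"
  by (rule rational_on_positiveI[of "\<lambda>_. 1" "\<lambda>_. 0" "\<lambda>q. q $ i"])
    (auto intro: real_polynomial_function.intros real_polynomial_function_nth simp: positive_def complex_eq_iff)

lemma rational_on_positive_energy:
  assumes "U \<noteq> {}" "U \<subset> verts G"
  shows "rational_on_positive (\<lambda>q. 1 / energy N q U)"
proof -
  define s where "s q = (\<Sum>i\<in>cut U. q $ i)" for q :: "real ^ 'e"
  define n where "n = real_of_int (\<Sum>v\<in>U. N v)"
  have e: "energy N q U = Complex (s q) (- n)" for q
    by (simp add: energy_def s_def n_def complex_eq_iff)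
  have s: "real_polynomial_function s"
    unfolding s_def using finite_subset[OF cut_subset finite_arcs]
    by (intro real_polynomial_function_sum real_polynomial_function_nth) auto
  show ?thesis
  proof (rule rational_on_positiveI)
    show "real_polynomial_function s" by (rule s)
    show "real_polynomial_function (\<lambda>_. n)" by (rule real_polynomial_function.intros)
    show "real_polynomial_function (\<lambda>q. s q * s q + n * n)"
      by (intro real_polynomial_function.intros s)
    show "s q * s q + n * n \<noteq> 0" if "q \<in> positive" for q
      using energy_nonzero[OF that assms, of N] unfolding e complex_eq_iff by (auto simp: sum_squares_eq_zero_iff)
    show "1 / energy N q U = Complex (s q) n / of_real (s q * s q + n * n)" if "s q * s q + n * n \<noteq> 0" for q
      unfolding e using that by (simp add: complex_eq_iff Re_divide Im_divide power2_eq_square)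
  qed
qed

lemma rational_on_positive_time_ordered: "rational_on_positive (time_ordered N)"
proof -
  have "rational_on_positive (\<lambda>p. of_real (pi ^ card (arcs G) / (2 * pi) ^ card inner_verts) *
    (\<Prod>i\<in>arcs G. 1 / of_real (p $ i)) * (\<Sum>\<sigma>\<in>permutations_of_set (verts G). \<Prod>k=1..<length \<sigma>. 1 / energy N p (set (take k \<sigma>))))"
    by (intro rational_on_positive_mult rational_on_positive_const rational_on_positive_prod rational_on_positive_sum
        rational_on_positive_coordinate rational_on_positive_energy set_take_permutation) auto
  then show ?thesis unfolding time_ordered_def ordered_term_def .
qed

lemma real_polynomial_function_flip_signs:
  assumes "real_polynomial_function p"
  shows "real_polynomial_function (\<lambda>q :: real ^ 'e. p (flip_signs A q))"
proof -
  have "bounded_linear (flip_signs A :: real ^ 'e \<Rightarrow> real ^ 'e)"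
    unfolding linear_conv_bounded_linear[symmetric]
    by (rule linearI) (auto simp: flip_signs_def vec_eq_iff)
  then show ?thesis
    using real_polynomial_function_compose[OF polynomial_function_bounded_linear assms] by (simp add: o_def)
qed

lemma flip_signs_involution: "flip_signs A (flip_signs A q) = q"
  by (simp add: flip_signs_def vec_eq_iff)

lemma positive_one: "(\<chi> i. 1) \<in> positive"
  by (simp add: positive_def)

lemma reflected_denominators:
  assumes "real_polynomial_function Q" and "\<And>q. q \<in> positive \<Longrightarrow> Q q \<noteq> 0"
    and "p \<in> (\<lambda>A q. Q (flip_signs A q)) ` Pow (arcs G)"
  shows "real_polynomial_function p \<and> (\<exists>a. p a \<noteq> 0)"
proof -
  obtain A where p: "p = (\<lambda>q. Q (flip_signs A q))" using assms(3) by auto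
  have "p (flip_signs A (\<chi> i. 1)) \<noteq> 0" using assms(2)[OF positive_one] by (simp add: p flip_signs_involution)
  then show ?thesis using real_polynomial_function_flip_signs[OF assms(1)] p by blast
qed

text \<open>At positive \<open>q\<close> the imaginary part of the time-ordered expression vanishes
  because the integral is real. Its numerator is a polynomial, hence zero identically, and the
  expression is real at reflected points as well.\<close>

lemma ex_closed_form:
  assumes N: "(\<Sum>v\<in>verts G. N v) = 0"
  obtains P Q where "closed_form G N T P Q"
    "\<And>q. Q q \<noteq> 0 \<Longrightarrow> time_ordered N q = of_real (P q / Q q)"
proof -
  obtain P1 P2 Q where f: "real_polynomial_function P1" "real_polynomial_function P2" "real_polynomial_function Q"
    "\<And>q. q \<in> positive \<Longrightarrow> Q q \<noteq> 0" "\<And>q. Q q \<noteq> 0 \<Longrightarrow> time_ordered N q = Complex (P1 q) (P2 q) / of_real (Q q)"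
    by (rule rational_on_positiveE[OF rational_on_positive_time_ordered[of N]]) (rule that)
  have *: "of_real (matsubara_integral G N T q) = Complex (P1 q) (P2 q) / of_real (Q q)" if "q \<in> positive" for q
    using matsubara_integral_eq[OF that N] f(5)[OF f(4)[OF that]] by simp
  then have re: "matsubara_integral G N T q = P1 q / Q q" and im: "P2 q = 0" if "q \<in> positive" for q
    using f(4)[OF that] *[OF that] by (auto simp: complex_eq_iff Re_divide_of_real Im_divide_of_real)
  have "P2 q = 0" for q
    using real_polynomial_function_eq_0[OF f(2) open_positive _ im] positive_one by blast
  then have "time_ordered N q = of_real (P1 q / Q q)" if "Q q \<noteq> 0" for q
    using f(5)[OF that] by (simp add: complex_eq_iff Re_divide_of_real Im_divide_of_real)
  moreover have "closed_form G N T P1 Q"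
    unfolding closed_form_def using f re by (auto simp: positive_def)
  ultimately show thesis using that by blast
qed

text \<open>After cross-multiplication the two closed forms differ by a polynomial that vanishes on
  the positive orthant. An arbitrary closed form can thus be traded for the time-ordered one even at
  reflected arguments.\<close>

lemma closed_form_unique:
  assumes "closed_form G N T P Q" "closed_form G N T P' Q'" "Q q \<noteq> 0" "Q' q \<noteq> 0"
  shows "P q / Q q = P' q / Q' q"
proof -
  have "P q * Q' q - P' q * Q q = 0"
  proof (rule real_polynomial_function_eq_0[OF _ open_positive])
    show "real_polynomial_function (\<lambda>q. P q * Q' q - P' q * Q q)"
      using assms(1,2) by (auto simp: closed_form_def intro!: real_polynomial_function_diff real_polynomial_function.intros(4))
    show "P x * Q' x - P' x * Q x = 0" if "x \<in> positive" for x
    proof -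
      have "Q x \<noteq> 0" "Q' x \<noteq> 0" "P x / Q x = P' x / Q' x"
        using assms(1,2) that unfolding closed_form_def positive_def by (metis (mono_tags, lifting) mem_Collect_eq)+
      then show ?thesis by (simp add: field_simps)
    qed
  qed (use positive_one in auto)
  then show ?thesis using assms by (simp add: field_simps)
qed

section \<open>Expansion of the operator and passage to all points\<close>

text \<open>Each factor is \<open>(1 + bose (q $ i)) - bose (q $ i) * R\<close>, so expanding the
  product chooses for every line between keeping the function and reflecting it with a minus sign;
  \<open>B\<close> is the set of reflected lines.\<close>

lemma fold_line_operator:
  assumes "finite A"
  shows "Finite_Set.fold line_operator f A q =
    (\<Sum>B\<in>Pow A. (\<Prod>i\<in>A. if i \<in> B then bose (q $ i) else 1 + bose (q $ i)) * ((- 1) ^ card B * f (flip_signs B q)))"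
  using assms
proof (induction A arbitrary: q rule: finite_induct)
  case empty
  then show ?case by (simp add: flip_signs_def)
next
  case (insert x A)
  interpret comp_fun_commute line_operator by (rule comp_fun_commute_line_operator)
  let ?w = "\<lambda>S B q. \<Prod>i\<in>S. if i \<in> B then bose (q $ i) else 1 + bose (q $ i)"
  let ?F = "\<lambda>q. Finite_Set.fold line_operator f A q"
  \<comment> \<open>Reflecting \<open>x\<close> does not affect the weights of the other lines, each
    of which depends on its own coordinate only.\<close>
  have flip: "?w A B (flip_signs {x} q) = ?w A B q" for B
    using insert.hyps by (intro prod.cong refl) (auto simp: flip_signs_nth)
  have flip2: "flip_signs B (flip_signs {x} q) = flip_signs (insert x B) q" if "x \<notin> B" for B
    using that by (auto simp: flip_signs_def vec_eq_iff)
  have w1: "?w (insert x A) B q = (1 + bose (q $ x)) * ?w A B q" if "x \<notin> B" for B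
    using insert.hyps that by simp
  have w2: "?w (insert x A) (insert x B) q = bose (q $ x) * ?w A B q" for B
    using insert.hyps by (auto intro!: prod.cong)
  have xB: "x \<notin> B" "finite B" if "B \<in> Pow A" for B using that insert.hyps finite_subset by auto
  have "Finite_Set.fold line_operator f (insert x A) q = (1 + bose (q $ x)) * ?F q - bose (q $ x) * ?F (flip_signs {x} q)"
    using insert.hyps by (simp add: fold_insert line_operator_def reflection_def algebra_simps)
  also have "(1 + bose (q $ x)) * ?F q = (\<Sum>B\<in>Pow A. ?w (insert x A) B q * ((- 1) ^ card B * f (flip_signs B q)))"
    unfolding insert.IH sum_distrib_left
    by (intro sum.cong refl) (simp only: w1[OF xB(1)] mult.assoc)
  also have "bose (q $ x) * ?F (flip_signs {x} q) =
    (\<Sum>B\<in>Pow A. - (?w (insert x A) (insert x B) q * ((- 1) ^ card (insert x B) * f (flip_signs (insert x B) q))))"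
    unfolding insert.IH sum_distrib_left
  proof (intro sum.cong refl)
    fix B assume B: "B \<in> Pow A"
    show "bose (q $ x) * (?w A B (flip_signs {x} q) * ((- 1) ^ card B * f (flip_signs B (flip_signs {x} q)))) =
      - (?w (insert x A) (insert x B) q * ((- 1) ^ card (insert x B) * f (flip_signs (insert x B) q)))"
      unfolding w2 flip flip2[OF xB(1)[OF B]] using xB[OF B] by simp
  qed
  also have "(\<Sum>B\<in>Pow A. ?w (insert x A) B q * ((- 1) ^ card B * f (flip_signs B q))) -
    (\<Sum>B\<in>Pow A. - (?w (insert x A) (insert x B) q * ((- 1) ^ card (insert x B) * f (flip_signs (insert x B) q)))) =
    (\<Sum>B\<in>Pow A. ?w (insert x A) B q * ((- 1) ^ card B * f (flip_signs B q))) +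
    (\<Sum>B\<in>insert x ` Pow A. ?w (insert x A) B q * ((- 1) ^ card B * f (flip_signs B q)))"
  proof -
    have "inj_on (insert x) (Pow A)" using insert.hyps by (auto simp: inj_on_def)
    then show ?thesis by (simp add: sum_negf sum.reindex)
  qed
  also have "\<dots> = (\<Sum>B\<in>Pow (insert x A). ?w (insert x A) B q * ((- 1) ^ card B * f (flip_signs B q)))"
    unfolding Pow_insert using insert.hyps by (intro sum.union_disjoint[symmetric]) auto
  finally show ?case .
qed

lemma matsubara_operator_eq:
  "of_real (matsubara_operator G f q) =
    (\<Sum>A\<in>Pow (arcs G). bose_weight q A * ((- 1) ^ card A * of_real (f (flip_signs A q))))"
  unfolding matsubara_operator_def fold_line_operator[OF finite_arcs] bose_weight_def by simp

lemma continuous_at_closed_form_operator: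
  assumes q: "q \<in> positive" and cf: "closed_form G N T P Q" and reg: "q \<in> regular_points G Q" and X: "X \<longlonglongrightarrow> q"
  shows "(\<lambda>k. matsubara_operator G (\<lambda>p. P p / Q p) (X k)) \<longlonglongrightarrow> matsubara_operator G (\<lambda>p. P p / Q p) q"
  unfolding matsubara_operator_def fold_line_operator[OF finite_arcs]
proof (intro tendsto_sum tendsto_mult tendsto_const tendsto_divide tendsto_prod)
  fix A assume A: "A \<in> Pow (arcs G)"
  have "real_polynomial_function P" "real_polynomial_function Q" using cf by (auto simp: closed_form_def)
  then have c: "isCont (\<lambda>q. P (flip_signs A q)) q" "isCont (\<lambda>q. Q (flip_signs A q)) q"
    using continuous_on_real_polynomial_function[OF real_polynomial_function_flip_signs, of _ UNIV]
    by (auto simp: continuous_on_eq_continuous_at)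
  show "(\<lambda>k. P (flip_signs A (X k))) \<longlonglongrightarrow> P (flip_signs A q)" "(\<lambda>k. Q (flip_signs A (X k))) \<longlonglongrightarrow> Q (flip_signs A q)"
    using isCont_tendsto_compose[OF c(1) X] isCont_tendsto_compose[OF c(2) X] by simp_all
  show "Q (flip_signs A q) \<noteq> 0" using reg A by (simp add: regular_points_def)
  fix i assume i: "i \<in> arcs G"
  have "exp (2 * pi * q $ i) - 1 \<noteq> 0" using q i by (auto simp: positive_def)
  then have "(\<lambda>k. bose (X k $ i)) \<longlonglongrightarrow> bose (q $ i)"
    unfolding bose_def by (intro tendsto_intros tendsto_vec_nth X)
  then show "(\<lambda>k. if i \<in> A then bose (X k $ i) else 1 + bose (X k $ i)) \<longlonglongrightarrow> (if i \<in> A then bose (q $ i) else 1 + bose (q $ i))"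
    by (cases "i \<in> A") (auto intro: tendsto_intros)
qed

text \<open>A point regular for \<open>Q\<close> may still be a pole of reflected time-ordered
  terms. The identity is proved at nearby points avoiding this, and both sides are continuous at
  \<open>q\<close>.\<close>

lemma matsubara_sum_regular:
  assumes q: "q \<in> positive" and N: "(\<Sum>v\<in>verts G. N v) = 0"
    and cf: "closed_form G N T P Q" and reg: "q \<in> regular_points G Q"
  shows "matsubara_sum G N q = matsubara_operator G (\<lambda>p. P p / Q p) q"
proof -
  obtain P' Q' where cf': "closed_form G N T P' Q'" and t: "\<And>q. Q' q \<noteq> 0 \<Longrightarrow> time_ordered N q = of_real (P' q / Q' q)"
    using ex_closed_form[OF N] by blast
  \<comment> \<open>All reflections of both denominators have to be nonzero for the two closed forms
    to be compared term by term.\<close>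
  let ?F = "\<lambda>Q. (\<lambda>A q. Q (flip_signs A q)) ` Pow (arcs G)"
  have den: "real_polynomial_function p \<and> (\<exists>a. p a \<noteq> 0)" if "p \<in> ?F Q \<union> ?F Q'" for p
  proof -
    have "real_polynomial_function R \<and> (\<forall>q\<in>positive. R q \<noteq> 0)" if "closed_form G N T S R" for S R
      using that by (auto simp: closed_form_def positive_def)
    from this[OF cf] this[OF cf'] show ?thesis
      using that reflected_denominators[of Q p] reflected_denominators[of Q' p] by blast
  qed
  have eq: "matsubara_sum G N x = matsubara_operator G (\<lambda>p. P p / Q p) x"
    if x: "x \<in> positive" "generic N x" "\<forall>p\<in>?F Q \<union> ?F Q'. p x \<noteq> 0" for x
  proof -
    have "time_ordered N (flip_signs A x) = of_real (P (flip_signs A x) / Q (flip_signs A x))" if "A \<in> Pow (arcs G)" for A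
    proof -
      have "Q (flip_signs A x) \<noteq> 0" "Q' (flip_signs A x) \<noteq> 0" using x(3) that by auto
      then show ?thesis using t closed_form_unique[OF cf cf'] by simp
    qed
    then have "complex_of_real (matsubara_sum G N x) = of_real (matsubara_operator G (\<lambda>p. P p / Q p) x)"
      unfolding matsubara_sum_generic[OF x(1,2) N] matsubara_operator_eq by (intro sum.cong refl) simp
    then show ?thesis by (simp only: of_real_eq_iff)
  qed
  define S where "S = {x \<in> positive. generic N x \<and> (\<forall>p\<in>?F Q \<union> ?F Q'. p x \<noteq> 0)}"
  have "q islimpt S"
    unfolding S_def using den by (intro generic_islimpt[OF q]) auto
  then obtain X where X: "\<forall>k. X k \<in> S - {q}" "X \<longlonglongrightarrow> q"
    unfolding islimpt_sequential by blast
  have "(\<lambda>k. matsubara_sum G N (X k)) \<longlonglongrightarrow> matsubara_sum G N q"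
    using q by (intro tendsto_matsubara_sum N X(2)) (auto simp: positive_def)
  moreover have "matsubara_sum G N (X k) = matsubara_operator G (\<lambda>p. P p / Q p) (X k)" for k
    using X(1) unfolding S_def by (intro eq) simp_all
  ultimately have "(\<lambda>k. matsubara_operator G (\<lambda>p. P p / Q p) (X k)) \<longlonglongrightarrow> matsubara_sum G N q" by simp
  then show ?thesis
    using continuous_at_closed_form_operator[OF q cf reg X(2)] by (rule LIMSEQ_unique)
qed

text \<open>Ensures that the limit along regular points is not vacuous.\<close>

lemma islimpt_regular_points:
  assumes "closed_form G N T P Q"
  shows "q islimpt regular_points G Q"
proof -
  have "q islimpt (UNIV \<inter> {x. \<forall>p\<in>(\<lambda>A q. Q (flip_signs A q)) ` Pow (arcs G). p x \<noteq> 0})"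
    using assms by (intro common_nonzero_islimpt reflected_denominators[of Q]) (auto simp: closed_form_def positive_def)
  then show ?thesis by (rule islimpt_subset) (auto simp: regular_points_def)
qed

text \<open>At regular points near \<open>q\<close> the operator equals the sum, which is
  continuous. So the poles of the individual reflected terms cancel and the identity persists as a
  limit.\<close>

lemma tendsto_matsubara_operator:
  assumes q: "q \<in> positive" and N: "(\<Sum>v\<in>verts G. N v) = 0" and cf: "closed_form G N T P Q"
  shows "(matsubara_operator G (\<lambda>p. P p / Q p) \<longlongrightarrow> matsubara_sum G N q) (at q within regular_points G Q)"
proof (rule Lim_transform_eventually)
  show "(matsubara_sum G N \<longlongrightarrow> matsubara_sum G N q) (at q within regular_points G Q)"
    unfolding tendsto_at_iff_sequentially o_def
    using q by (auto intro!: tendsto_matsubara_sum N simp: positive_def)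
  have "\<forall>\<^sub>F x in at q within regular_points G Q. x \<in> positive"
    using q open_positive by (intro eventually_at_topological[THEN iffD2]) blast
  moreover have "\<forall>\<^sub>F x in at q within regular_points G Q. x \<in> regular_points G Q"
    by (simp add: eventually_at_filter)
  ultimately show "\<forall>\<^sub>F x in at q within regular_points G Q. matsubara_sum G N x = matsubara_operator G (\<lambda>p. P p / Q p) x"
    by eventually_elim (rule matsubara_sum_regular[OF _ N cf])
qed

end

theorem theorem3p1:
  fixes G :: "('v, 'e::finite) pre_digraph"
    and N :: "'v \<Rightarrow> int"
    and q :: "real ^ 'e"
    and T :: "'e set"
  assumes "matsubara_graph G"
    and "\<And>i. i \<in> arcs G \<Longrightarrow> 0 < q $ i"
    and "(\<Sum>v\<in>verts G. N v) = 0"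
    and "spanning_tree_lines G T"
  shows "matsubara_summand G N q summable_on (arcs G \<rightarrow>\<^sub>E UNIV) \<and>
    integrable (Pi\<^sub>M (arcs G - T) (\<lambda>_. lborel)) (matsubara_integrand G N T q) \<and>
    (\<exists>P Q. closed_form G N T P Q) \<and>
    (\<forall>P Q. closed_form G N T P Q \<longrightarrow>
      (q \<in> regular_points G Q \<longrightarrow>
        matsubara_sum G N q = matsubara_operator G (\<lambda>p. P p / Q p) q) \<and>
      q islimpt regular_points G Q \<and>
      (matsubara_operator G (\<lambda>p. P p / Q p) \<longlongrightarrow> matsubara_sum G N q)
        (at q within regular_points G Q))"
proof -
  interpret matsubara_graph G by fact
  interpret matsubara_tree G T by unfold_locales fact
  have q: "q \<in> positive" using assms(2) by (simp add: positive_def)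
  \<comment> \<open>Summability and integrability show that the sum and the integral are genuine
    values, not the default 0 of a divergent expression.\<close>
  have "matsubara_summand G N q summable_on (arcs G \<rightarrow>\<^sub>E UNIV)"
    using assms(2) by (intro summable_on_matsubara_summand) (auto simp: less_imp_neq[THEN not_sym])
  moreover have "integrable (Pi\<^sub>M (arcs G - T) (\<lambda>_. lborel)) (matsubara_integrand G N T q)"
    using assms(3,2) by (rule integrable_matsubara_integrand)
  moreover have "\<exists>P Q. closed_form G N T P Q"
    using ex_closed_form[OF assms(3)] by blast
  ultimately show ?thesis
    using matsubara_sum_regular[OF q assms(3)] islimpt_regular_points tendsto_matsubara_operator[OF q assms(3)]
    by blast
qed

end
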